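(* Assume $N\ge3$ and $\frac{N}{N-2}<p<\frac{N+2}{N-2}$. If $\overline M\le M<0$ there exists no ground state of (E). Moreover there exists a positive solution $u$ of (E) on $(0,\infty)$, unique up to the similarity transformations $u\mapsto k^{\frac{2}{p-1}}u(k\,\cdot)$, $k>0$, satisfying $u(r)\sim U_M(r)$ as $r\to0$ and $u(r)\sim cr^{2-N}$ for some $c>0$ as $r\to\infty$.
   Context: (E) denotes the ODE $-u_{rr}-\frac{N-1}{r}u_r=|u|^{p-1}u+M|u_r|^{\frac{2p}{p+1}}$ for $r>0$. A ground state is a nonnegative $u\in C^2([0,\infty))$ with $u_r(0)=0$ solving (E) on $(0,\infty)$. Let $K=\frac{(N-2)p-N}{p-1}$; for $M<0$, $X_M$ is the unique positive root of $X^{p-1}+M\left(\frac{2}{p-1}\right)^{\frac{2p}{p+1}}X^{\frac{p-1}{p+1}}-\frac{2K}{p-1}=0$ and $U_M(r)=X_Mr^{-\frac{2}{p-1}}$. $\overline M=\frac{(p+1)((N-2)p-N-2)}{(4p)^{\frac{p}{p+1}}((N-2)(p-1)^2+4)^{\frac{1}{p+1}}}$, which is negative here. $f\sim g$ means $f/g\to1$.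
   Formalization: A ground state is required to be not identically zero; under the literal definition (nonnegative C² solution with u_r(0)=0) the function u=0 is a ground state, so the nonexistence claim would be false. *)

theory Defs
  imports "HOL-Analysis.Analysis" "HOL-Library.Landau_Symbols"
begin

text \<open>The ODE (E):  -u'' - (N-1)/r u' = |u|^(p-1) u + M |u'|^(2p/(p+1)),
  written pointwise at r with u1 = u', u2 = u''.\<close>
definition E_eq :: "nat \<Rightarrow> real \<Rightarrow> real \<Rightarrow> real \<Rightarrow> real \<Rightarrow> real \<Rightarrow> real \<Rightarrow> bool" where
  "E_eq N p M r u0 u1 u2 \<longleftrightarrow>
     - u2 - (real N - 1) / r * u1 = \<bar>u0\<bar> powr (p - 1) * u0 + M * \<bar>u1\<bar> powr (2 * p / (p + 1))"

definition solves_E :: "nat \<Rightarrow> real \<Rightarrow> real \<Rightarrow> (real \<Rightarrow> real) \<Rightarrow> bool" where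
  "solves_E N p M u \<longleftrightarrow>
     (\<exists>u1 u2. \<forall>r>0. (u has_real_derivative u1 r) (at r) \<and>
                     (u1 has_real_derivative u2 r) (at r) \<and>
                     E_eq N p M r (u r) (u1 r) (u2 r))"

definition ground_state :: "nat \<Rightarrow> real \<Rightarrow> real \<Rightarrow> (real \<Rightarrow> real) \<Rightarrow> bool" where
  "ground_state N p M u \<longleftrightarrow>
     (\<forall>r\<ge>0. u r \<ge> 0) \<and> (\<exists>r\<ge>0. u r \<noteq> 0) \<and>
     (\<exists>u1 u2. (\<forall>r\<ge>0. (u has_real_derivative u1 r) (at r within {0..}) \<and>
                        (u1 has_real_derivative u2 r) (at r within {0..})) \<and>
              continuous_on {0..} u2 \<and> u1 0 = 0 \<and>
              (\<forall>r>0. E_eq N p M r (u r) (u1 r) (u2 r)))"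

definition K_const :: "nat \<Rightarrow> real \<Rightarrow> real" where
  "K_const N p = ((real N - 2) * p - real N) / (p - 1)"

definition X_M :: "nat \<Rightarrow> real \<Rightarrow> real \<Rightarrow> real" where
  "X_M N p M = (THE X. X > 0 \<and>
      X powr (p - 1) + M * (2 / (p - 1)) powr (2 * p / (p + 1)) * X powr ((p - 1) / (p + 1))
        - 2 * K_const N p / (p - 1) = 0)"

definition U_M :: "nat \<Rightarrow> real \<Rightarrow> real \<Rightarrow> real \<Rightarrow> real" where
  "U_M N p M r = X_M N p M * r powr (- 2 / (p - 1))"

definition Mbar :: "nat \<Rightarrow> real \<Rightarrow> real" where
  "Mbar N p = (p + 1) * ((real N - 2) * p - real N - 2) /
     ((4 * p) powr (p / (p + 1)) * ((real N - 2) * (p - 1)^2 + 4) powr (1 / (p + 1)))"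

definition singular_sol :: "nat \<Rightarrow> real \<Rightarrow> real \<Rightarrow> (real \<Rightarrow> real) \<Rightarrow> bool" where
  "singular_sol N p M u \<longleftrightarrow>
     (\<forall>r>0. u r > 0) \<and> solves_E N p M u \<and>
     (u \<sim>[at_right 0] U_M N p M) \<and>
     (\<exists>c>0. u \<sim>[at_top] (\<lambda>r. c * r powr (2 - real N)))"

end

theory Submission
  imports Defs "HOL-Real_Asymp.Real_Asymp"
begin

text \<open>With \<open>t = ln r\<close>, \<open>a = 2/(p-1)\<close>, \<open>x = r\<^sup>a u\<close> and \<open>y = - r\<^sup>a\<^sup>+\<^sup>1 u'\<close> the equation becomes the autonomous
  system \<open>x' = a x - y\<close>, \<open>y' = x\<^sup>p - K y - m |y|\<^sup>q\<close> with \<open>m = -M\<close>, \<open>q = 2p/(p+1)\<close>. The origin is a saddle: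
  ground states leave it along its unstable manifold, and solutions decaying like \<open>r\<^sup>2\<^sup>-\<^sup>N\<close> enter it along
  its stable manifold. The condition \<open>Mbar \<le> M\<close> says exactly that, for suitable \<open>\<alpha>\<close> and \<open>b\<close>, the Dulac factor
  \<open>x\<^sup>-\<^sup>\<alpha> y\<^sup>b\<close> makes the divergence nonnegative. For a planar system with \<open>x' = a x - y\<close> this yields a strict
  Lyapunov function: if \<open>H\<^sub>y = x\<^sup>-\<^sup>\<alpha> y\<^sup>b x'\<close> and \<open>J = H\<^sub>x + x\<^sup>-\<^sup>\<alpha> y\<^sup>b y'\<close>, then \<open>J\<^sub>y\<close> is the divergence, and
  \<open>L(x,y) = H(x,y) - \<integral>\<^sub>0\<^sup>x J(s, a s) ds\<close> has derivative \<open>-(y - a x)(J(x,y) - J(x,a x)) \<le> 0\<close>. It vanishes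
  at the origin and is maximal at the fixed point, so a ground state has \<open>L < 0\<close>, which is incompatible
  with staying in the quadrant, whereas the stable manifold has \<open>L > 0\<close>, stays in a compact part of the
  quadrant backwards in time and comes from the fixed point.\<close>

section \<open>Calculus on the real line\<close>

text \<open>The exponents are tuned to each other: with s = p/(p+1) the product (y/x)^s
  (x^p/y)^(1-s) is exactly y^(q-1), so the weighted arithmetic-geometric mean inequality absorbs the
  gradient term for all x, y > 0 at once. The weights \<open>b\<close> and \<open>\<alpha>\<close>
  do not depend on \<open>m\<close>, hence an inequality that is sharp at one value of
  \<open>m\<close> holds for all smaller ones; that value, -Mbar, is where the linearisation at the
  fixed point has trace zero. Two obstacles shape the rest. The weight x^(-\<alpha>) is singular on
  the axis x = 0, so L tends to 0 at the origin only along orbits of bounded slope y/x, and every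
  passage to that limit needs such a bound first. The stable manifold has its data at t = infinity:
  once the decay is scaled out, \<xi> = e^(K t) x and \<eta> = e^(K t) y, the variable e^(-k t) with
  k = (q-1) K turns infinity into an ordinary initial point, where a contraction argument applies to
  truncated nonlinearities.\<close>

lemma barbalat_at_bot:
  fixes f g :: "real \<Rightarrow> real"
  assumes d: "\<And>t. t \<le> c \<Longrightarrow> (f has_real_derivative g t) (at t)"
    and l: "(f \<longlongrightarrow> l) at_bot" and uc: "uniformly_continuous_on {..c} g"
  shows "(g \<longlongrightarrow> 0) at_bot"
proof (rule tendstoI)
  fix e :: real assume e: "e > 0"
  obtain \<delta> where \<delta>: "\<delta> > 0" "\<And>s t. s \<le> c \<Longrightarrow> t \<le> c \<Longrightarrow> dist s t < \<delta> \<Longrightarrow> dist (g s) (g t) < e/2"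
    using uc e unfolding uniformly_continuous_on_def by (meson atMost_iff half_gt_zero)
  \<comment> \<open>Over a window of length \<open>h\<close> the function \<open>f\<close> changes
    by less than e*h/2, so the mean value theorem yields a point with |g| < e/2; uniform continuity
    carries this back to \<open>t\<close>.\<close>
  define h where "h = \<delta>/2"
  have h: "h > 0" "h < \<delta>" using \<delta>(1) by (auto simp: h_def)
  have "\<forall>\<^sub>F t in at_bot. dist (f t) l < e*h/4"
    using l e h by (intro tendstoD) auto
  then obtain T where T: "\<And>t. t \<le> T \<Longrightarrow> dist (f t) l < e*h/4"
    unfolding eventually_at_bot_linorder by blast
  show "\<forall>\<^sub>F t in at_bot. dist (g t) 0 < e"
    unfolding eventually_at_bot_linorder
  proof (intro exI allI impI)
    fix t assume t: "t \<le> min T c - h"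
    have "\<exists>z. t < z \<and> z < t+h \<and> f (t+h) - f t = (t + h - t) * g z"
      using h t by (intro MVT2 d) auto
    then obtain z where z: "t < z" "z < t+h" "f (t+h) - f t = h * g z" by auto
    have "\<bar>h * g z\<bar> < e*h/2"
      using T[of t] T[of "t+h"] t h z(3) unfolding dist_real_def by linarith
    hence "h * \<bar>g z\<bar> < h * (e/2)" using h by (simp add: abs_mult mult.commute)
    hence "\<bar>g z\<bar> < e/2" using h by simp
    moreover have "dist (g t) (g z) < e/2"
      using z t h by (intro \<delta>(2)) (auto simp: dist_real_def)
    ultimately show "dist (g t) 0 < e" unfolding dist_real_def by linarith
  qed
qed

lemma tendsto_derivative_zero_at_top:
  fixes f g :: "real \<Rightarrow> real"
  assumes d: "\<And>t. t \<ge> c \<Longrightarrow> (f has_real_derivative g t) (at t)"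
    and l: "(f \<longlongrightarrow> l) at_top" and g: "(g \<longlongrightarrow> l') at_top"
  shows "l' = 0"
proof (rule ccontr)
  assume "l' \<noteq> 0"
  then have e: "\<bar>l'\<bar>/4 > 0" by simp
  from tendstoD[OF l e] tendstoD[OF g e]
  have "\<forall>\<^sub>F t in at_top. dist (f t) l < \<bar>l'\<bar>/4 \<and> dist (g t) l' < \<bar>l'\<bar>/4" by eventually_elim auto
  then obtain T where T: "\<And>t. t \<ge> T \<Longrightarrow> dist (f t) l < \<bar>l'\<bar>/4 \<and> dist (g t) l' < \<bar>l'\<bar>/4"
    unfolding eventually_at_top_linorder by blast
  define t where "t = max T c"
  have "\<exists>z. t < z \<and> z < t+1 \<and> f (t+1) - f t = (t + 1 - t) * g z"
    by (intro MVT2 d) (auto simp: t_def)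
  then obtain z where z: "t < z" "z < t+1" "f (t+1) - f t = g z" by auto
  have "z \<ge> T" "t \<ge> T" "t + 1 \<ge> T" using z by (auto simp: t_def)
  from T[OF this(1)] T[OF this(2)] T[OF this(3)] z(3) show False
    unfolding dist_real_def by linarith
qed

text \<open>On the compact set where |\<Psi>| >= e the function \<Phi> has a positive minimum, so
  \<Phi> tending to 0 expels the orbit from it. This replaces limit sets: vanishing dissipation is
  turned into vanishing x', and later into convergence to the fixed point.\<close>

lemma compact_zero_set_tendsto:
  fixes \<Phi> \<Psi> :: "'a::metric_space \<Rightarrow> real" and z :: "'b \<Rightarrow> 'a"
  assumes "compact S" "continuous_on S \<Phi>" "continuous_on S \<Psi>"
    and zS: "\<forall>\<^sub>F t in F. z t \<in> S"
    and pos: "\<And>w. w \<in> S \<Longrightarrow> \<Phi> w \<ge> 0" and zero: "\<And>w. w \<in> S \<Longrightarrow> \<Phi> w = 0 \<Longrightarrow> \<Psi> w = 0"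
    and lim: "((\<lambda>t. \<Phi> (z t)) \<longlongrightarrow> 0) F"
  shows "((\<lambda>t. \<Psi> (z t)) \<longlongrightarrow> 0) F"
proof (rule tendstoI)
  fix e :: real assume e: "e > 0"
  define S' where "S' = S \<inter> {w. e \<le> \<bar>\<Psi> w\<bar>}"
  have "closed {w \<in> S. e \<le> \<bar>\<Psi> w\<bar>}"
    using assms(1,3) by (intro continuous_on_closed_Collect_le continuous_intros compact_imp_closed)
  hence "compact (S \<inter> {w \<in> S. e \<le> \<bar>\<Psi> w\<bar>})" using assms(1) by (rule compact_Int_closed[rotated])
  moreover have "S \<inter> {w \<in> S. e \<le> \<bar>\<Psi> w\<bar>} = S'" by (auto simp: S'_def)
  ultimately have "compact S'" by simp
  show "\<forall>\<^sub>F t in F. dist (\<Psi> (z t)) 0 < e"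
  proof (cases "S' = {}")
    case True
    show ?thesis using zS by eventually_elim (use True in \<open>auto simp: S'_def dist_real_def not_le\<close>)
  next
    case False
    have "continuous_on S' \<Phi>" using assms(2) by (rule continuous_on_subset) (auto simp: S'_def)
    then obtain w0 where w0: "w0 \<in> S'" "\<And>w. w \<in> S' \<Longrightarrow> \<Phi> w0 \<le> \<Phi> w"
      using continuous_attains_inf[OF \<open>compact S'\<close> False] by blast
    have "\<Phi> w0 > 0" using w0(1) pos[of w0] zero[of w0] e by (force simp: S'_def less_le)
    with lim have "\<forall>\<^sub>F t in F. dist (\<Phi> (z t)) 0 < \<Phi> w0" by (intro tendstoD) auto
    with zS show ?thesis
    proof eventually_elim
      case (elim t)
      hence "z t \<notin> S'" using w0(2)[of "z t"] by (auto simp: dist_real_def)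
      with elim show ?case by (auto simp: S'_def dist_real_def not_le)
    qed
  qed
qed

section \<open>A Lyapunov function for the phase plane system\<close>

text \<open>The assumptions collect what the phase plane argument needs. \<open>rel\<close> cancels
  the linear terms of the divergence, \<open>young\<close> says that what remains, divided by
  x^(-\<alpha>) y^b, is nonnegative, and \<open>young_eq\<close> locates its zeros.
  \<open>below_X\<close> and \<open>above_X\<close> give the sign of y' on the line y = a x.\<close>

locale emden =
  fixes a K p q m b \<alpha> X :: real
  assumes a0: "a > 0" and K0: "K > 0" and p1: "p > 1" and q_eq: "q = 2*p/(p+1)" and m0: "m > 0"
    and b0: "b > 0" and \<alpha>0: "\<alpha> > 0" and \<alpha>1: "\<alpha> < 1" and rel: "a*(1-\<alpha>) = K*(b+1)"
    and young: "\<And>x y. 0 < x \<Longrightarrow> 0 < y \<Longrightarrow> m*(q+b)*y powr (q-1) \<le> \<alpha>*(y/x) + b*(x powr p/y)"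
    and young_eq: "\<And>x y. 0 < x \<Longrightarrow> 0 < y \<Longrightarrow> m*(q+b)*y powr (q-1) = \<alpha>*(y/x) + b*(x powr p/y) \<Longrightarrow>
                      \<alpha>*(y/x) = p*b*(x powr p/y)"
    and X0: "X > 0"
    and below_X: "\<And>x. 0 < x \<Longrightarrow> x < X \<Longrightarrow> x powr p < K*(a*x) + m*(a*x) powr q"
    and above_X: "\<And>x. X < x \<Longrightarrow> x powr p > K*(a*x) + m*(a*x) powr q"
begin

lemma q_bounds: "1 < q" "q < 2" "q < p"
  using p1 unfolding q_eq by (auto simp: field_simps)

lemma q_p: "(q-1)*(p+1) = p-1"
  using p1 unfolding q_eq by (simp add: field_simps)

text \<open>This is H_x + x^(-\<alpha>) y^b y' for H = a/(b+1) x^(1-\<alpha>) y^(b+1) -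
  x^(-\<alpha>) y^(b+2)/(b+2). The two terms in y^(b+1), one from H_x and one from -K y, have
  cancelled by \<open>rel\<close>.\<close>

definition J :: "real \<Rightarrow> real \<Rightarrow> real" where
  "J x y = x powr (-\<alpha>) * (\<alpha>/(b+2) * y powr (b+2) / x + x powr p * y powr b - m * y powr (q+b))"

lemma J_deriv:
  assumes "x > 0" "y > 0"
  shows "(J x has_real_derivative x powr (-\<alpha>) * y powr b * (\<alpha>*(y/x) + b*(x powr p/y) - m*(q+b)*y powr (q-1))) (at y)"
proof -
  have e: "y powr (b+1) = y powr b * y" "y powr (b-1) = y powr b / y"
     "y powr (q+b-1) = y powr b * y powr (q-1)"
    using assms by (auto simp: powr_add powr_diff)
  have b2: "b + 2 \<noteq> 0" using b0 by simp
  have d: "((\<lambda>y. y powr c) has_real_derivative c * y powr (c-1)) (at y)" for c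
    using assms(2) by (rule has_real_derivative_powr)
  have "((\<lambda>y. x powr (-\<alpha>) * (\<alpha>/(b+2) * y powr (b+2) / x + x powr p * y powr b - m * y powr (q+b)))
     has_real_derivative x powr (-\<alpha>) * (\<alpha>/(b+2) * ((b+2) * y powr (b+2-1)) / x + x powr p * (b * y powr (b-1))
        - m * ((q+b) * y powr (q+b-1)))) (at y)"
    by (intro DERIV_cmult DERIV_add DERIV_diff DERIV_cdivide d)
  moreover have "b + 2 - 1 = b + 1" by simp
  moreover have "x powr (-\<alpha>) * (\<alpha>/(b+2) * ((b+2) * (y powr b * y)) / x + x powr p * (b * (y powr b / y))
        - m * ((q+b) * (y powr b * y powr (q-1)))) 
     = x powr (-\<alpha>) * y powr b * (\<alpha>*(y/x) + b*(x powr p/y) - m*(q+b)*y powr (q-1))"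
    using assms b2 by (simp add: divide_simps) (simp add: algebra_simps)
  ultimately show ?thesis unfolding J_def by (simp only: e)
qed

text \<open>Strictness comes from \<open>young_eq\<close>: were J not strictly increasing, its
  derivative would vanish on a whole interval, but for fixed x the zeros satisfy y^2 = (p
  b/\<alpha>) x^(p+1), which leaves a single positive y.\<close>

lemma J_mono: 
  assumes "x > 0" "0 < y1" "y1 < y2"
  shows "J x y1 < J x y2"
proof (rule ccontr)
  assume neg: "\<not> J x y1 < J x y2"
  define J' where "J' = (\<lambda>y. x powr (-\<alpha>) * y powr b * (\<alpha>*(y/x) + b*(x powr p/y) - m*(q+b)*y powr (q-1)))"
  have d: "(J x has_real_derivative J' y) (at y)" if "y > 0" for y
    unfolding J'_def using J_deriv[OF assms(1) that] .
  have nn: "J' y \<ge> 0" if "y > 0" for y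
    unfolding J'_def using young[OF assms(1) that] assms(1) that by simp
  have mono: "J x u \<le> J x v" if "0 < u" "u \<le> v" for u v
    using that by (intro DERIV_nonneg_imp_nondecreasing[OF that(2)]) (meson d nn less_le_trans)
  have const: "J x y = J x y1" if "y1 \<le> y" "y \<le> y2" for y
    using mono[of y1 y] mono[of y y2] that assms neg by linarith
  have zero: "J' y = 0" if "y1 < y" "y < y2" for y
  proof (rule DERIV_local_const[OF d])
    show "0 < min (y - y1) (y2 - y)" using that by simp
    show "\<forall>z. \<bar>y - z\<bar> < min (y - y1) (y2 - y) \<longrightarrow> J x y = J x z"
    proof (intro allI impI)
      fix z assume "\<bar>y - z\<bar> < min (y - y1) (y2 - y)"
      hence "y1 \<le> z" "z \<le> y2" by linarith+
      thus "J x y = J x z" using const[of y] const[of z] that by simp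
    qed
  qed (use that assms in auto)
  have sq: "y * y = (p * b / \<alpha>) * x powr p * x" if "y1 < y" "y < y2" for y
  proof -
    have y: "y > 0" using that assms by simp
    have "m*(q+b)*y powr (q-1) = \<alpha>*(y/x) + b*(x powr p/y)"
      using zero[OF that] y assms(1) by (simp add: J'_def)
    from young_eq[OF assms(1) y this] show ?thesis using y assms(1) \<alpha>0 by (simp add: field_simps)
  qed
  define u where "u = y1 + (y2-y1)/3"
  define v where "v = y1 + (y2-y1)/2"
  have uv: "y1 < u" "u < v" "v < y2" using assms by (auto simp: u_def v_def field_simps)
  have "u * u = v * v" using sq[of u] sq[of v] uv by simp
  moreover have "u * u < v * v" using uv assms by (intro mult_strict_mono) auto
  ultimately show False by simp
qed

lemma J_0: "J x 0 = 0" using b0 q_bounds by (simp add: J_def)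

lemma J_nonneg:
  assumes "x > 0" "y \<ge> 0" shows "J x y \<ge> 0"
proof (cases "y = 0")
  case False
  hence y: "y > 0" using assms by simp
  have "J x 0 \<le> J x y"
  proof (rule DERIV_nonneg_imp_increasing_open[of 0 y])
    show "continuous_on {0..y} (J x)" unfolding J_def using assms b0 q_bounds
      by (auto intro!: continuous_intros continuous_on_powr')
    fix z assume "0 < z" "z < y"
    thus "\<exists>d. (J x has_real_derivative d) (at z) \<and> 0 \<le> d"
      using young[OF assms(1), of z] J_deriv[OF assms(1), of z] assms(1) by (metis diff_ge_0_iff_ge mult_nonneg_nonneg powr_ge_zero)
  qed (use y in auto)
  thus ?thesis by (simp add: J_0)
qed (simp add: J_0)

text \<open>The integral of J(s, a s) over 0 < s < x, computed term by term; since \<alpha> < 1 all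
  exponents are positive and no boundary term arises at 0.\<close>

definition C :: "real \<Rightarrow> real" where
  "C x = \<alpha>/(b+2) * a powr (b+2) * (x powr (b+2-\<alpha>) / (b+2-\<alpha>)) + a powr b * (x powr (p+b+1-\<alpha>) / (p+b+1-\<alpha>))
     - m * a powr (q+b) * (x powr (q+b+1-\<alpha>) / (q+b+1-\<alpha>))"

lemma C_deriv: assumes "x > 0" shows "(C has_real_derivative J x (a*x)) (at x)"
proof -
  have d: "((\<lambda>y. y powr c / c) has_real_derivative x powr (c-1)) (at x)" if "c > 0" for c
    using DERIV_cdivide[OF has_real_derivative_powr[OF assms, of c], of c] that by simp
  have "((\<lambda>x. \<alpha>/(b+2) * a powr (b+2) * (x powr (b+2-\<alpha>) / (b+2-\<alpha>)) + a powr b * (x powr (p+b+1-\<alpha>) / (p+b+1-\<alpha>))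
     - m * a powr (q+b) * (x powr (q+b+1-\<alpha>) / (q+b+1-\<alpha>))) has_real_derivative
      \<alpha>/(b+2) * a powr (b+2) * x powr (b+2-\<alpha>-1) + a powr b * x powr (p+b+1-\<alpha>-1)
       - m * a powr (q+b) * x powr (q+b+1-\<alpha>-1)) (at x)"
    using \<alpha>1 b0 q_bounds p1 by (intro DERIV_cmult DERIV_add DERIV_diff DERIV_cdivide d) auto
  moreover have "x powr (b+2-\<alpha>-1) = x powr (-\<alpha>) * x powr (b+2) / x"
     "x powr (p+b+1-\<alpha>-1) = x powr (-\<alpha>) * x powr p * x powr b"
     "x powr (q+b+1-\<alpha>-1) = x powr (-\<alpha>) * x powr (q+b)"
  proof -
    have "x powr (-\<alpha>) * x powr (b+2) / x powr 1 = x powr (-\<alpha> + (b+2) - 1)" by (simp only: powr_add powr_diff)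
    moreover have "-\<alpha> + (b+2) - 1 = b+2-\<alpha>-1" by simp
    ultimately show "x powr (b+2-\<alpha>-1) = x powr (-\<alpha>) * x powr (b+2) / x" using assms by simp
    show "x powr (p+b+1-\<alpha>-1) = x powr (-\<alpha>) * x powr p * x powr b"
     "x powr (q+b+1-\<alpha>-1) = x powr (-\<alpha>) * x powr (q+b)"
      by (simp_all add: powr_add[symmetric] algebra_simps)
  qed
  ultimately show ?thesis unfolding C_def J_def using assms a0
    by (simp add: powr_mult algebra_simps)
qed

lemma C_0: "C 0 = 0" unfolding C_def by simp

lemma C_cont: "continuous_on {0..} C"
  unfolding C_def using \<alpha>1 b0 q_bounds p1
  by (auto intro!: continuous_intros continuous_on_powr')

lemma C_nonneg: assumes "x \<ge> 0" shows "C x \<ge> 0"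
proof (cases "x = 0")
  case False
  hence x: "x > 0" using assms by simp
  have "C 0 \<le> C x"
  proof (rule DERIV_nonneg_imp_increasing_open[of 0 x])
    show "continuous_on {0..x} C" by (rule continuous_on_subset[OF C_cont]) auto
    fix z assume "0 < z" "z < x"
    thus "\<exists>d. (C has_real_derivative d) (at z) \<and> 0 \<le> d"
      using J_nonneg[of z "a*z"] a0 C_deriv[of z] by (metis less_eq_real_def mult_nonneg_nonneg)
  qed (use x in auto)
  thus ?thesis by (simp add: C_0)
qed (simp add: C_0)

definition L :: "real \<Rightarrow> real \<Rightarrow> real" where
  "L x y = a/(b+1) * x powr (1-\<alpha>) * y powr (b+1) - x powr (-\<alpha>) * y powr (b+2) / (b+2) - C x"

lemma L_alt: assumes "x > 0" "y > 0"
  shows "L x y = x powr (-\<alpha>) * y powr (b+1) * (a*x/(b+1) - y/(b+2)) - C x"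
proof -
  have "x powr (1-\<alpha>) = x powr (-\<alpha>) * x" "y powr (b+2) = y powr (b+1) * y"
    using assms by (simp_all add: powr_diff powr_add powr_minus field_simps power2_eq_square)
  thus ?thesis unfolding L_def by (simp add: right_diff_distrib mult_ac)
qed

text \<open>The chain rule gives H_x x' + H_y y' - J(x, a x) x'. As H_y is x^(-\<alpha>) y^b x', the
  factor x' comes out and leaves J(x, y) - J(x, a x).\<close>

lemma L_deriv:
  assumes x: "(x has_real_derivative a * x t - y t) (at t)"
    and y: "(y has_real_derivative y') (at t)" and y': "y' = x t powr p - K * y t - m * \<bar>y t\<bar> powr q"
    and pos: "x t > 0" "y t > 0"
  shows "((\<lambda>t. L (x t) (y t)) has_real_derivative - ((y t - a * x t) * (J (x t) (y t) - J (x t) (a * x t)))) (at t)"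
proof -
  define x' where "x' = a * x t - y t"
  have px: "((\<lambda>t. x t powr c) has_real_derivative c * x t powr (c-1) * x') (at t)" for c
    using DERIV_chain2[OF has_real_derivative_powr[OF pos(1), of c] x] by (simp add: x'_def)
  have py: "((\<lambda>t. y t powr c) has_real_derivative c * y t powr (c-1) * y') (at t)" for c
    using DERIV_chain2[OF has_real_derivative_powr[OF pos(2), of c] y] by simp
  have C: "((\<lambda>t. C (x t)) has_real_derivative J (x t) (a * x t) * x') (at t)"
    using DERIV_chain2[OF C_deriv[OF pos(1)] x] by (simp add: x'_def)
  have "((\<lambda>t. L (x t) (y t)) has_real_derivative
     ((a/(b+1) * ((1-\<alpha>) * x t powr (1-\<alpha>-1) * x')) * y t powr (b+1) + 
      ((b+1) * y t powr (b+1-1) * y') * (a/(b+1) * x t powr (1-\<alpha>)))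
     - (((-\<alpha>) * x t powr (-\<alpha>-1) * x') * y t powr (b+2) + ((b+2) * y t powr (b+2-1) * y') * x t powr (-\<alpha>)) / (b+2)
     - J (x t) (a * x t) * x') (at t)"
    unfolding L_def by (intro DERIV_diff DERIV_mult DERIV_cdivide C DERIV_cmult px py)
  moreover have "a/(b+1) * ((1-\<alpha>) * x t powr (1-\<alpha>-1) * x') * y t powr (b+1) + 
      ((b+1) * y t powr (b+1-1) * y') * (a/(b+1) * x t powr (1-\<alpha>))
     - (((-\<alpha>) * x t powr (-\<alpha>-1) * x') * y t powr (b+2) + ((b+2) * y t powr (b+2-1) * y') * x t powr (-\<alpha>)) / (b+2)
     = x' * J (x t) (y t)"
  proof -
    define A B1 where "A = x t powr (-\<alpha>)" and "B1 = y t powr b"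
    have e: "x t powr (1-\<alpha>-1) = A" "y t powr (b+1) = B1 * y t" "y t powr (b+1-1) = B1" "x t powr (1-\<alpha>) = A * x t"
      "x t powr (-\<alpha>-1) = A / x t" "y t powr (b+2) = B1 * y t * y t" "y t powr (b+2-1) = B1 * y t"
      "y t powr (q+b) = B1 * y t powr q"
      using pos by (simp_all add: A_def B1_def powr_diff powr_add powr_minus field_simps power2_eq_square)
    \<comment> \<open>The coefficient of x^(-\<alpha>) y^(b+1) in H_x is therefore K, and it cancels
      the damping term -K y of y'.\<close>
    have "a * (1-\<alpha>)/(b+1) = K" using rel b0 by (simp add: field_simps)
    hence "a/(b+1) * ((1-\<alpha>) * A * x') * (B1 * y t) = K * A * x' * (B1 * y t)"
      by (metis (no_types, lifting) mult.assoc mult.commute times_divide_eq_left)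
    moreover have "((b+1) * B1 * y') * (a/(b+1) * (A * x t)) - ((b+2) * (B1 * y t) * y') * A / (b+2) = A * B1 * y' * x'"
    proof -
      have nz: "b + 1 \<noteq> 0" "b + 2 \<noteq> 0" using b0 by auto
      have "((b+1) * B1 * y') * (a/(b+1) * (A * x t)) = B1 * y' * a * A * x t"
        "((b+2) * (B1 * y t) * y') * A / (b+2) = B1 * y t * y' * A" using nz by simp_all
      thus ?thesis by (simp only: x'_def) (simp add: algebra_simps)
    qed
    moreover have "- ((-\<alpha>) * (A / x t) * x' * (B1 * y t * y t)) / (b+2) = x' * A * (\<alpha>/(b+2) * (B1 * y t * y t) / x t)"
      by (simp add: field_simps)
    moreover have "A * B1 * y' * x' + K * A * x' * (B1 * y t) = x' * A * (x t powr p * B1 - m * (B1 * y t powr q))"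
      using pos by (simp add: y' algebra_simps)
    ultimately show ?thesis unfolding e J_def A_def[symmetric] B1_def[symmetric]
      by (simp add: add_divide_distrib diff_divide_distrib ring_distribs del: times_divide_eq_right times_divide_eq_left minus_divide_left[symmetric])
  qed
  ultimately have "((\<lambda>t. L (x t) (y t)) has_real_derivative x' * J (x t) (y t) - J (x t) (a * x t) * x') (at t)"
    by simp
  thus ?thesis by (simp add: x'_def algebra_simps)
qed

lemma diss_pos: assumes "x > 0" "y > 0" "y \<noteq> a * x"
  shows "(y - a*x) * (J x y - J x (a*x)) > 0"
  using J_mono[OF assms(1,2), of "a*x"] J_mono[OF assms(1), of "a*x" y] assms a0
  by (cases "y < a*x") (auto intro: mult_neg_neg)

lemma diss_nonneg: assumes "x > 0" "y > 0"
  shows "(y - a*x) * (J x y - J x (a*x)) \<ge> 0"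
  using diss_pos[OF assms] by (cases "y = a*x") auto

text \<open>Along the diagonal, L(x, a x) vanishes at 0 and has derivative (a x)^b x^(-\<alpha>) (K
  a x + m (a x)^q - x^p), which \<open>below_X\<close> makes positive up to the fixed point.\<close>

lemma L_diag_pos: assumes "0 < x" "x \<le> X" shows "L x (a*x) > 0"
proof -
  define g where "g = (\<lambda>x. a powr (b+1) * K * (x powr (b+2-\<alpha>) / (b+2-\<alpha>)) - a powr b * (x powr (p+b+1-\<alpha>) / (p+b+1-\<alpha>))
     + m * a powr (q+b) * (x powr (q+b+1-\<alpha>) / (q+b+1-\<alpha>)))"
  have Lg: "L x (a*x) = g x" if "x > 0" for x
  proof -
    have e: "a powr (b+1) = a powr b * a" "a powr (b+2) = a powr b * a * a"
      using a0 by (simp_all add: powr_add power2_eq_square)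
    have e': "x powr (1-\<alpha>) * x powr (b+1) = x powr (b+2-\<alpha>)"
      "x powr (-\<alpha>) * x powr (b+2) = x powr (b+2-\<alpha>)"
      by (simp_all add: powr_add[symmetric] algebra_simps)
    have "K = a*(1-\<alpha>)/(b+1)" using rel b0 by (simp add: field_simps)
    \<comment> \<open>The three terms in x^(b+2-\<alpha>), two from H and one from C, collapse
      because 1/(b+1) - 1/(b+2-\<alpha>) = (1-\<alpha>)/((b+1)(b+2-\<alpha>)); \<open>rel\<close>
      then turns the numerator into K.\<close>
    moreover have "a/(b+1) * (a powr b * a) * Q - (a powr b * a * a) * Q / (b+2) - \<alpha>/(b+2) * (a powr b * a * a) * (Q/(b+2-\<alpha>))
       = (a powr b * a) * (a*(1-\<alpha>)/(b+1)) * (Q/(b+2-\<alpha>))" for Q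
    proof -
      have "b+1 > 0" "b+2 > 0" "b+2-\<alpha> > 0" using b0 \<alpha>1 by auto
      thus ?thesis by (simp add: divide_simps) (simp add: algebra_simps)
    qed
    moreover have "L x (a*x) = a/(b+1) * (a powr b * a) * (x powr (1-\<alpha>) * x powr (b+1))
        - (a powr b * a * a) * (x powr (-\<alpha>) * x powr (b+2)) / (b+2) - C x"
      unfolding L_def using that a0 by (simp add: powr_mult e mult_ac)
    ultimately show ?thesis unfolding e' g_def C_def e by (smt (verit))
  qed
  have d: "((\<lambda>y. y powr c / c) has_real_derivative z powr (c-1)) (at z)" if "c > 0" "z > 0" for c z :: real
    using DERIV_cdivide[OF has_real_derivative_powr[OF that(2), of c], of c] that by simp
  have dg: "(g has_real_derivative a powr b * z powr (b-\<alpha>) * (K*(a*z) + m*(a*z) powr q - z powr p)) (at z)" if z: "z > 0" for z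
  proof -
    have "(g has_real_derivative a powr (b+1) * K * z powr (b+2-\<alpha>-1) - a powr b * z powr (p+b+1-\<alpha>-1)
       + m * a powr (q+b) * z powr (q+b+1-\<alpha>-1)) (at z)" unfolding g_def
      using \<alpha>1 b0 q_bounds p1 z by (intro DERIV_cmult DERIV_add DERIV_diff DERIV_cdivide d) auto
    moreover have e: "z powr (b+2-\<alpha>-1) = z powr (b-\<alpha>) * z" "z powr (p+b+1-\<alpha>-1) = z powr (b-\<alpha>) * z powr p"
      "z powr (q+b+1-\<alpha>-1) = z powr (b-\<alpha>) * z powr q"
      "a powr (b+1) = a powr b * a" "a powr (q+b) = a powr b * a powr q"
      using z a0 by (simp_all add: powr_add powr_diff field_simps power2_eq_square)
    ultimately show ?thesis unfolding e using z a0 by (simp add: powr_mult algebra_simps)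
  qed
  have "g 0 < g x"
  proof (rule DERIV_pos_imp_increasing_open[of 0 x])
    show "continuous_on {0..x} g" unfolding g_def using \<alpha>1 b0 q_bounds p1
      by (auto intro!: continuous_intros continuous_on_powr')
    fix z assume z: "0 < z" "z < x"
    have "a powr b * z powr (b-\<alpha>) * (K*(a*z) + m*(a*z) powr q - z powr p) > 0"
      using below_X[of z] z a0 assms by (intro mult_pos_pos) auto
    with dg z show "\<exists>d. (g has_real_derivative d) (at z) \<and> 0 < d" by blast
  qed (use assms in auto)
  moreover have "g 0 = 0" by (simp add: g_def)
  ultimately show ?thesis using Lg assms by simp
qed

end

section \<open>Comparison estimates and first exit times\<close>

lemma gronwall_le:
  fixes f :: "real \<Rightarrow> real"
  assumes "S \<le> T" and cont: "continuous_on {S..T} f"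
    and d: "\<And>t. S < t \<Longrightarrow> t < T \<Longrightarrow> \<exists>d. (f has_real_derivative d) (at t) \<and> d \<le> c * f t"
  shows "f T \<le> exp (c * (T - S)) * f S"
proof -
  define g where "g = (\<lambda>t. exp (- c * (t - S)) * f t)"
  have "g T \<le> g S"
  proof (rule DERIV_nonpos_imp_decreasing_open[OF assms(1)])
    show "continuous_on {S..T} g" unfolding g_def by (intro continuous_intros cont)
    fix t assume t: "S < t" "t < T"
    from d[OF t] obtain d where d: "(f has_real_derivative d) (at t)" "d \<le> c * f t" by blast
    have "(g has_real_derivative exp (- c * (t - S)) * (d - c * f t)) (at t)" unfolding g_def
      by (auto intro!: derivative_eq_intros d(1) simp: algebra_simps)
    moreover have "exp (- c * (t - S)) * (d - c * f t) \<le> 0" using d(2) by (simp add: mult_nonneg_nonpos)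
    ultimately show "\<exists>d. (g has_real_derivative d) (at t) \<and> d \<le> 0" by blast
  qed
  hence "exp (- c * (T - S)) * f T \<le> f S" by (simp add: g_def)
  hence "exp (c * (T - S)) * (exp (- c * (T - S)) * f T) \<le> exp (c * (T - S)) * f S" by (intro mult_left_mono) auto
  moreover have "exp (c * (T - S)) * (exp (- c * (T - S)) * f T) = f T"
    by (simp add: mult.assoc[symmetric] exp_minus_inverse)
  ultimately show ?thesis by (simp only:)
qed

lemma gronwall_le':
  fixes f :: "real \<Rightarrow> real"
  assumes "S \<le> T"
    and d: "\<And>t. S \<le> t \<Longrightarrow> t \<le> T \<Longrightarrow> (f has_real_derivative f' t) (at t) \<and> f' t \<le> c * f t"
  shows "f T \<le> exp (c * (T - S)) * f S"
proof (rule gronwall_le[OF assms(1)])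
  show "continuous_on {S..T} f"
    by (rule DERIV_continuous_on[where D = f']) (use d in \<open>auto intro: has_field_derivative_at_within\<close>)
  show "\<exists>d. (f has_real_derivative d) (at t) \<and> d \<le> c * f t" if "S < t" "t < T" for t
    using d[of t] that by auto
qed

lemma first_zero:
  fixes h :: "real \<Rightarrow> real"
  assumes "continuous_on {s..t} h" "h s > 0" "h t \<le> 0" "s \<le> t"
  obtains z where "s < z" "z \<le> t" "h z = 0" "\<And>u. s \<le> u \<Longrightarrow> u < z \<Longrightarrow> h u > 0"
proof -
  define S where "S = {u \<in> {s..t}. h u \<le> 0}"
  have "closed S" unfolding S_def
    using assms(1) by (intro continuous_on_closed_Collect_le continuous_intros) auto
  moreover have ne: "t \<in> S" using assms by (auto simp: S_def)
  moreover have bb: "bdd_below S" by (rule bdd_belowI[of _ s]) (auto simp: S_def)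
  ultimately have z: "Inf S \<in> S" by (intro closed_contains_Inf) auto
  define z where "z = Inf S"
  have zS: "s \<le> z" "z \<le> t" "h z \<le> 0" using z by (auto simp: S_def z_def)
  have pos: "h u > 0" if "s \<le> u" "u < z" for u
  proof (rule ccontr)
    assume "\<not> h u > 0"
    hence "u \<in> S" using that zS by (auto simp: S_def)
    hence "z \<le> u" unfolding z_def by (rule cInf_lower[OF _ bb])
    thus False using that by simp
  qed
  have "h z = 0"
  proof -
    have "\<exists>x\<ge>s. x \<le> z \<and> h x = 0"
      by (rule IVT2') (use zS assms in \<open>auto intro: continuous_on_subset\<close>)
    then obtain x where "s \<le> x" "x \<le> z" "h x = 0" by blast
    thus ?thesis using pos[of x] by (cases "x = z") auto
  qed
  moreover have "s < z" using zS assms(2) \<open>h z = 0\<close> by (cases "s = z") auto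
  ultimately show ?thesis using that zS pos by blast
qed

lemma barbalat_at_top:
  fixes f g :: "real \<Rightarrow> real"
  assumes d: "\<And>t. t \<ge> c \<Longrightarrow> (f has_real_derivative g t) (at t)"
    and l: "(f \<longlongrightarrow> l) at_top" and uc: "uniformly_continuous_on {c..} g"
  shows "(g \<longlongrightarrow> 0) at_top"
proof -
  have "((\<lambda>t. - g (- t)) \<longlongrightarrow> 0) at_bot"
  proof (rule barbalat_at_bot)
    show "((\<lambda>t. f (- t)) has_real_derivative - g (- t)) (at t)" if "t \<le> - c" for t
      using DERIV_mirror[of f "g (-t)" t] d[of "-t"] that by simp
    show "((\<lambda>t. f (- t)) \<longlongrightarrow> l) at_bot" using l by (simp add: filterlim_at_top_mirror)
    show "uniformly_continuous_on {..- c} (\<lambda>t. - g (- t))"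
      unfolding uniformly_continuous_on_def
    proof safe
      fix e :: real assume "e > 0"
      with uc obtain d where d: "d > 0" "\<And>x y. x \<in> {c..} \<Longrightarrow> y \<in> {c..} \<Longrightarrow> dist y x < d \<Longrightarrow> dist (g y) (g x) < e"
        unfolding uniformly_continuous_on_def by meson
      show "\<exists>d>0. \<forall>x\<in>{..- c}. \<forall>x'\<in>{..- c}. dist x' x < d \<longrightarrow> dist (- g (- x')) (- g (- x)) < e"
        using d(1) d(2)[of "- _" "- _"] by (intro exI[of _ d]) (auto simp: dist_minus)
    qed
  qed
  hence "((\<lambda>t. - g t) \<longlongrightarrow> 0) at_top" by (simp add: filterlim_at_bot_mirror)
  thus ?thesis by (rule tendsto_minus_cancel[where a = 0, simplified])
qed

lemma uniformly_continuous_bounded_deriv: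
  fixes f :: "real \<Rightarrow> real"
  assumes "convex S" "\<And>t. t \<in> S \<Longrightarrow> (f has_real_derivative f' t) (at t)" "\<And>t. t \<in> S \<Longrightarrow> \<bar>f' t\<bar> \<le> B"
  shows "uniformly_continuous_on S f"
proof -
  have "(max B 0)-lipschitz_on S f"
  proof (rule lipschitz_onI)
    fix x y assume "x \<in> S" "y \<in> S"
    have "norm (f x - f y) \<le> max B 0 * norm (x - y)"
      by (rule field_differentiable_bound[OF assms(1), of f f'])
         (use assms \<open>x \<in> S\<close> \<open>y \<in> S\<close> in \<open>auto intro: has_field_derivative_at_within simp: max.coboundedI1\<close>)
    thus "dist (f x) (f y) \<le> max B 0 * dist x y" by (simp add: dist_norm)
  qed auto
  thus ?thesis by (rule lipschitz_on_uniformly_continuous)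
qed

section \<open>Trajectories and their limits at infinity\<close>

context emden
begin

text \<open>Signs are kept out of the definition: that of y has to be derived both for ground states
  and for fast decaying solutions, hence the absolute value.\<close>

definition traj :: "(real \<Rightarrow> real) \<Rightarrow> (real \<Rightarrow> real) \<Rightarrow> bool" where
  "traj x y \<longleftrightarrow> (\<forall>t. (x has_real_derivative a * x t - y t) (at t) \<and>
     (y has_real_derivative x t powr p - K * y t - m * \<bar>y t\<bar> powr q) (at t))"

lemma trajD: assumes "traj x y"
  shows "(x has_real_derivative a * x t - y t) (at t)"
    and "(y has_real_derivative x t powr p - K * y t - m * \<bar>y t\<bar> powr q) (at t)"
  using assms by (auto simp: traj_def)

lemma traj_L:
  assumes "traj x y" "x t > 0" "y t > 0"
  shows "((\<lambda>t. L (x t) (y t)) has_real_derivative - ((y t - a * x t) * (J (x t) (y t) - J (x t) (a * x t)))) (at t)"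
  using L_deriv[OF trajD(1,2)[OF assms(1)] refl assms(2,3)] .

lemma fixed_point_unique:
  assumes "\<xi> > 0" "\<xi> powr p = K * (a * \<xi>) + m * (a * \<xi>) powr q"
  shows "\<xi> = X"
  using below_X[of \<xi>] above_X[of \<xi>] assms by (cases "\<xi>" X rule: linorder_cases) auto

lemma L_tendsto:
  assumes "(x \<longlongrightarrow> \<xi>) F" "(y \<longlongrightarrow> \<eta>) F" "\<xi> > 0" "\<eta> > 0"
  shows "((\<lambda>t. L (x t) (y t)) \<longlongrightarrow> L \<xi> \<eta>) F"
proof -
  have "isCont C \<xi>" using C_deriv[OF assms(3)] by (rule DERIV_isCont)
  hence "((\<lambda>t. C (x t)) \<longlongrightarrow> C \<xi>) F" using assms(1) by (rule isCont_tendsto_compose)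
  thus ?thesis unfolding L_def using assms b0 by (intro tendsto_intros) auto
qed

text \<open>Convergence to the origin alone does not control the factor x^(-\<alpha>). With y <= B x
  both terms of H are of order x^(b+2-\<alpha>), a positive power.\<close>

lemma L_tendsto_0:
  assumes "(x \<longlongrightarrow> 0) F" "\<forall>\<^sub>F t in F. x t > 0 \<and> 0 < y t \<and> y t \<le> B * x t"
  shows "((\<lambda>t. L (x t) (y t)) \<longlongrightarrow> 0) F"
proof -
  have B: "\<forall>\<^sub>F t in F. \<bar>L (x t) (y t)\<bar> \<le> a * B powr (b+1) / (b+1) * x t powr (b+2-\<alpha>) + B powr (b+2) / (b+2) * x t powr (b+2-\<alpha>) + C (x t)"
    using assms(2)
  proof eventually_elim
    case (elim t)
    have le: "y t powr c \<le> B powr c * x t powr c" if "c > 0" for c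
    proof -
      have "B > 0" using elim by (smt (verit) zero_less_mult_pos2)
      have "y t powr c \<le> (B * x t) powr c" using elim that by (intro powr_mono2) auto
      thus ?thesis using elim \<open>B > 0\<close> by (simp add: powr_mult)
    qed
    have e: "x t powr (1-\<alpha>) * x t powr (b+1) = x t powr (b+2-\<alpha>)" "x t powr (-\<alpha>) * x t powr (b+2) = x t powr (b+2-\<alpha>)"
      by (simp_all add: powr_add[symmetric] algebra_simps)
    have "0 \<le> a/(b+1) * x t powr (1-\<alpha>) * y t powr (b+1)" using a0 b0 by simp
    moreover have "a/(b+1) * x t powr (1-\<alpha>) * y t powr (b+1) \<le> a/(b+1) * x t powr (1-\<alpha>) * (B powr (b+1) * x t powr (b+1))"
      using a0 b0 by (intro mult_left_mono le) auto
    moreover have "a/(b+1) * x t powr (1-\<alpha>) * (B powr (b+1) * x t powr (b+1)) = a * B powr (b+1) / (b+1) * x t powr (b+2-\<alpha>)"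
      by (simp add: e(1)[symmetric])
    moreover have "0 \<le> x t powr (-\<alpha>) * y t powr (b+2) / (b+2)" using b0 by simp
    moreover have "x t powr (-\<alpha>) * y t powr (b+2) / (b+2) \<le> x t powr (-\<alpha>) * (B powr (b+2) * x t powr (b+2)) / (b+2)"
      using b0 by (intro divide_right_mono mult_left_mono le) auto
    moreover have "x t powr (-\<alpha>) * (B powr (b+2) * x t powr (b+2)) / (b+2) = B powr (b+2) / (b+2) * x t powr (b+2-\<alpha>)"
      by (simp add: e(2)[symmetric])
    moreover have "C (x t) \<ge> 0" using elim by (intro C_nonneg) auto
    ultimately show ?case unfolding L_def by linarith
  qed
  have "((\<lambda>t. x t powr c) \<longlongrightarrow> 0) F" if "c > 0" for c
  proof (rule tendsto_eq_rhs[OF tendsto_powr'[OF assms(1) tendsto_const]])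
    show "0 \<noteq> (0::real) \<or> 0 < c \<and> (\<forall>\<^sub>F t in F. 0 \<le> x t)"
      using that assms(2) by (auto elim!: eventually_mono)
  qed (use that in auto)
  hence p0: "((\<lambda>t. x t powr (b+2-\<alpha>)) \<longlongrightarrow> 0) F" "((\<lambda>t. x t powr (p+b+1-\<alpha>)) \<longlongrightarrow> 0) F" "((\<lambda>t. x t powr (q+b+1-\<alpha>)) \<longlongrightarrow> 0) F"
    using b0 \<alpha>1 p1 q_bounds by auto
  have "((\<lambda>t. a * B powr (b+1) / (b+1) * x t powr (b+2-\<alpha>) + B powr (b+2) / (b+2) * x t powr (b+2-\<alpha>) + C (x t)) \<longlongrightarrow> 
     a * B powr (b+1) / (b+1) * 0 + B powr (b+2) / (b+2) * 0 + (\<alpha>/(b+2) * a powr (b+2) * (0 / (b+2-\<alpha>)) + a powr b * (0 / (p+b+1-\<alpha>))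
     - m * a powr (q+b) * (0 / (q+b+1-\<alpha>)))) F"
    unfolding C_def using b0 \<alpha>1 p1 q_bounds by (intro tendsto_intros p0) auto
  hence "((\<lambda>t. a * B powr (b+1) / (b+1) * x t powr (b+2-\<alpha>) + B powr (b+2) / (b+2) * x t powr (b+2-\<alpha>) + C (x t)) \<longlongrightarrow> 0) F"
    by simp
  thus ?thesis by (rule Lim_null_comparison[rotated]) (use B in simp)
qed

text \<open>Since x converges and x' is uniformly continuous, x' tends to 0, which makes y converge
  to a \<xi>. Then y' converges too, and its limit must vanish, so the limit point is a rest point
  of the field.\<close>

lemma limit_is_equilibrium:
  assumes T: "traj x y" and xl: "(x \<longlongrightarrow> \<xi>) at_top" 
    and xb: "\<And>t. t \<ge> c \<Longrightarrow> x t > 0 \<and> 0 < y t \<and> y t \<le> B" and xB: "\<And>t. t \<ge> c \<Longrightarrow> x t \<le> B"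
  shows "(y \<longlongrightarrow> a * \<xi>) at_top" "\<xi> = 0 \<or> \<xi> = X"
proof -
  have B: "B > 0" using xb[of c] by linarith
  have \<xi>: "\<xi> \<ge> 0" by (rule tendsto_lowerbound[OF xl]) (use xb in \<open>auto intro!: eventually_at_top_linorderI[of c] less_imp_le\<close>)
  define y' where "y' = (\<lambda>t. x t powr p - K * y t - m * \<bar>y t\<bar> powr q)"
  have y'B: "\<bar>y' t\<bar> \<le> B powr p + K * B + m * B powr q" if "t \<ge> c" for t
  proof -
    have "x t powr p \<le> B powr p" "\<bar>y t\<bar> powr q \<le> B powr q" "0 \<le> x t powr p" "0 \<le> \<bar>y t\<bar> powr q"
      using xb[OF that] xB[OF that] p1 q_bounds by (auto intro!: powr_mono2)
    moreover from this have "m * \<bar>y t\<bar> powr q \<le> m * B powr q" "0 \<le> m * \<bar>y t\<bar> powr q"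
       "K * y t \<le> K * B" "0 \<le> K * y t" using m0 K0 xb[OF that] by auto
    ultimately show ?thesis unfolding y'_def by linarith
  qed
  have uc: "uniformly_continuous_on {c..} (\<lambda>t. a * x t - y t)"
  proof (rule uniformly_continuous_bounded_deriv)
    show "((\<lambda>t. a * x t - y t) has_real_derivative a * (a * x t - y t) - y' t) (at t)" for t
      unfolding y'_def by (intro DERIV_diff DERIV_cmult trajD[OF T])
    fix t assume "t \<in> {c..}"
    hence t: "t \<ge> c" by simp
    have "a * x t \<le> a * B" "0 < a * x t" using xb[OF t] xB[OF t] a0 by auto
    hence "\<bar>a * x t - y t\<bar> \<le> a * B + B" using xb[OF t] by linarith
    hence "a * \<bar>a * x t - y t\<bar> \<le> a * (a * B + B)" using a0 by simp
    hence "\<bar>a * (a * x t - y t)\<bar> \<le> a * (a * B + B)" using a0 by (simp add: abs_mult)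
    thus "\<bar>a * (a * x t - y t) - y' t\<bar> \<le> a * (a * B + B) + (B powr p + K * B + m * B powr q)"
      using y'B[OF t] by linarith
  qed auto
  have "((\<lambda>t. a * x t - y t) \<longlongrightarrow> 0) at_top"
    by (rule barbalat_at_top[OF trajD(1)[OF T] xl uc])
  hence "((\<lambda>t. a * x t - (a * x t - y t)) \<longlongrightarrow> a * \<xi> - 0) at_top" by (intro tendsto_intros xl)
  thus yl: "(y \<longlongrightarrow> a * \<xi>) at_top" by simp
  have "(y' \<longlongrightarrow> \<xi> powr p - K * (a * \<xi>) - m * \<bar>a * \<xi>\<bar> powr q) at_top"
    unfolding y'_def using p1 q_bounds xb
    by (intro tendsto_diff tendsto_mult tendsto_const tendsto_powr' tendsto_rabs xl yl disjI2 conjI)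
       (auto intro!: eventually_at_top_linorderI[of c] less_imp_le)
  hence "\<xi> powr p - K * (a * \<xi>) - m * \<bar>a * \<xi>\<bar> powr q = 0"
    using tendsto_derivative_zero_at_top[of c y y', OF _ yl] trajD(2)[OF T] unfolding y'_def by blast
  thus "\<xi> = 0 \<or> \<xi> = X"
    using \<xi> a0 fixed_point_unique[of \<xi>] by (cases "\<xi> = 0") auto
qed

end

section \<open>Trajectories leaving the origin\<close>

lemma mono_bdd_above_tendsto:
  fixes f :: "real \<Rightarrow> real"
  assumes "mono f" "bdd_above (range f)"
  shows "(f \<longlongrightarrow> (SUP t. f t)) at_top"
proof (rule increasing_tendsto)
  show "\<forall>\<^sub>F t in at_top. f t \<le> (SUP t. f t)" using assms(2) by (intro always_eventually allI cSUP_upper) auto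
  fix l assume "l < (SUP t. f t)"
  then obtain s where "l < f s" using less_cSUP_iff[of UNIV f] assms(2) by auto
  thus "\<forall>\<^sub>F t in at_top. l < f t"
    using assms(1) by (intro eventually_at_top_linorderI[of s]) (auto dest: monoD intro: less_le_trans)
qed

lemma antitone_nonneg_tendsto:
  fixes f :: "real \<Rightarrow> real"
  assumes anti: "\<And>s t. c \<le> s \<Longrightarrow> s \<le> t \<Longrightarrow> f t \<le> f s" and nonneg: "\<And>t. c \<le> t \<Longrightarrow> f t \<ge> 0"
  shows "\<exists>l. (f \<longlongrightarrow> l) at_top"
proof -
  define z where "z = (\<lambda>t. - f (max t c))"
  have "(z \<longlongrightarrow> (SUP t. z t)) at_top"
  proof (rule mono_bdd_above_tendsto)
    show "bdd_above (range z)" using nonneg by (intro bdd_aboveI[of _ 0]) (auto simp: z_def)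
    show "mono z" by (auto simp: mono_def z_def intro!: anti)
  qed
  hence "((\<lambda>t. - z t) \<longlongrightarrow> - (SUP t. z t)) at_top" by (rule tendsto_minus)
  moreover have "\<forall>\<^sub>F t in at_top. - z t = f t"
    by (rule eventually_at_top_linorderI[of c]) (simp add: z_def max_def)
  ultimately show ?thesis using tendsto_cong by metis
qed

context emden
begin

text \<open>A trajectory leaving the origin has \<open>L < 0\<close>, while \<open>L > 0\<close> on the part of the line \<open>y = a x\<close>
  up to the fixed point. Hence it crosses this line only to the right of the fixed point, upwards.\<close>

lemma L_neg_crossing:
  assumes "x > 0" "L x (a*x) < 0" shows "x powr p - K*(a*x) - m*\<bar>a*x\<bar> powr q > 0"
proof -
  have "X < x" using L_diag_pos[of x] assms by fastforce
  from above_X[OF this] show ?thesis using assms a0 by simp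
qed

lemma L_fixed_pos: "L X (a*X) > 0" using L_diag_pos[of X] X0 by simp

text \<open>Below the diagonal x increases. If it stays bounded, the limit is the fixed point, where
  L > 0. If not, x^(p-1) dominates the equation for the slope y/x, which then grows past a.\<close>

lemma traj_crosses_diag:
  assumes T: "traj x y" and pos: "\<And>t. x t > 0 \<and> y t > 0" and Lneg: "\<And>t. L (x t) (y t) < 0"
  shows "\<exists>t. y t > a * x t"
proof (rule ccontr)
  assume "\<nexists>t. y t > a * x t"
  hence le: "y t \<le> a * x t" for t by (simp add: not_less)
  have mono: "x s \<le> x t" if "s \<le> t" for s t
    by (rule DERIV_nonneg_imp_nondecreasing[OF that]) (use trajD(1)[OF T] le in \<open>auto intro!: exI\<close>)
  show False
  proof (cases "bdd_above (range x)")
    case True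
    then obtain B where B: "\<And>t. x t \<le> B" by (auto simp: bdd_above_def)
    have xl: "(x \<longlongrightarrow> (SUP t. x t)) at_top"
      by (rule mono_bdd_above_tendsto) (use True mono in \<open>auto simp: mono_def\<close>)
    define \<xi> where "\<xi> = (SUP t. x t)"
    have "x 0 \<le> \<xi>" unfolding \<xi>_def by (rule cSUP_upper[OF _ True]) simp
    hence \<xi>: "\<xi> > 0" using pos[of 0] by simp
    have yB: "y t \<le> max B (a*B)" for t
      using le[of t] B[of t] a0 by (meson max.coboundedI2 mult_left_mono order.trans less_imp_le)
    have xB: "x t \<le> max B (a*B)" for t using B[of t] by (simp add: max.coboundedI1)
    note lim = limit_is_equilibrium[OF T xl[folded \<xi>_def], of 0 "max B (a*B)"]
    have "\<xi> = X" using lim(2) pos yB xB \<xi> by auto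
    moreover have "(y \<longlongrightarrow> a * \<xi>) at_top" using lim(1) pos yB xB by auto
    ultimately have "((\<lambda>t. L (x t) (y t)) \<longlongrightarrow> L X (a*X)) at_top"
      using xl X0 a0 unfolding \<xi>_def by (intro L_tendsto) auto
    hence "L X (a*X) \<le> 0"
      by (rule tendsto_upperbound) (use Lneg in \<open>auto intro!: always_eventually less_imp_le\<close>)
    thus False using L_fixed_pos by simp
  next
    case False
    have xinf: "filterlim x at_top at_top"
      unfolding filterlim_at_top
    proof
      fix Z
      from False obtain s where s: "x s > Z" by (auto simp: bdd_above_def not_le)
      show "\<forall>\<^sub>F t in at_top. Z \<le> x t"
        using mono[of s] s by (intro eventually_at_top_linorderI[of s]) (force intro: order.trans less_imp_le)
    qed
    have "filterlim (\<lambda>x. 1 * x powr (p-1) - m * a powr q * x powr (q-1)) at_top at_top"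
      using q_bounds by real_asymp
    from filterlim_compose[OF this xinf]
    \<comment> \<open>The slope Y = y/x obeys Y' = x^(p-1) - K Y - m y^q/x - Y (a - Y). For 0 < Y <=
      a the terms K*a and a*a dominate K Y and Y (a - Y), and 1 is the growth rate left
      over.\<close>
    have "\<forall>\<^sub>F t in at_top. x t powr (p-1) - m * a powr q * x t powr (q-1) \<ge> K*a + a*a + 1"
      unfolding filterlim_at_top by simp
    then obtain t0 where t0: "\<And>t. t \<ge> t0 \<Longrightarrow> x t powr (p-1) - m * a powr q * x t powr (q-1) \<ge> K*a + a*a + 1"
      unfolding eventually_at_top_linorder by blast
    define Y' where "Y' = (\<lambda>t. ((x t powr p - K * y t - m * \<bar>y t\<bar> powr q) * x t - y t * (a * x t - y t)) / (x t * x t))"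
    have dY: "((\<lambda>t. y t / x t) has_real_derivative Y' t) (at t)" for t
      unfolding Y'_def using pos[of t] by (intro DERIV_divide trajD[OF T]) auto
    have Y'1: "Y' t \<ge> 1" if "t \<ge> t0" for t
    proof -
      define Y where "Y = y t / x t"
      have x: "x t > 0" "y t > 0" using pos by auto
      have Y: "0 < Y" "Y \<le> a" using x le[of t] by (auto simp: Y_def field_simps)
      have yY: "y t = Y * x t" using x by (simp add: Y_def)
      have "Y' t = x t powr p / x t - K * Y - m * (y t powr q / x t) - Y * (a - Y)"
        unfolding Y'_def using x by (simp add: yY field_simps)
      also have "x t powr p / x t = x t powr (p-1)" using x by (simp add: powr_diff)
      finally have e: "Y' t = x t powr (p-1) - K * Y - m * (y t powr q / x t) - Y * (a - Y)" .
      have "y t powr q \<le> (a * x t) powr q" using x le[of t] q_bounds by (intro powr_mono2) auto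
      hence "y t powr q / x t \<le> a powr q * x t powr (q-1)"
        using x a0 by (simp add: powr_mult powr_diff field_simps)
      hence "m * (y t powr q / x t) \<le> m * a powr q * x t powr (q-1)"
        using mult_left_mono[OF _ less_imp_le[OF m0]] by (simp only: mult.assoc)
      moreover have "K * Y \<le> K * a" using Y K0 by simp
      moreover have "Y * (a - Y) \<le> a * a" using Y by (intro mult_mono) auto
      ultimately show ?thesis using t0[OF that] e by linarith
    qed
    \<comment> \<open>At rate at least 1, time a+1 lifts the slope above a from any positive
      starting value.\<close>
    have "y (t0+a+1) / x (t0+a+1) - y t0 / x t0 \<ge> a + 1"
    proof -
      have "\<exists>z>t0. z < t0+a+1 \<and> y (t0+a+1) / x (t0+a+1) - y t0 / x t0 = (t0+a+1 - t0) * Y' z"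
        using a0 dY by (intro MVT2) auto
      then obtain z where "z > t0" "y (t0+a+1) / x (t0+a+1) - y t0 / x t0 = (a+1) * Y' z" by auto
      thus ?thesis using Y'1[of z] a0 by (simp add: mult_le_cancel_left1)
    qed
    moreover have "y t0 / x t0 > 0" using pos by simp
    ultimately have "y (t0+a+1) / x (t0+a+1) > a" using a0 by linarith
    hence "y (t0+a+1) > a * x (t0+a+1)" using pos[of "t0+a+1"] by (simp add: pos_less_divide_eq)
    thus False using le[of "t0+a+1"] by simp
  qed
qed

text \<open>A first return to the diagonal would have y - a x decreasing to 0, but L < 0 puts the
  point beyond the fixed point, where the derivative of y - a x is positive.\<close>

lemma traj_stays_above_diag:
  assumes T: "traj x y" and pos: "\<And>t. x t > 0 \<and> y t > 0" and Lneg: "\<And>t. L (x t) (y t) < 0"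
    and start: "y s > a * x s" and "s \<le> t"
  shows "y t > a * x t"
proof (rule ccontr)
  assume neg: "\<not> y t > a * x t"
  define h where "h = (\<lambda>t. y t - a * x t)"
  have d: "(h has_real_derivative (x t powr p - K * y t - m * \<bar>y t\<bar> powr q) - a * (a * x t - y t)) (at t)" for t
    unfolding h_def by (intro DERIV_diff DERIV_cmult trajD[OF T])
  have "continuous_on {s..t} h" by (rule DERIV_continuous_on[OF has_field_derivative_at_within[OF d]])
  moreover have "h s > 0" "h t \<le> 0" using start neg by (simp_all add: h_def)
  ultimately obtain z where z: "s < z" "h z = 0" "\<And>u. s \<le> u \<Longrightarrow> u < z \<Longrightarrow> h u > 0"
    using \<open>s \<le> t\<close> by (rule first_zero) blast
  have yz: "y z = a * x z" using z(2) by (simp add: h_def)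
  have "x z powr p - K*(a*x z) - m*\<bar>a*x z\<bar> powr q > 0"
    using L_neg_crossing[of "x z"] pos[of z] Lneg[of z] yz by simp
  hence "\<exists>d>0. \<forall>k>0. k < d \<longrightarrow> h (z - k) < h z"
    using d[of z] yz by (intro DERIV_pos_inc_left) auto
  then obtain d where d: "d > 0" "\<And>k. k > 0 \<Longrightarrow> k < d \<Longrightarrow> h (z - k) < 0" using z(2) by auto
  define k where "k = min (d/2) ((z - s)/2)"
  have "h (z - k) < 0" using d z(1) by (intro d) (auto simp: k_def)
  moreover have "h (z - k) > 0" using d z(1) by (intro z(3)) (auto simp: k_def min_def field_simps)
  ultimately show False by simp
qed

text \<open>For small y the inverse slope S = x/y satisfies S' <= c S - 1 with c = a+K+1. Once below
  the unstable level 1/c, it would become negative in finite time.\<close>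

lemma slope_bounded:
  assumes T: "traj x y" and pos: "\<And>t. x t > 0 \<and> y t > 0" and yl: "(y \<longlongrightarrow> 0) at_top"
  shows "\<forall>\<^sub>F t in at_top. y t \<le> (a+K+1) * x t"
proof -
  have "((\<lambda>t. m * y t powr (q-1)) \<longlongrightarrow> m * 0) at_top"
    using q_bounds pos by (intro tendsto_mult tendsto_const tendsto_eq_rhs[OF tendsto_powr'[OF yl tendsto_const]] disjI2)
       (auto intro!: always_eventually less_imp_le)
  hence "\<forall>\<^sub>F t in at_top. m * y t powr (q-1) < 1" by (intro order_tendstoD) auto
  then obtain t0 where t0: "\<And>t. t \<ge> t0 \<Longrightarrow> m * y t powr (q-1) < 1" unfolding eventually_at_top_linorder by blast
  define c where "c = a+K+1"
  have c: "c > 0" using a0 K0 by (simp add: c_def)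
  have "y t \<le> c * x t" if t: "t \<ge> t0" for t
  proof (rule ccontr)
    assume "\<not> y t \<le> c * x t"
    hence neg: "x t / y t - 1/c < 0" using pos[of t] c by (simp add: field_simps)
    define D where "D = 1/c - x t / y t"
    have D: "D > 0" using neg by (simp add: D_def)
    \<comment> \<open>Chosen so that c (T' - t) = 1/(c D). By e^z >= 1 + z the gap 1/c - S, equal to
      D at time t, has then grown to at least D + 1/c, which forces S < 0.\<close>
    define T' where "T' = t + 1 / (c * c * D)"
    have T': "t \<le> T'" using c D by (simp add: T'_def)
    define s' where "s' = (\<lambda>t. ((a * x t - y t) * y t - x t * (x t powr p - K * y t - m * \<bar>y t\<bar> powr q)) / (y t * y t))"
    have "x T' / y T' - 1/c \<le> exp (c * (T' - t)) * (x t / y t - 1/c)"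
    proof (rule gronwall_le'[OF T', where f' = s'], intro conjI)
      fix u assume u: "t \<le> u" "u \<le> T'"
      have xy: "x u > 0" "y u > 0" using pos by auto
      have "((\<lambda>t. x t / y t - 1 / c) has_real_derivative s' u - 0) (at u)"
        unfolding s'_def using xy by (intro DERIV_diff DERIV_divide trajD[OF T] DERIV_const) auto
      thus "((\<lambda>t. x t / y t - 1 / c) has_real_derivative s' u) (at u)" by simp
      define S where "S = x u / y u"
      have S: "S > 0" "x u = S * y u" using xy by (auto simp: S_def)
      have "y u powr q = y u powr (q-1) * y u" using xy by (simp add: powr_diff)
      hence "s' u = a * S - 1 - S * (x u powr p / y u - K - m * y u powr (q-1))"
        unfolding s'_def using xy by (simp add: S(2) field_simps)
      also have "\<dots> \<le> S * (a + K + m * y u powr (q-1)) - 1"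
        using S xy by (simp add: algebra_simps)
      also have "\<dots> \<le> S * c - 1" using S t0[of u] u t unfolding c_def by (simp add: mult_left_mono)
      also have "\<dots> = c * (S - 1/c)" using c by (simp add: algebra_simps)
      finally show "s' u \<le> c * (x u / y u - 1/c)" unfolding S_def .
    qed
    hence "exp (c * (T' - t)) * D \<le> 1/c - x T' / y T'" by (simp add: D_def algebra_simps)
    also have "\<dots> < 1/c" using pos[of T'] by simp
    finally have 1: "exp (c * (T' - t)) * D < 1/c" .
    have "c * (T' - t) = 1 / (c * D)" using c by (simp add: T'_def)
    hence "exp (c * (T' - t)) \<ge> 1 + 1 / (c * D)" using exp_ge_add_one_self by simp
    hence "exp (c * (T' - t)) * D \<ge> (1 + 1 / (c * D)) * D" using D by (intro mult_right_mono) auto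
    also have "(1 + 1 / (c * D)) * D = D + 1/c" using D c by (simp add: field_simps)
    finally show False using 1 D by simp
  qed
  thus ?thesis unfolding c_def by (rule eventually_at_top_linorderI)
qed

text \<open>L starts at 0 and decreases, hence is negative. The orbit then crosses the diagonal for
  good, after which x decreases and the orbit converges. At the origin L would have to return to 0,
  at the fixed point it would be positive; a negative decreasing function does neither.\<close>

theorem no_regular_trajectory:
  assumes T: "traj x y" and pos: "\<And>t. x t > 0 \<and> y t > 0" 
    and L0: "((\<lambda>t. L (x t) (y t)) \<longlongrightarrow> 0) at_bot" and low: "\<And>t. t \<le> t0 \<Longrightarrow> y t < a * x t"
  shows False
proof -
  define \<Lambda> where "\<Lambda> = (\<lambda>t. L (x t) (y t))"
  define \<Lambda>' where "\<Lambda>' = (\<lambda>t. - ((y t - a * x t) * (J (x t) (y t) - J (x t) (a * x t))))"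
  have d\<Lambda>: "(\<Lambda> has_real_derivative \<Lambda>' t) (at t)" for t
    unfolding \<Lambda>_def \<Lambda>'_def using traj_L[OF T] pos by blast
  have "\<Lambda>' t \<le> 0" for t
    using diss_nonneg[of "x t" "y t"] pos[of t] by (simp add: \<Lambda>'_def)
  hence anti: "\<Lambda> t \<le> \<Lambda> s" if "s \<le> t" for s t
    using d\<Lambda> by (intro DERIV_nonpos_imp_nonincreasing[OF that]) blast
  have le0: "\<Lambda> t \<le> 0" for t
    by (rule tendsto_lowerbound[OF L0[folded \<Lambda>_def]])
       (use anti[of _ t] in \<open>auto intro!: eventually_at_bot_linorderI[of t]\<close>)
  have Lneg: "\<Lambda> t < 0" for t
  proof -
    \<comment> \<open>Before \<open>t0\<close> the orbit is off the diagonal, so L drops strictly on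
      the unit interval ending at \<open>s\<close>; this turns L <= 0 into L < 0.\<close>
    define s where "s = min t t0"
    have "\<Lambda> s < \<Lambda> (s - 1)"
    proof (rule DERIV_neg_imp_decreasing[of "s - 1" s \<Lambda>])
      fix u assume "s - 1 \<le> u" "u \<le> s"
      hence "y u \<noteq> a * x u" using low[of u] by (auto simp: s_def)
      hence "\<Lambda>' u < 0" using diss_pos pos by (auto simp: \<Lambda>'_def)
      thus "\<exists>d. (\<Lambda> has_real_derivative d) (at u) \<and> d < 0" using d\<Lambda> by blast
    qed simp
    moreover have "\<Lambda> t \<le> \<Lambda> s" by (rule anti) (simp add: s_def)
    ultimately show ?thesis using le0[of "s-1"] by linarith
  qed
  note Ln = Lneg[unfolded \<Lambda>_def]
  obtain t1 where t1: "y t1 > a * x t1" using traj_crosses_diag[OF T pos Ln] by blast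
  have above: "y t > a * x t" if "t \<ge> t1" for t
    using traj_stays_above_diag[OF T pos Ln t1 that] .
  have dec: "x t \<le> x s" if "t1 \<le> s" "s \<le> t" for s t
  proof (rule DERIV_nonpos_imp_nonincreasing[OF that(2)])
    fix u assume "s \<le> u" "u \<le> t"
    hence "a * x u - y u \<le> 0" using above[of u] that by simp
    thus "\<exists>d. (x has_real_derivative d) (at u) \<and> d \<le> 0" using trajD(1)[OF T] by blast
  qed
  \<comment> \<open>Above the level x^p/K the damping -K y outweighs x^p, and x only decreases after
    \<open>t1\<close>.\<close>
  define B where "B = max (x t1) (max (y t1) (x t1 powr p / K))"
  have yB: "y t \<le> B" if t: "t \<ge> t1" for t
  proof -
    have "y t - B \<le> exp (-K * (t - t1)) * (y t1 - B)"
    proof (rule gronwall_le'[OF t, where f = "\<lambda>t. y t - B" and f' = "\<lambda>t. x t powr p - K * y t - m * \<bar>y t\<bar> powr q"], intro conjI)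
      fix u assume u: "t1 \<le> u" "u \<le> t"
      show "((\<lambda>t. y t - B) has_real_derivative x u powr p - K * y u - m * \<bar>y u\<bar> powr q) (at u)"
        using DERIV_diff[OF trajD(2)[OF T] DERIV_const] by simp
      have "x u powr p \<le> x t1 powr p" using dec[OF order_refl u(1)] pos p1 by (intro powr_mono2) (auto intro: less_imp_le)
      also have "x t1 powr p / K \<le> B" by (simp add: B_def)
      hence "x t1 powr p \<le> K * B" using K0 by (simp add: field_simps)
      finally have "x u powr p \<le> K * B" .
      moreover have "m * \<bar>y u\<bar> powr q \<ge> 0" using m0 by simp
      ultimately show "x u powr p - K * y u - m * \<bar>y u\<bar> powr q \<le> - K * (y u - B)" by (simp add: algebra_simps)
    qed
    moreover have "exp (-K * (t - t1)) * (y t1 - B) \<le> 0" by (intro mult_nonneg_nonpos) (auto simp: B_def)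
    ultimately show ?thesis by simp
  qed
  have xB: "x t \<le> B" if "t \<ge> t1" for t using dec[OF order_refl that] by (simp add: B_def)
  have "\<exists>\<xi>. (x \<longlongrightarrow> \<xi>) at_top"
    using dec pos by (intro antitone_nonneg_tendsto[of t1]) (auto intro: less_imp_le)
  then obtain \<xi> where xl: "(x \<longlongrightarrow> \<xi>) at_top" by blast
  note lim = limit_is_equilibrium[OF T xl, of t1 B]
  have yl: "(y \<longlongrightarrow> a * \<xi>) at_top" and eq: "\<xi> = 0 \<or> \<xi> = X" using lim pos yB xB by auto
  show False
  proof (cases "\<xi> = 0")
    case True
    have "\<forall>\<^sub>F t in at_top. 0 < x t \<and> 0 < y t \<and> y t \<le> (a+K+1) * x t"
      using slope_bounded[OF T pos] yl True pos by auto
    hence "(\<Lambda> \<longlongrightarrow> 0) at_top" unfolding \<Lambda>_def using xl True by (intro L_tendsto_0) auto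
    hence "0 \<le> \<Lambda> 0"
      by (rule tendsto_upperbound) (use anti[of 0] in \<open>auto intro!: eventually_at_top_linorderI[of 0]\<close>)
    thus False using Lneg[of 0] by simp
  next
    case False
    hence "\<xi> = X" using eq by simp
    hence "(\<Lambda> \<longlongrightarrow> L X (a*X)) at_top" unfolding \<Lambda>_def using xl yl X0 a0 by (intro L_tendsto) auto
    hence "L X (a*X) \<le> 0" by (rule tendsto_upperbound) (use le0 in auto)
    thus False using L_fixed_pos by simp
  qed
qed

end

section \<open>Backward convergence to the fixed point\<close>

context emden
begin

text \<open>As C >= 0, positivity of L forces H > 0, and H has the sign of a x/(b+1) -
  y/(b+2).\<close>

lemma L_pos_slope:
  assumes "x > 0" "y > 0" "L x y > 0" shows "y < a*(b+2)/(b+1) * x"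
proof -
  have "x powr (-\<alpha>) * y powr (b+1) * (a*x/(b+1) - y/(b+2)) > 0"
    using L_alt[OF assms(1,2)] assms(3) C_nonneg[of x] assms(1) by simp
  moreover have "x powr (-\<alpha>) * y powr (b+1) > 0" using assms by simp
  ultimately have "a*x/(b+1) - y/(b+2) > 0" by (rule zero_less_mult_pos)
  hence "y / (b+2) < a*x/(b+1)" by simp
  thus ?thesis using b0 by (simp add: pos_divide_less_eq mult_ac)
qed

lemma L_le_power:
  assumes "x > 0" "y > 0" "L x y > 0"
  shows "L x y \<le> a/(b+1) * x powr (1-\<alpha>) * y powr (b+1) - C x"
  unfolding L_def using b0 by simp

text \<open>By the slope bound H is at most of order x^(b+2-\<alpha>), while C contains a positive
  multiple of x^(p+b+1-\<alpha>), its leading power because p > q > 1. So L > 0 fails for large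
  x.\<close>

lemma L_pos_bounded: "\<exists>R>0. \<forall>x y. x > 0 \<longrightarrow> y > 0 \<longrightarrow> L x y > 0 \<longrightarrow> x \<le> R \<and> y \<le> R"
proof -
  define S where "S = a*(b+2)/(b+1)"
  have S: "S > 0" using a0 b0 by (simp add: S_def)
  \<comment> \<open>After division by x^(b+2-\<alpha>), \<open>c1\<close> bounds H, and
    \<open>c2\<close>, \<open>c3\<close> are the coefficients of the terms of C that come from x^p
    and from the gradient.\<close>
  define c2 where "c2 = a powr b / (p+b+1-\<alpha>)"
  define c3 where "c3 = m * a powr (q+b) / (q+b+1-\<alpha>)"
  define c1 where "c1 = a/(b+1) * S powr (b+1)"
  have c2: "c2 > 0" using a0 p1 b0 \<alpha>1 by (simp add: c2_def)
  have "filterlim (\<lambda>x. c2 * x powr (p-1) - c3 * x powr (q-1)) at_top at_top"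
    using q_bounds c2 by real_asymp
  hence "\<forall>\<^sub>F x in at_top. c1 \<le> c2 * x powr (p-1) - c3 * x powr (q-1)" unfolding filterlim_at_top by blast
  then obtain R where R: "\<And>x. x \<ge> R \<Longrightarrow> c1 \<le> c2 * x powr (p-1) - c3 * x powr (q-1)"
    unfolding eventually_at_top_linorder by blast
  have main: "x < R" if xy: "x > 0" "y > 0" "L x y > 0" for x y
  proof (rule ccontr)
    assume "\<not> x < R"
    hence ge: "c1 \<le> c2 * x powr (p-1) - c3 * x powr (q-1)" using R by simp
    have "y powr (b+1) \<le> (S * x) powr (b+1)"
      using L_pos_slope[OF xy] xy b0 unfolding S_def[symmetric] by (intro powr_mono2) auto
    hence "a/(b+1) * x powr (1-\<alpha>) * y powr (b+1) \<le> a/(b+1) * x powr (1-\<alpha>) * (S * x) powr (b+1)"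
      using a0 b0 by (intro mult_left_mono) auto
    also have "\<dots> = c1 * (x powr (1-\<alpha>) * x powr (b+1))" using S xy by (simp add: powr_mult c1_def)
    also have "x powr (1-\<alpha>) * x powr (b+1) = x powr (b+2-\<alpha>)" by (simp add: powr_add[symmetric] algebra_simps)
    finally have 1: "a/(b+1) * x powr (1-\<alpha>) * y powr (b+1) \<le> c1 * x powr (b+2-\<alpha>)" .
    have "(c2 * x powr (p-1) - c3 * x powr (q-1)) * x powr (b+2-\<alpha>) = c2 * (x powr (p-1) * x powr (b+2-\<alpha>)) - c3 * (x powr (q-1) * x powr (b+2-\<alpha>))"
      by (simp add: algebra_simps)
    also have "\<dots> = c2 * x powr (p+b+1-\<alpha>) - c3 * x powr (q+b+1-\<alpha>)"
      by (simp add: powr_add[symmetric] algebra_simps)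
    also have "\<dots> \<le> C x" unfolding C_def c2_def c3_def using \<alpha>0 \<alpha>1 b0 a0 by simp
    finally have "c1 * x powr (b+2-\<alpha>) \<le> C x"
      using ge by (meson mult_right_mono order.trans powr_ge_zero)
    thus False using 1 L_le_power[OF xy] xy(3) by linarith
  qed
  show ?thesis
  proof (intro exI[of _ "max 1 (max R (S * R))"] conjI allI impI)
    fix x y assume xy: "x > 0" "y > 0" "L x y > 0"
    show "x \<le> max 1 (max R (S * R))" using main[OF xy] by simp
    have "y \<le> S * x" using L_pos_slope[OF xy] by (simp add: S_def)
    also have "\<dots> \<le> S * R" using S main[OF xy] by simp
    finally show "y \<le> max 1 (max R (S * R))" by simp
  qed auto
qed

text \<open>L is at most a/(b+1) x^(1-\<alpha>) y^(b+1). With one coordinate bounded by R, a small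
  value of the other makes this smaller than e.\<close>

lemma L_ge_lower:
  assumes "e > 0" shows "\<exists>\<delta>>0. \<forall>x y. x > 0 \<longrightarrow> y > 0 \<longrightarrow> L x y \<ge> e \<longrightarrow> \<delta> \<le> x \<and> \<delta> \<le> y"
proof -
  from L_pos_bounded obtain R where R: "R > 0" "\<And>x y. x > 0 \<Longrightarrow> y > 0 \<Longrightarrow> L x y > 0 \<Longrightarrow> x \<le> R \<and> y \<le> R" by blast
  define c where "c = a/(b+1) * R powr (b+1)"
  define d where "d = a/(b+1) * R powr (1-\<alpha>)"
  have cd: "c > 0" "d > 0" using a0 b0 R by (auto simp: c_def d_def)
  define \<delta> where "\<delta> = min ((e/c) powr (1/(1-\<alpha>))) ((e/d) powr (1/(b+1)))"
  have "\<delta> > 0" using cd assms by (simp add: \<delta>_def)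
  moreover have "\<delta> \<le> x \<and> \<delta> \<le> y" if xy: "x > 0" "y > 0" "L x y \<ge> e" for x y
  proof -
    have Lp: "L x y > 0" using xy assms by simp
    have le: "e \<le> a/(b+1) * x powr (1-\<alpha>) * y powr (b+1)"
      using L_le_power[OF xy(1,2) Lp] xy C_nonneg[of x] by simp
    have "y powr (b+1) \<le> R powr (b+1)" "x powr (1-\<alpha>) \<le> R powr (1-\<alpha>)"
      using R(2)[OF xy(1,2) Lp] xy b0 \<alpha>1 by (auto intro!: powr_mono2)
    hence "a/(b+1) * x powr (1-\<alpha>) * y powr (b+1) \<le> a/(b+1) * x powr (1-\<alpha>) * R powr (b+1)"
      "a/(b+1) * x powr (1-\<alpha>) * y powr (b+1) \<le> a/(b+1) * R powr (1-\<alpha>) * y powr (b+1)"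
      using a0 b0 by (auto intro!: mult_left_mono mult_right_mono divide_right_mono)
    hence "e \<le> c * x powr (1-\<alpha>)" "e \<le> d * y powr (b+1)" using le by (auto simp: c_def d_def mult_ac)
    hence "e/c \<le> x powr (1-\<alpha>)" "e/d \<le> y powr (b+1)" using cd by (auto simp: field_simps)
    hence "(e/c) powr (1/(1-\<alpha>)) \<le> (x powr (1-\<alpha>)) powr (1/(1-\<alpha>))" "(e/d) powr (1/(b+1)) \<le> (y powr (b+1)) powr (1/(b+1))"
      using cd assms \<alpha>1 b0 by (auto intro!: powr_mono2)
    moreover have "(x powr (1-\<alpha>)) powr (1/(1-\<alpha>)) = x" "(y powr (b+1)) powr (1/(b+1)) = y"
      using xy \<alpha>1 b0 by (auto simp: powr_powr)
    ultimately show ?thesis by (auto simp: \<delta>_def)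
  qed
  ultimately show ?thesis by blast
qed

text \<open>Backwards in time L grows, which confines the orbit to a compact box away from the axes.
  There L converges, so its dissipation tends to 0 and with it x'. A second application of the same
  principle gives x'' -> 0, and x' = x'' = 0 only holds at the fixed point.\<close>

lemma traj_converges_at_bot:
  assumes T: "traj x y" and pos: "\<And>t. x t > 0 \<and> y t > 0"
    and Lpos: "L (x t0) (y t0) > 0"
  shows "(x \<longlongrightarrow> X) at_bot"
proof -
  define \<Lambda> where "\<Lambda> = (\<lambda>t. L (x t) (y t))"
  define D where "D = (\<lambda>(x,y). (y - a * x) * (J x y - J x (a * x)))"
  have d\<Lambda>: "(\<Lambda> has_real_derivative - D (x t, y t)) (at t)" for t
    unfolding \<Lambda>_def D_def using traj_L[OF T] pos by simp
  have D0: "D (u,v) \<ge> 0" if "u > 0" "v > 0" for u v using diss_nonneg[OF that] by (simp add: D_def)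
  have anti: "\<Lambda> t \<le> \<Lambda> s" if "s \<le> t" for s t
    using d\<Lambda> D0 pos by (intro DERIV_nonpos_imp_nonincreasing[OF that]) (meson neg_le_0_iff_le)
  define e where "e = \<Lambda> t0"
  have e: "e > 0" using Lpos by (simp add: e_def \<Lambda>_def)
  from L_pos_bounded obtain R where R: "R > 0" "\<And>x y. x > 0 \<Longrightarrow> y > 0 \<Longrightarrow> L x y > 0 \<Longrightarrow> x \<le> R \<and> y \<le> R" by blast
  from L_ge_lower[OF e] obtain \<delta> where \<delta>: "\<delta> > 0" "\<And>x y. x > 0 \<Longrightarrow> y > 0 \<Longrightarrow> L x y \<ge> e \<Longrightarrow> \<delta> \<le> x \<and> \<delta> \<le> y" by blast
  define S where "S = {\<delta>..R} \<times> {\<delta>..R}"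
  have S: "compact S" unfolding S_def by (intro compact_Times compact_Icc)
  have Spos: "fst w > 0" "snd w > 0" if "w \<in> S" for w using that \<delta>(1) by (auto simp: S_def)
  have inS: "(x t, y t) \<in> S" if "t \<le> t0" for t
    using R(2)[of "x t" "y t"] \<delta>(2)[of "x t" "y t"] pos[of t] anti[OF that] e unfolding e_def \<Lambda>_def S_def by auto
  have Dcont: "continuous_on S D"
  proof -
    have "continuous_on S (\<lambda>w. (snd w - a * fst w) * (J (fst w) (snd w) - J (fst w) (a * fst w)))"
      unfolding J_def using Spos a0 
      by (intro continuous_intros ballI) (auto simp: less_imp_neq[symmetric])
    thus ?thesis by (simp add: D_def case_prod_unfold)
  qed
  define y' where "y' = (\<lambda>t. x t powr p - K * y t - m * \<bar>y t\<bar> powr q)"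
  have bounds: "0 \<le> x t" "x t \<le> R" "0 \<le> y t" "y t \<le> R" if "t \<le> t0" for t
    using inS[OF that] pos[of t] by (auto simp: S_def)
  have x'B: "\<bar>a * x t - y t\<bar> \<le> a * R + R" if "t \<le> t0" for t
  proof -
    have "a * x t \<le> a * R" "0 \<le> a * x t" using bounds[OF that] a0 by auto
    thus ?thesis using bounds[OF that] by linarith
  qed
  have y'B: "\<bar>y' t\<bar> \<le> R powr p + K * R + m * R powr q" if "t \<le> t0" for t
  proof -
    have "x t powr p \<le> R powr p" "\<bar>y t\<bar> powr q \<le> R powr q" "0 \<le> x t powr p" "0 \<le> \<bar>y t\<bar> powr q"
      using bounds[OF that] p1 q_bounds by (auto intro!: powr_mono2)
    moreover from this have "m * \<bar>y t\<bar> powr q \<le> m * R powr q" "0 \<le> m * \<bar>y t\<bar> powr q"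
       "K * y t \<le> K * R" "0 \<le> K * y t" using m0 K0 bounds[OF that] by auto
    ultimately show ?thesis unfolding y'_def by linarith
  qed
  have ucx: "uniformly_continuous_on {..t0} x"
    by (rule uniformly_continuous_bounded_deriv[OF _ trajD(1)[OF T]]) (use x'B in auto)
  have ucy: "uniformly_continuous_on {..t0} y"
    by (rule uniformly_continuous_bounded_deriv[OF _ trajD(2)[OF T]]) (use y'B in \<open>auto simp: y'_def\<close>)
  have ucz: "uniformly_continuous_on {..t0} (\<lambda>t. (x t, y t))"
    unfolding uniformly_continuous_on_def
  proof safe
    fix \<epsilon> :: real assume \<epsilon>: "\<epsilon> > 0"
    from ucx \<epsilon> obtain d1 where d1: "d1 > 0" "\<And>s t. s \<le> t0 \<Longrightarrow> t \<le> t0 \<Longrightarrow> dist s t < d1 \<Longrightarrow> dist (x s) (x t) < \<epsilon>/2"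
      unfolding uniformly_continuous_on_def by (meson atMost_iff half_gt_zero)
    from ucy \<epsilon> obtain d2 where d2: "d2 > 0" "\<And>s t. s \<le> t0 \<Longrightarrow> t \<le> t0 \<Longrightarrow> dist s t < d2 \<Longrightarrow> dist (y s) (y t) < \<epsilon>/2"
      unfolding uniformly_continuous_on_def by (meson atMost_iff half_gt_zero)
    have "dist (x s, y s) (x t, y t) < \<epsilon>" if "s \<le> t0" "t \<le> t0" "dist s t < min d1 d2" for s t
    proof -
      have "dist (x s, y s) (x t, y t) \<le> dist (x s) (x t) + dist (y s) (y t)"
        unfolding dist_Pair_Pair by (rule sqrt_sum_squares_le_sum) auto
      thus ?thesis using d1(2)[of s t] d2(2)[of s t] that by simp
    qed
    thus "\<exists>d>0. \<forall>t\<in>{..t0}. \<forall>s\<in>{..t0}. dist s t < d \<longrightarrow> dist (x s, y s) (x t, y t) < \<epsilon>"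
      using d1(1) d2(1) by (intro exI[of _ "min d1 d2"]) auto
  qed
  have comp: "uniformly_continuous_on {..t0} (\<lambda>t. G (x t, y t))" if "continuous_on S G" for G :: "real \<times> real \<Rightarrow> real"
  proof -
    have "(\<lambda>t. (x t, y t)) ` {..t0} \<subseteq> S" using inS by auto
    hence "uniformly_continuous_on ((\<lambda>t. (x t, y t)) ` {..t0}) G"
      using compact_uniformly_continuous[OF that S] unfolding uniformly_continuous_on_def by (meson subsetD)
    from uniformly_continuous_on_compose[OF ucz this] show ?thesis by (simp add: o_def)
  qed
  have ev: "\<forall>\<^sub>F t in at_bot. (x t, y t) \<in> S" using inS by (rule eventually_at_bot_linorderI)
  have "\<exists>l. (\<Lambda> \<longlongrightarrow> l) at_bot"
  proof -
    \<comment> \<open>Time is reversed and frozen at \<open>t0\<close>, so that the monotone limit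
      exists on the whole line.\<close>
    define z where "z = (\<lambda>t. \<Lambda> (min t0 (- t)))"
    have "\<Lambda> t \<le> a/(b+1) * R powr (1-\<alpha>) * R powr (b+1)" if "t \<le> t0" for t
    proof -
      have "L (x t) (y t) > 0" using anti[OF that] e by (simp add: e_def \<Lambda>_def)
      from L_le_power[OF _ _ this] have "\<Lambda> t \<le> a/(b+1) * x t powr (1-\<alpha>) * y t powr (b+1)"
        using pos[of t] C_nonneg[of "x t"] by (simp add: \<Lambda>_def)
      also have "\<dots> \<le> a/(b+1) * R powr (1-\<alpha>) * R powr (b+1)"
        using a0 b0 \<alpha>1 bounds[OF that] by (intro mult_mono powr_mono2 order_refl) (simp_all add: less_imp_le)
      finally show ?thesis .
    qed
    hence "bdd_above (range z)"
      by (intro bdd_aboveI[of _ "a/(b+1) * R powr (1-\<alpha>) * R powr (b+1)"]) (auto simp: z_def)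
    moreover have "mono z" unfolding mono_def z_def by (auto intro!: anti)
    ultimately have "(z \<longlongrightarrow> (SUP t. z t)) at_top" by (intro mono_bdd_above_tendsto)
    moreover have "\<forall>\<^sub>F t in at_top. z t = \<Lambda> (- t)"
      by (rule eventually_at_top_linorderI[of "-t0"]) (simp add: z_def min_absorb2)
    ultimately have "((\<lambda>t. \<Lambda> (- t)) \<longlongrightarrow> (SUP t. z t)) at_top" using tendsto_cong by metis
    thus ?thesis by (auto simp: filterlim_at_bot_mirror)
  qed
  then obtain l where "(\<Lambda> \<longlongrightarrow> l) at_bot" by blast
  hence "((\<lambda>t. - D (x t, y t)) \<longlongrightarrow> 0) at_bot"
    by (rule barbalat_at_bot[OF d\<Lambda>, where c = t0]) (use comp[OF continuous_on_minus[OF Dcont]] in simp)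
  hence Dl: "((\<lambda>t. D (x t, y t)) \<longlongrightarrow> 0) at_bot" by (rule tendsto_minus_cancel[where a = 0, simplified])
  have x'l: "((\<lambda>t. (\<lambda>w. a * fst w - snd w) (x t, y t)) \<longlongrightarrow> 0) at_bot"
  proof (rule compact_zero_set_tendsto[OF S Dcont _ ev _ _ Dl])
    fix w assume w: "w \<in> S"
    show "D w \<ge> 0" using D0[OF Spos[OF w]] by simp
    assume "D w = 0"
    thus "a * fst w - snd w = 0" using diss_pos[OF Spos[OF w]] by (force simp: D_def case_prod_unfold)
  qed (intro continuous_intros)
  \<comment> \<open>This is x'' = a x' - y' as a function on the phase plane; together with x' = 0
    its vanishing means y' = 0.\<close>
  define F2 where "F2 = (\<lambda>w. a * (a * fst w - snd w) - (fst w powr p - K * snd w - m * \<bar>snd w\<bar> powr q))"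
  have F2cont: "continuous_on S F2" unfolding F2_def using Spos by (intro continuous_intros ballI) fastforce+
  have "((\<lambda>t. F2 (x t, y t)) \<longlongrightarrow> 0) at_bot"
  proof (rule barbalat_at_bot[where c = t0])
    show "((\<lambda>t. a * x t - y t) has_real_derivative F2 (x t, y t)) (at t)" for t
      unfolding F2_def fst_conv snd_conv by (intro DERIV_diff DERIV_cmult trajD[OF T])
  qed (use x'l comp[OF F2cont] in auto)
  hence "((\<lambda>t. \<bar>a * x t - y t\<bar> + \<bar>F2 (x t, y t)\<bar>) \<longlongrightarrow> \<bar>0\<bar> + \<bar>0\<bar>) at_bot"
    using x'l by (intro tendsto_intros) auto
  hence lim: "((\<lambda>t. (\<lambda>w. \<bar>a * fst w - snd w\<bar> + \<bar>F2 w\<bar>) (x t, y t)) \<longlongrightarrow> 0) at_bot" by simp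
  have "((\<lambda>t. (\<lambda>w. fst w - X) (x t, y t)) \<longlongrightarrow> 0) at_bot"
  proof (rule compact_zero_set_tendsto[OF S _ _ ev _ _ lim])
    fix w assume w: "w \<in> S"
    assume "\<bar>a * fst w - snd w\<bar> + \<bar>F2 w\<bar> = 0"
    hence "snd w = a * fst w" "F2 w = 0" by linarith+
    hence "fst w powr p = K * (a * fst w) + m * (a * fst w) powr q"
      using Spos[OF w] by (simp add: F2_def)
    thus "fst w - X = 0" using fixed_point_unique[OF Spos(1)[OF w]] by simp
  qed (auto intro!: continuous_intros F2cont)
  hence "((\<lambda>t. x t - X) \<longlongrightarrow> 0) at_bot" by simp
  thus ?thesis by (simp add: LIM_zero_iff)
qed

end

section \<open>Uniqueness of the stable manifold\<close>

lemma powr_lipschitz: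
  fixes u v B r :: real
  assumes "0 \<le> u" "u \<le> B" "0 \<le> v" "v \<le> B" "r > 1"
  shows "\<bar>u powr r - v powr r\<bar> \<le> r * B powr (r-1) * \<bar>u - v\<bar>"
proof -
  have main: "v powr r - u powr r \<le> r * B powr (r-1) * (v - u)" if "0 \<le> u" "u \<le> v" "v \<le> B" for u v
  proof -
    define g where "g = (\<lambda>z. z powr r - r * B powr (r-1) * z)"
    have "g v \<le> g u"
    proof (rule DERIV_nonpos_imp_decreasing_open[OF that(2)])
      show "continuous_on {u..v} g" unfolding g_def using that assms
        by (auto intro!: continuous_intros continuous_on_powr')
      fix z assume z: "u < z" "z < v"
      have "(g has_real_derivative r * z powr (r-1) - r * B powr (r-1)) (at z)"
        unfolding g_def using z that by (intro DERIV_diff has_real_derivative_powr DERIV_cmult_Id) auto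
      moreover have "z powr (r-1) \<le> B powr (r-1)" using z that assms by (intro powr_mono2) auto
      hence "r * z powr (r-1) - r * B powr (r-1) \<le> 0" using assms by simp
      ultimately show "\<exists>d. (g has_real_derivative d) (at z) \<and> d \<le> 0" by blast
    qed
    thus ?thesis by (simp add: g_def algebra_simps)
  qed
  show ?thesis
  proof (cases "u \<le> v")
    case True
    have "u powr r \<le> v powr r" using True assms by (intro powr_mono2) auto
    thus ?thesis using main[OF assms(1) True assms(4)] True by simp
  next
    case False
    have "v powr r \<le> u powr r" using False assms by (intro powr_mono2) auto
    thus ?thesis using main[OF assms(3) _ assms(2)] False by simp
  qed
qed

text \<open>Takes the place of integration from t to infinity in all estimates whose data are given
  at infinity.\<close>

lemma deriv_nonneg_le_limit:
  fixes f :: "real \<Rightarrow> real"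
  assumes d: "\<And>t. t \<ge> T \<Longrightarrow> (f has_real_derivative f' t) (at t)" "\<And>t. t \<ge> T \<Longrightarrow> f' t \<ge> 0"
    and l: "(f \<longlongrightarrow> l) at_top" and t: "t \<ge> T"
  shows "f t \<le> l"
proof (rule tendsto_lowerbound[OF l])
  have "f t \<le> f s" if "s \<ge> t" for s
    using d t by (intro DERIV_nonneg_imp_nondecreasing[OF that]) (meson order.trans)
  thus "\<forall>\<^sub>F s in at_top. f t \<le> f s" by (rule eventually_at_top_linorderI)
qed auto

context emden
begin

text \<open>A Gronwall estimate for the squared distance. The sign \<open>\<sigma>\<close> lets it
  serve both directions of time, and since p, q > 1 the field is Lipschitz up to the axes, so
  uniqueness also holds at the origin.\<close>

lemma traj_unique_forward:
  assumes d: "\<And>t. t \<in> {s..T} \<Longrightarrow> (x has_real_derivative \<sigma> * (a * x t - y t)) (at t)"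
     "\<And>t. t \<in> {s..T} \<Longrightarrow> (y has_real_derivative \<sigma> * (x t powr p - K * y t - m * \<bar>y t\<bar> powr q)) (at t)"
     "\<And>t. t \<in> {s..T} \<Longrightarrow> (x' has_real_derivative \<sigma> * (a * x' t - y' t)) (at t)"
     "\<And>t. t \<in> {s..T} \<Longrightarrow> (y' has_real_derivative \<sigma> * (x' t powr p - K * y' t - m * \<bar>y' t\<bar> powr q)) (at t)"
   and pos: "\<And>t. t \<in> {s..T} \<Longrightarrow> x t \<ge> 0 \<and> x' t \<ge> 0" and "\<bar>\<sigma>\<bar> = 1"
   and init: "x s = x' s" "y s = y' s" and "s \<le> T"
  shows "x T = x' T \<and> y T = y' T"
proof -
  have cont: "continuous_on {s..T} x" "continuous_on {s..T} y" "continuous_on {s..T} x'" "continuous_on {s..T} y'"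
    by (rule DERIV_continuous_on[OF has_field_derivative_at_within], erule d)+
  define G where "G = (\<lambda>t. \<bar>x t\<bar> + \<bar>y t\<bar> + \<bar>x' t\<bar> + \<bar>y' t\<bar>)"
  have "compact (G ` {s..T})" unfolding G_def by (intro compact_continuous_image continuous_intros cont compact_Icc)
  then obtain B where B: "\<And>t. t \<in> {s..T} \<Longrightarrow> \<bar>G t\<bar> \<le> B"
    using compact_imp_bounded[OF \<open>compact (G ` {s..T})\<close>] unfolding bounded_iff by fastforce
  define P Q where "P = p * B powr (p-1)" and "Q = q * B powr (q-1)"
  \<comment> \<open>The summands 1 and P come from 2|u v| <= u^2 + v^2, applied to the coupling term
    and to the difference of the powers x^p; the others bound diagonal terms.\<close>
  define c where "c = 2 * a + 1 + P + 2 * K + 2 * m * Q"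
  define D where "D = (\<lambda>t. (x t - x' t)^2 + (y t - y' t)^2)"
  define D' where "D' = (\<lambda>t. \<sigma> * (2 * (x t - x' t) * (a * (x t - x' t) - (y t - y' t)) + 
     2 * (y t - y' t) * ((x t powr p - x' t powr p) - K * (y t - y' t) - m * (\<bar>y t\<bar> powr q - \<bar>y' t\<bar> powr q))))"
  have "D T \<le> exp (c * (T - s)) * D s"
  proof (rule gronwall_le'[OF \<open>s \<le> T\<close>, where f' = D'], intro conjI)
    fix t assume t: "s \<le> t" "t \<le> T"
    show "(D has_real_derivative D' t) (at t)" unfolding D_def D'_def power2_eq_square
      by (rule derivative_eq_intros refl d | use t in force)+ (simp add: algebra_simps)
    define u v where "u = x t - x' t" and "v = y t - y' t"
    have bd: "\<bar>x t\<bar> \<le> B" "\<bar>y t\<bar> \<le> B" "\<bar>x' t\<bar> \<le> B" "\<bar>y' t\<bar> \<le> B" using B[of t] t by (auto simp: G_def)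
    have P0: "P \<ge> 0" "Q \<ge> 0" using p1 q_bounds by (auto simp: P_def Q_def)
    have 1: "\<bar>x t powr p - x' t powr p\<bar> \<le> P * \<bar>u\<bar>"
      unfolding P_def u_def using bd pos[of t] t p1 by (intro powr_lipschitz) auto
    have "\<bar>\<bar>y t\<bar> powr q - \<bar>y' t\<bar> powr q\<bar> \<le> Q * \<bar>\<bar>y t\<bar> - \<bar>y' t\<bar>\<bar>"
      unfolding Q_def using bd q_bounds by (intro powr_lipschitz) auto
    also have "\<dots> \<le> Q * \<bar>v\<bar>" using P0 by (intro mult_left_mono) (auto simp: v_def)
    finally have 2: "\<bar>\<bar>y t\<bar> powr q - \<bar>y' t\<bar> powr q\<bar> \<le> Q * \<bar>v\<bar>" .
    have uv: "2 * (\<bar>u\<bar> * \<bar>v\<bar>) \<le> u^2 + v^2"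
      using sum_squares_bound[of "\<bar>u\<bar>" "\<bar>v\<bar>"] by (simp add: mult.assoc)
    define X1 where "X1 = x t powr p - x' t powr p"
    define Y1 where "Y1 = \<bar>y t\<bar> powr q - \<bar>y' t\<bar> powr q"
    have "\<bar>D' t\<bar> = \<bar>2 * u * (a * u - v) + 2 * v * (X1 - K * v - m * Y1)\<bar>"
      unfolding D'_def u_def[symmetric] v_def[symmetric] X1_def[symmetric] Y1_def[symmetric] using \<open>\<bar>\<sigma>\<bar> = 1\<close> by (simp add: abs_mult)
    also have "\<dots> = \<bar>2 * a * u^2 - 2 * (u * v) + 2 * (v * X1) - 2 * K * v^2 - 2 * m * (v * Y1)\<bar>"
      by (simp add: algebra_simps power2_eq_square)
    also have "\<dots> \<le> 2 * a * u^2 + 2 * \<bar>u * v\<bar> + 2 * \<bar>v * X1\<bar> + 2 * K * v^2 + 2 * m * \<bar>v * Y1\<bar>"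
    proof -
      have "\<bar>2 * a * u^2\<bar> = 2 * a * u^2" "\<bar>2 * K * v^2\<bar> = 2 * K * v^2" "\<bar>2 * m * (v * Y1)\<bar> = 2 * m * \<bar>v * Y1\<bar>"
        using a0 K0 m0 by (auto simp: abs_mult)
      thus ?thesis by linarith
    qed
    also have "\<dots> \<le> c * (u^2 + v^2)"
    proof -
      have "\<bar>v * X1\<bar> \<le> P * (\<bar>u\<bar> * \<bar>v\<bar>)" using mult_left_mono[OF 1, of "\<bar>v\<bar>"] by (simp add: X1_def abs_mult mult_ac)
      moreover have "P * (2 * (\<bar>u\<bar> * \<bar>v\<bar>)) \<le> P * (u^2 + v^2)" using uv P0 by (intro mult_left_mono)
      moreover have "\<bar>v * Y1\<bar> \<le> Q * v^2" using mult_left_mono[OF 2, of "\<bar>v\<bar>"] by (simp add: Y1_def abs_mult mult_ac power2_eq_square)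
      hence "2 * m * \<bar>v * Y1\<bar> \<le> 2 * m * (Q * v^2)" using m0 by (intro mult_left_mono) auto
      moreover have "2 * \<bar>u * v\<bar> \<le> u^2 + v^2" using uv by (simp add: abs_mult)
      moreover have "0 \<le> 2 * a * v^2" "0 \<le> 2 * K * u^2" "0 \<le> 2 * m * (Q * u^2)" using a0 K0 m0 P0 by auto
      ultimately show ?thesis unfolding c_def by (simp add: algebra_simps)
    qed
    finally show "D' t \<le> c * D t" unfolding D_def u_def v_def by linarith
  qed
  also have "D s = 0" using init by (simp add: D_def)
  finally have "D T \<le> 0" by simp
  hence "(x T - x' T)^2 = 0 \<and> (y T - y' T)^2 = 0" unfolding D_def
    by (smt (verit) zero_le_power2)
  thus ?thesis by simp
qed

lemma traj_unique:
  assumes T: "traj x y" "traj x' y'" and pos: "\<And>t. x t \<ge> 0 \<and> x' t \<ge> 0" and init: "x s = x' s" "y s = y' s"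
  shows "x t = x' t \<and> y t = y' t"
proof (cases "s \<le> t")
  case True
  show ?thesis
    by (rule traj_unique_forward[where \<sigma> = 1 and s = s and x = x and x' = x' and y = y and y' = y'])
       (use trajD[OF T(1)] trajD[OF T(2)] pos init True in auto)
next
  case False
  have r: "((\<lambda>t. f (- t)) has_real_derivative -1 * d) (at t)" if "(f has_real_derivative d) (at (-t))" for f d t
    using DERIV_mirror[of f d t] that by simp
  have "x (- (-t)) = x' (- (-t)) \<and> y (- (-t)) = y' (- (-t))"
    by (rule traj_unique_forward[where \<sigma> = "-1" and s = "-s" and x = "\<lambda>t. x (-t)" and x' = "\<lambda>t. x' (-t)" 
           and y = "\<lambda>t. y (-t)" and y' = "\<lambda>t. y' (-t)"])
       (use r[OF trajD(1)[OF T(1)]] r[OF trajD(2)[OF T(1)]] r[OF trajD(1)[OF T(2)]] r[OF trajD(2)[OF T(2)]]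
          pos init False in auto)
  thus ?thesis by simp
qed

text \<open>The factor e^(K t) removes the damping, so \<eta> changes only by e^(K t)(x^p - m
  |y|^q), whose positive part decays exponentially. Hence \<eta> converges, then so does \<xi>' =
  (a+K) \<xi> - \<eta>, and a convergent derivative of a convergent function tends to 0.\<close>

lemma fast_decay_slope:
  assumes T: "traj x y" and pos: "\<And>t. x t > 0" and lim: "((\<lambda>t. exp (K*t) * x t) \<longlongrightarrow> c) at_top"
  shows "\<exists>t0. \<forall>t\<ge>t0. y t > 0" "((\<lambda>t. exp (K*t) * y t) \<longlongrightarrow> (a+K) * c) at_top"
proof -
  have "\<exists>s. y s > 0"
  proof (rule ccontr)
    assume "\<nexists>s. y s > 0"
    hence neg: "y t \<le> 0" for t by (simp add: not_less)
    have "((\<lambda>t. exp (- K * t)) \<longlongrightarrow> 0) at_top" using K0 by real_asymp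
    from tendsto_mult[OF this lim] have "((\<lambda>t. exp (- K * t) * (exp (K*t) * x t)) \<longlongrightarrow> 0) at_top" by simp
    moreover have "(\<lambda>t. exp (- K * t) * (exp (K*t) * x t)) = x"
      by (simp add: fun_eq_iff exp_minus)
    ultimately have "(x \<longlongrightarrow> 0) at_top" by (simp only:)
    \<comment> \<open>If y never became positive, x would be nondecreasing with limit 0, against x >
      0.\<close>
    moreover have "0 \<le> a * x t - y t" for t
      using neg[of t] mult_pos_pos[OF a0 pos[of t]] by linarith
    ultimately have "x 0 \<le> 0"
      by (intro deriv_nonneg_le_limit[OF trajD(1)[OF T], where T = 0]) auto
    thus False using pos[of 0] by simp
  qed
  then obtain s where s: "y s > 0" by blast
  have ypos: "y t > 0" if "t \<ge> s" for t
  proof (rule ccontr)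
    assume "\<not> y t > 0"
    hence le: "y t \<le> 0" by simp
    have "continuous_on {s..t} y" by (rule DERIV_continuous_on[OF has_field_derivative_at_within[OF trajD(2)[OF T]]])
    from this s le that obtain z where z: "s < z" "y z = 0" "\<And>u. s \<le> u \<Longrightarrow> u < z \<Longrightarrow> y u > 0" by (rule first_zero) blast
    \<comment> \<open>On the axis y = 0 the derivative of y is x^p > 0, so y can only cross it
      upwards.\<close>
    have "x z powr p - K * y z - m * \<bar>y z\<bar> powr q > 0" using z(2) pos[of z] by simp
    hence "\<exists>d>0. \<forall>k>0. k < d \<longrightarrow> y (z - k) < y z" using trajD(2)[OF T, of z] by (intro DERIV_pos_inc_left)
    then obtain d where d: "d > 0" "\<And>k. k > 0 \<Longrightarrow> k < d \<Longrightarrow> y (z - k) < 0" using z(2) by auto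
    define k where "k = min (d/2) ((z - s)/2)"
    have "y (z - k) < 0" using d z(1) by (intro d) (auto simp: k_def)
    moreover have "y (z - k) > 0" using d z(1) by (intro z(3)) (auto simp: k_def min_def field_simps)
    ultimately show False by simp
  qed
  thus "\<exists>t0. \<forall>t\<ge>t0. y t > 0" by blast
  define \<xi> where "\<xi> = (\<lambda>t. exp (K*t) * x t)"
  define \<eta> where "\<eta> = (\<lambda>t. exp (K*t) * y t)"
  have d\<eta>: "(\<eta> has_real_derivative exp (K*t) * (x t powr p - m * \<bar>y t\<bar> powr q)) (at t)" for t
    unfolding \<eta>_def by (rule derivative_eq_intros refl trajD(2)[OF T])+ (simp add: algebra_simps)
  have d\<xi>: "(\<xi> has_real_derivative (a+K) * \<xi> t - \<eta> t) (at t)" for t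
    unfolding \<xi>_def \<eta>_def by (rule derivative_eq_intros refl trajD(1)[OF T])+ (simp add: algebra_simps)
  have "\<forall>\<^sub>F t in at_top. \<xi> t < c + 1" using lim unfolding \<xi>_def by (intro order_tendstoD) auto
  then obtain t1 where t1: "\<And>t. t \<ge> t1 \<Longrightarrow> \<xi> t < c + 1" unfolding eventually_at_top_linorder by blast
  define t2 where "t2 = max s t1"
  define \<beta> where "\<beta> = (p-1) * K"
  have \<beta>: "\<beta> > 0" using p1 K0 by (simp add: \<beta>_def)
  define M where "M = (c+1) powr p"
  \<comment> \<open>The added term is the integral from t to infinity of M e^(-\<beta> t), a bound
    for the growth of \<eta>; it makes Z nonincreasing, and Z is bounded below by 0.\<close>
  define Z where "Z = (\<lambda>t. \<eta> t + M/\<beta> * exp (- \<beta> * t))"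
  have dZ: "(Z has_real_derivative exp (K*t) * (x t powr p - m * \<bar>y t\<bar> powr q) - M * exp (- \<beta> * t)) (at t)" for t
    unfolding Z_def by (rule derivative_eq_intros refl d\<eta>)+ (use \<beta> in simp)
  have Z': "exp (K*t) * (x t powr p - m * \<bar>y t\<bar> powr q) - M * exp (- \<beta> * t) \<le> 0" if "t \<ge> t2" for t
  proof -
    have "x t = exp (- K*t) * \<xi> t" by (simp add: \<xi>_def mult.assoc[symmetric] exp_add[symmetric])
    hence xp: "x t powr p = exp (- K*t*p) * \<xi> t powr p" by (simp add: powr_mult exp_powr_real)
    have "exp (K*t) * exp (- K*t*p) = exp (- \<beta> * t)" by (simp add: exp_add[symmetric] \<beta>_def algebra_simps)
    hence "exp (K*t) * x t powr p = exp (- \<beta> * t) * \<xi> t powr p" by (simp only: xp mult.assoc[symmetric])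
    also have "\<dots> \<le> exp (- \<beta> * t) * M"
      using t1[of t] that pos[of t] p1 unfolding M_def t2_def \<xi>_def by (intro mult_left_mono powr_mono2) auto
    finally have "exp (K*t) * x t powr p \<le> exp (- \<beta> * t) * M" .
    moreover have "exp (K*t) * (m * \<bar>y t\<bar> powr q) \<ge> 0" using m0 by simp
    ultimately show ?thesis by (simp add: right_diff_distrib mult.commute)
  qed
  have "\<exists>l. (Z \<longlongrightarrow> l) at_top"
  proof -
    have anti: "Z u \<le> Z v" if "t2 \<le> v" "v \<le> u" for u v
      using dZ Z' that by (intro DERIV_nonpos_imp_nonincreasing[OF that(2)]) (meson order.trans)
    have Zp: "Z t \<ge> 0" if "t \<ge> t2" for t
      using ypos[of t] that \<beta> unfolding Z_def M_def \<eta>_def t2_def by (intro add_nonneg_nonneg mult_nonneg_nonneg divide_nonneg_nonneg) auto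
    show ?thesis using anti Zp by (rule antitone_nonneg_tendsto)
  qed
  then obtain l where "(Z \<longlongrightarrow> l) at_top" by blast
  moreover have "((\<lambda>t. M/\<beta> * exp (- \<beta> * t)) \<longlongrightarrow> 0) at_top" using \<beta> by real_asymp
  ultimately have "((\<lambda>t. Z t - M/\<beta> * exp (- \<beta> * t)) \<longlongrightarrow> l - 0) at_top" by (rule tendsto_diff)
  hence \<eta>l: "(\<eta> \<longlongrightarrow> l) at_top" by (simp add: Z_def)
  have "((\<lambda>t. (a+K) * \<xi> t - \<eta> t) \<longlongrightarrow> (a+K) * c - l) at_top"
    using lim \<eta>l unfolding \<xi>_def by (intro tendsto_intros)
  hence "(a+K) * c - l = 0"
    using tendsto_derivative_zero_at_top[of 0 \<xi>, OF d\<xi>] lim unfolding \<xi>_def by blast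
  thus "((\<lambda>t. exp (K*t) * y t) \<longlongrightarrow> (a+K) * c) at_top" using \<eta>l unfolding \<eta>_def by simp
qed

text \<open>Let S be the supremum of |\<eta> - \<eta>'| from a late time on. Comparison from
  infinity, where all differences vanish, bounds |\<xi> - \<xi>'| by S/(a+K), and then |\<eta> -
  \<eta>'| by S/2, so S = 0. Uniqueness for the initial value problem extends the equality to all
  times.\<close>

theorem fast_decay_unique:
  assumes T: "traj x y" "traj x' y'" and pos: "\<And>t. x t > 0" "\<And>t. x' t > 0"
    and lim: "((\<lambda>t. exp (K*t) * x t) \<longlongrightarrow> c) at_top" "((\<lambda>t. exp (K*t) * x' t) \<longlongrightarrow> c) at_top"
  shows "x t = x' t"
proof -
  define B where "B = max (c + 1) ((a+K) * c + 1)"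
  note f1 = fast_decay_slope[OF T(1) pos(1) lim(1)] and f2 = fast_decay_slope[OF T(2) pos(2) lim(2)]
  define \<xi> where "\<xi> = (\<lambda>t. exp (K*t) * x t)"
  define \<eta> where "\<eta> = (\<lambda>t. exp (K*t) * y t)"
  define \<xi>' where "\<xi>' = (\<lambda>t. exp (K*t) * x' t)"
  define \<eta>' where "\<eta>' = (\<lambda>t. exp (K*t) * y' t)"
  have lims: "(\<xi> \<longlongrightarrow> c) at_top" "(\<xi>' \<longlongrightarrow> c) at_top" "(\<eta> \<longlongrightarrow> (a+K)*c) at_top" "(\<eta>' \<longlongrightarrow> (a+K)*c) at_top"
    using lim f1(2) f2(2) by (auto simp: \<xi>_def \<eta>_def \<xi>'_def \<eta>'_def)
  define D\<eta> where "D\<eta> = (\<lambda>t. exp (K*t) * ((x t powr p - x' t powr p) - m * (\<bar>y t\<bar> powr q - \<bar>y' t\<bar> powr q)))"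
  have d\<eta>: "((\<lambda>t. \<eta> t - \<eta>' t) has_real_derivative D\<eta> t) (at t)" for t
    unfolding \<eta>_def \<eta>'_def D\<eta>_def 
    by (rule derivative_eq_intros refl trajD(2)[OF T(1)] trajD(2)[OF T(2)])+ (simp add: algebra_simps)
  have d\<xi>: "((\<lambda>t. \<xi> t - \<xi>' t) has_real_derivative (a+K) * (\<xi> t - \<xi>' t) - (\<eta> t - \<eta>' t)) (at t)" for t
    unfolding \<xi>_def \<eta>_def \<xi>'_def \<eta>'_def 
    by (rule derivative_eq_intros refl trajD(1)[OF T(1)] trajD(1)[OF T(2)])+ (simp add: algebra_simps)
  have "\<forall>\<^sub>F t in at_top. \<xi> t < B \<and> \<xi>' t < B \<and> \<eta> t < B \<and> \<eta>' t < B"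
    using lims by (intro eventually_conj order_tendstoD) (auto simp: B_def)
  moreover obtain s1 s2 where "\<And>t. t \<ge> s1 \<Longrightarrow> y t > 0" "\<And>t. t \<ge> s2 \<Longrightarrow> y' t > 0" using f1(1) f2(1) by blast
  hence "\<forall>\<^sub>F t in at_top. y t > 0 \<and> y' t > 0"
    by (intro eventually_conj eventually_at_top_linorderI[of s1] eventually_at_top_linorderI[of s2]) auto
  ultimately have "\<forall>\<^sub>F t in at_top. \<xi> t < B \<and> \<xi>' t < B \<and> \<eta> t < B \<and> \<eta>' t < B \<and> y t > 0 \<and> y' t > 0"
    by eventually_elim auto
  then obtain T0 where T0: "\<And>t. t \<ge> T0 \<Longrightarrow> \<xi> t < B \<and> \<xi>' t < B \<and> \<eta> t < B \<and> \<eta>' t < B \<and> y t > 0 \<and> y' t > 0"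
    unfolding eventually_at_top_linorder by blast
  \<comment> \<open>The slower of the two decay rates (p-1) K and (q-1) K in the equation for
    \<eta>. One exponential bounds both only for t >= 0, which is why \<open>S0\<close> below
    includes 0.\<close>
  define \<gamma> where "\<gamma> = (q-1) * K"
  have \<gamma>: "\<gamma> > 0" using q_bounds K0 by (simp add: \<gamma>_def)
  define C0 where "C0 = p * B powr (p-1) / (a+K) + m * (q * B powr (q-1))"
  have C0: "C0 \<ge> 0" using p1 q_bounds a0 K0 m0 by (simp add: C0_def)
  have "((\<lambda>t. C0 / \<gamma> * exp (- \<gamma> * t)) \<longlongrightarrow> 0) at_top" using \<gamma> by real_asymp
  hence "\<forall>\<^sub>F t in at_top. C0 / \<gamma> * exp (- \<gamma> * t) < 1/2" by (rule order_tendstoD) simp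
  then obtain T1 where T1: "\<And>t. t \<ge> T1 \<Longrightarrow> C0 / \<gamma> * exp (- \<gamma> * t) < 1/2" unfolding eventually_at_top_linorder by blast
  define S0 where "S0 = max 0 (max T0 T1)"
  define S where "S = (SUP t\<in>{S0..}. \<bar>\<eta> t - \<eta>' t\<bar>)"
  have bnd: "\<bar>\<eta> t - \<eta>' t\<bar> \<le> B" if "t \<ge> S0" for t
  proof -
    have "\<eta> t \<ge> 0" "\<eta>' t \<ge> 0" "\<eta> t < B" "\<eta>' t < B" using T0[of t] that by (auto simp: \<eta>_def \<eta>'_def S0_def)
    thus ?thesis by linarith
  qed
  have "bdd_above ((\<lambda>t. \<bar>\<eta> t - \<eta>' t\<bar>) ` {S0..})" using bnd by (intro bdd_aboveI) auto
  hence S_ub: "\<bar>\<eta> t - \<eta>' t\<bar> \<le> S" if "t \<ge> S0" for t unfolding S_def using that by (intro cSUP_upper) auto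
  have S_ge: "S \<ge> 0" using S_ub[of S0] by simp
  have \<Delta>\<xi>: "\<bar>\<xi> t - \<xi>' t\<bar> \<le> S / (a+K)" if t: "t \<ge> S0" for t
  proof -
    have aK: "a + K > 0" using a0 K0 by simp
    have "\<sigma> * (\<xi> t - \<xi>' t) \<le> S / (a+K)" if \<sigma>: "\<bar>\<sigma>\<bar> = 1" for \<sigma> :: real
    proof -
      \<comment> \<open>The unstable equation for \<xi> - \<xi>' is integrated from infinity: the
        integrating factor sends f to 0, and f is nondecreasing because S dominates the
        forcing.\<close>
      define f where "f = (\<lambda>t. exp (- (a+K) * t) * (\<sigma> * (\<xi> t - \<xi>' t) - S / (a+K)))"
      have "f t \<le> 0"
      proof (rule deriv_nonneg_le_limit[OF _ _ _ t, where f' = "\<lambda>t. exp (- (a+K) * t) * (S - \<sigma> * (\<eta> t - \<eta>' t))"])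
        show "(f has_real_derivative exp (- (a+K) * t) * (S - \<sigma> * (\<eta> t - \<eta>' t))) (at t)" for t
          unfolding f_def by (rule derivative_eq_intros refl d\<xi>)+ (use aK in \<open>simp add: field_simps\<close>)
        show "exp (- (a+K) * t) * (S - \<sigma> * (\<eta> t - \<eta>' t)) \<ge> 0" if "t \<ge> S0" for t
        proof -
          have "\<sigma> * (\<eta> t - \<eta>' t) \<le> \<bar>\<sigma> * (\<eta> t - \<eta>' t)\<bar>" by simp
          also have "\<dots> = \<bar>\<eta> t - \<eta>' t\<bar>" using \<sigma> by (simp add: abs_mult)
          finally show ?thesis using S_ub[OF that] by simp
        qed
        have "((\<lambda>t. exp (- (a+K) * t)) \<longlongrightarrow> 0) at_top" using aK by real_asymp
        hence "(f \<longlongrightarrow> 0 * (\<sigma> * (c - c) - S / (a+K))) at_top" unfolding f_def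
          using lims by (intro tendsto_intros) 
        thus "(f \<longlongrightarrow> 0) at_top" by simp
      qed
      thus ?thesis by (simp add: f_def mult_le_0_iff)
    qed
    from this[of 1] this[of "-1"] show ?thesis by simp
  qed
  have \<Delta>\<eta>': "\<bar>D\<eta> t\<bar> \<le> C0 * S * exp (- \<gamma> * t)" if t: "t \<ge> S0" for t
  proof -
    have sc: "x t = exp (- K*t) * \<xi> t" "x' t = exp (- K*t) * \<xi>' t" "y t = exp (- K*t) * \<eta> t" "y' t = exp (- K*t) * \<eta>' t"
      by (simp_all add: \<xi>_def \<xi>'_def \<eta>_def \<eta>'_def mult.assoc[symmetric] exp_add[symmetric])
    have nn: "\<xi> t \<ge> 0" "\<xi>' t \<ge> 0" "\<eta> t \<ge> 0" "\<eta>' t \<ge> 0" "\<xi> t \<le> B" "\<xi>' t \<le> B" "\<eta> t \<le> B" "\<eta>' t \<le> B"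
      using T0[of t] t pos(1)[of t] pos(2)[of t] by (auto simp: S0_def \<xi>_def \<xi>'_def \<eta>_def \<eta>'_def)
    have ee: "exp (K*t) * (exp (- K*t*r)) = exp (- ((r-1) * K * t))" for r by (simp add: exp_add[symmetric] algebra_simps)
    have pw: "x t powr p = exp (- K*t*p) * \<xi> t powr p" "x' t powr p = exp (- K*t*p) * \<xi>' t powr p"
       "\<bar>y t\<bar> powr q = exp (- K*t*q) * \<eta> t powr q" "\<bar>y' t\<bar> powr q = exp (- K*t*q) * \<eta>' t powr q"
      unfolding sc using nn by (simp_all add: powr_mult exp_powr_real abs_mult)
    have "exp (K*t) * (x t powr p - x' t powr p) = exp (- ((p-1) * K * t)) * (\<xi> t powr p - \<xi>' t powr p)"
      by (simp only: pw right_diff_distrib[symmetric] mult.assoc[symmetric] ee)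
    moreover have "exp (K*t) * (\<bar>y t\<bar> powr q - \<bar>y' t\<bar> powr q) = exp (- \<gamma> * t) * (\<eta> t powr q - \<eta>' t powr q)"
      by (simp only: pw right_diff_distrib[symmetric] mult.assoc[symmetric] ee) (simp add: \<gamma>_def mult.assoc)
    moreover have "D\<eta> t = exp (K*t) * (x t powr p - x' t powr p) - m * (exp (K*t) * (\<bar>y t\<bar> powr q - \<bar>y' t\<bar> powr q))"
      unfolding D\<eta>_def by (simp add: algebra_simps)
    ultimately have "D\<eta> t = exp (- ((p-1) * K * t)) * (\<xi> t powr p - \<xi>' t powr p) - m * (exp (- \<gamma> * t) * (\<eta> t powr q - \<eta>' t powr q))"
      by (simp only:)
    hence "\<bar>D\<eta> t\<bar> \<le> exp (- ((p-1) * K * t)) * \<bar>\<xi> t powr p - \<xi>' t powr p\<bar> + m * (exp (- \<gamma> * t) * \<bar>\<eta> t powr q - \<eta>' t powr q\<bar>)"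
      using m0 abs_triangle_ineq4 by (metis (no_types, lifting) abs_exp_cancel abs_mult abs_of_pos)
    also have "\<dots> \<le> exp (- \<gamma> * t) * (p * B powr (p-1) * (S / (a+K))) + m * (exp (- \<gamma> * t) * (q * B powr (q-1) * S))"
    proof (intro add_mono mult_left_mono mult_mono)
      have "(q-1) * (K * t) \<le> (p-1) * (K * t)" using q_bounds K0 t by (intro mult_right_mono) (auto simp: S0_def)
      thus "exp (- ((p-1) * K * t)) \<le> exp (- \<gamma> * t)" by (simp add: \<gamma>_def mult.assoc)
      have "\<bar>\<xi> t powr p - \<xi>' t powr p\<bar> \<le> p * B powr (p-1) * \<bar>\<xi> t - \<xi>' t\<bar>" using nn p1 by (intro powr_lipschitz) auto
      also have "\<dots> \<le> p * B powr (p-1) * (S / (a+K))" using \<Delta>\<xi>[OF t] p1 by (intro mult_left_mono) auto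
      finally show "\<bar>\<xi> t powr p - \<xi>' t powr p\<bar> \<le> p * B powr (p-1) * (S / (a+K))" .
      have "\<bar>\<eta> t powr q - \<eta>' t powr q\<bar> \<le> q * B powr (q-1) * \<bar>\<eta> t - \<eta>' t\<bar>" using nn q_bounds by (intro powr_lipschitz) auto
      also have "\<dots> \<le> q * B powr (q-1) * S" using S_ub[OF t] q_bounds by (intro mult_left_mono) auto
      finally show "\<bar>\<eta> t powr q - \<eta>' t powr q\<bar> \<le> q * B powr (q-1) * S" .
    qed (use m0 in auto)
    also have "\<dots> = C0 * S * exp (- \<gamma> * t)" by (simp add: C0_def algebra_simps)
    finally show ?thesis .
  qed
  have half: "\<bar>\<eta> t - \<eta>' t\<bar> \<le> S / 2" if t: "t \<ge> S0" for t
  proof -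
    have "\<sigma> * (\<eta> t - \<eta>' t) \<le> S / 2" if \<sigma>: "\<bar>\<sigma>\<bar> = 1" for \<sigma> :: real
    proof -
      \<comment> \<open>The subtracted term is the tail integral of the bound on
        \<open>D\<eta>\<close>; past \<open>T1\<close> its coefficient of S is below 1/2.\<close>
      define f where "f = (\<lambda>t. \<sigma> * (\<eta> t - \<eta>' t) - S * (C0 / \<gamma> * exp (- \<gamma> * t)))"
      have "f t \<le> 0"
      proof (rule deriv_nonneg_le_limit[OF _ _ _ t, where f' = "\<lambda>t. \<sigma> * D\<eta> t + C0 * S * exp (- \<gamma> * t)"])
        show "(f has_real_derivative \<sigma> * D\<eta> t + C0 * S * exp (- \<gamma> * t)) (at t)" for t
          unfolding f_def by (rule derivative_eq_intros refl d\<eta>)+ (use \<gamma> in \<open>simp add: field_simps\<close>)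
        show "\<sigma> * D\<eta> t + C0 * S * exp (- \<gamma> * t) \<ge> 0" if "t \<ge> S0" for t
        proof -
          have "\<bar>\<sigma> * D\<eta> t\<bar> = \<bar>D\<eta> t\<bar>" using \<sigma> by (simp add: abs_mult)
          thus ?thesis using \<Delta>\<eta>'[OF that] by linarith
        qed
        have "((\<lambda>t. C0 / \<gamma> * exp (- \<gamma> * t)) \<longlongrightarrow> 0) at_top" using \<gamma> by real_asymp
        hence "(f \<longlongrightarrow> \<sigma> * ((a+K)*c - (a+K)*c) - S * 0) at_top" unfolding f_def
          using lims by (intro tendsto_intros) 
        thus "(f \<longlongrightarrow> 0) at_top" by simp
      qed
      hence "\<sigma> * (\<eta> t - \<eta>' t) \<le> S * (C0 / \<gamma> * exp (- \<gamma> * t))" by (simp add: f_def)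
      also have "\<dots> \<le> S * (1/2)" using T1[of t] t S_ge by (intro mult_left_mono) (auto simp: S0_def)
      finally show ?thesis by simp
    qed
    from this[of 1] this[of "-1"] show ?thesis by (simp add: abs_if)
  qed
  have "S \<le> S / 2" unfolding S_def by (rule cSUP_least) (use half in \<open>auto simp: S_def[symmetric]\<close>)
  hence S0: "S = 0" using S_ge by simp
  have "\<xi> S0 = \<xi>' S0" "\<eta> S0 = \<eta>' S0" using \<Delta>\<xi>[of S0] half[of S0] S0 by auto
  hence eq: "x S0 = x' S0" "y S0 = y' S0" by (auto simp: \<xi>_def \<xi>'_def \<eta>_def \<eta>'_def)
  show ?thesis using traj_unique[OF T _ eq] pos by (meson less_imp_le)
qed

end

section \<open>Existence of the stable manifold\<close>

text \<open>Clipping before taking powers makes the nonlinearities bounded and globally Lipschitz,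
  whatever the sign of the argument.\<close>

definition clip :: "real \<Rightarrow> real \<Rightarrow> real" where "clip A z = max 0 (min A z)"

lemma clip_bounds: "A > 0 \<Longrightarrow> 0 \<le> clip A z" "A > 0 \<Longrightarrow> clip A z \<le> A"
  by (auto simp: clip_def)

lemma clip_lipschitz: "\<bar>clip A u - clip A v\<bar> \<le> \<bar>u - v\<bar>"
  by (auto simp: clip_def max_def min_def)

lemma continuous_on_clip: "continuous_on S f \<Longrightarrow> continuous_on S (\<lambda>x. clip A (f x))"
  unfolding clip_def by (intro continuous_intros)

lemma clip_powr_lipschitz:
  assumes "A > 0" "r > 1"
  shows "\<bar>clip A u powr r - clip A v powr r\<bar> \<le> r * A powr (r-1) * \<bar>u - v\<bar>"
proof -
  have "\<bar>clip A u powr r - clip A v powr r\<bar> \<le> r * A powr (r-1) * \<bar>clip A u - clip A v\<bar>"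
    using assms clip_bounds by (intro powr_lipschitz) auto
  also have "\<dots> \<le> r * A powr (r-1) * \<bar>u - v\<bar>"
    using assms clip_lipschitz by (intro mult_left_mono) auto
  finally show ?thesis .
qed

lemma continuous_on_integral_from_0:
  fixes g :: "real \<Rightarrow> real"
  assumes "continuous_on {0..} g" shows "continuous_on {0..} (\<lambda>r. integral {0..r} g)"
  unfolding continuous_on_eq_continuous_within
proof
  fix r :: real assume r: "r \<in> {0..}"
  have "continuous_on {0..r+1} (\<lambda>r. integral {0..r} g)"
    using assms by (intro indefinite_integral_continuous_1 integrable_continuous_interval) (auto intro: continuous_on_subset)
  hence "continuous (at r within {0..r+1}) (\<lambda>r. integral {0..r} g)"
    using r by (simp add: continuous_on_eq_continuous_within)
  moreover have "at r within {0..} = at r within {0..r+1}"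
    using r by (intro at_within_nhd[of r "{..<r+1}"]) auto
  ultimately show "continuous (at r within {0..}) (\<lambda>r. integral {0..r} g)" by (simp add: continuous_within)
qed

lemma DERIV_integral_from_0:
  fixes g :: "real \<Rightarrow> real"
  assumes "continuous_on {0..} g" "r > 0" shows "((\<lambda>r. integral {0..r} g) has_real_derivative g r) (at r)"
proof -
  have "((\<lambda>x. integral {0..x} g) has_real_derivative g r) (at r within {0..r+1})"
    using assms by (intro integral_has_real_derivative) (auto intro: continuous_on_subset)
  moreover have "at r within {0..r+1} = at r"
    using assms(2) by (intro at_within_interior) auto
  ultimately show ?thesis by simp
qed

lemma integral_abs_le_primitive:
  fixes g G G' :: "real \<Rightarrow> real"
  assumes g: "continuous_on {0..} g" and "r \<ge> 0" and contG: "continuous_on {0..r} G"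
    and dG: "\<And>s. 0 < s \<Longrightarrow> s < r \<Longrightarrow> (G has_real_derivative G' s) (at s)"
    and le: "\<And>s. 0 < s \<Longrightarrow> s < r \<Longrightarrow> \<bar>g s\<bar> \<le> G' s"
  shows "\<bar>integral {0..r} g\<bar> \<le> G r - G 0"
proof -
  have 1: "\<sigma> * integral {0..r} g \<le> G r - G 0" if \<sigma>: "\<bar>\<sigma>\<bar> = 1" for \<sigma> :: real
  proof -
    define h where "h = (\<lambda>r. G r - \<sigma> * integral {0..r} g)"
    have "h 0 \<le> h r"
    proof (rule DERIV_nonneg_imp_increasing_open[OF \<open>r \<ge> 0\<close>])
      show "continuous_on {0..r} h" unfolding h_def
        by (intro continuous_intros contG continuous_on_subset[OF continuous_on_integral_from_0[OF g]]) auto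
      fix s assume s: "0 < s" "s < r"
      have "(h has_real_derivative G' s - \<sigma> * g s) (at s)" unfolding h_def
        by (intro DERIV_diff DERIV_cmult dG s DERIV_integral_from_0 g)
      moreover have "\<sigma> * g s \<le> \<bar>\<sigma> * g s\<bar>" by simp
      hence "G' s - \<sigma> * g s \<ge> 0" using le[OF s] \<sigma> by (simp add: abs_mult)
      ultimately show "\<exists>d. (h has_real_derivative d) (at s) \<and> 0 \<le> d" by blast
    qed
    thus ?thesis by (simp add: h_def)
  qed
  from 1[of 1] 1[of "-1"] show ?thesis by (simp add: abs_if)
qed

section \<open>The scaled system in the variable r = e^(-k t)\<close>

context emden
begin

text \<open>With r = e^(-k t) the equation for \<eta> becomes \<eta>' = r^(p+1) \<xi>^p - m r
  \<eta>^q, because k (p+1) = (p-1) K by \<open>q_p\<close>. Division by dr/dt = -k r leaves an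
  equation in r that is regular at r = 0.\<close>

definition k :: real where "k = (q-1) * K"
definition lam :: real where "lam = (a+K)/k"

lemma k_pos: "k > 0" using q_bounds K0 by (simp add: k_def)

lemma lam_gt1: "lam > 1"
proof -
  have "k < 1 * K" unfolding k_def using q_bounds K0 by (intro mult_strict_right_mono) auto
  thus ?thesis using k_pos a0 by (simp add: lam_def)
qed

text \<open>In r the equation for \<xi> reads r \<xi>_r = \<eta>/k - lam \<xi>. The homogeneous
  solution r^(-lam) blows up at r = 0, so this is the only solution that stays bounded
  there.\<close>

definition avg :: "(real \<Rightarrow> real) \<Rightarrow> real \<Rightarrow> real" where
  "avg \<eta> r = r powr (-lam) / k * integral {0..r} (\<lambda>s. s powr (lam-1) * \<eta> s)"

lemma avg_integrand_cont: "continuous_on {0..} \<eta> \<Longrightarrow> continuous_on {0..} (\<lambda>s. s powr (lam-1) * \<eta> s)"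
  using lam_gt1 by (auto intro!: continuous_intros continuous_on_powr')

lemma avg_deriv:
  assumes "continuous_on {0..} \<eta>" "r > 0"
  shows "(avg \<eta> has_real_derivative (\<eta> r / k - lam * avg \<eta> r) / r) (at r)"
proof -
  define I where "I = (\<lambda>r. integral {0..r} (\<lambda>s. s powr (lam-1) * \<eta> s))"
  have dI: "(I has_real_derivative r powr (lam-1) * \<eta> r) (at r)"
    unfolding I_def by (rule DERIV_integral_from_0[OF avg_integrand_cont[OF assms(1)] assms(2)])
  have dp: "((\<lambda>r. r powr (-lam) / k) has_real_derivative (-lam) * r powr (-lam-1) / k) (at r)"
    by (intro DERIV_cdivide has_real_derivative_powr assms)
  have "(avg \<eta> has_real_derivative (-lam) * r powr (-lam-1) / k * I r + (r powr (lam-1) * \<eta> r) * (r powr (-lam) / k)) (at r)"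
    unfolding avg_def[abs_def] I_def[symmetric] using DERIV_mult[OF dp dI] unfolding I_def by simp
  moreover have "(-lam) * r powr (-lam-1) / k * I r + (r powr (lam-1) * \<eta> r) * (r powr (-lam) / k) = (\<eta> r / k - lam * avg \<eta> r) / r"
  proof -
    have "r powr (-lam-1) = r powr (-lam) / r" using assms(2) by (simp add: powr_diff)
    hence "(-lam) * r powr (-lam-1) / k * I r = - lam * avg \<eta> r / r" by (simp add: avg_def I_def mult_ac)
    moreover have "r powr (lam-1) * r powr (-lam) = 1 / r"
      using assms(2) by (simp add: powr_minus_divide powr_diff)
    moreover have "(r powr (lam-1) * \<eta> r) * (r powr (-lam) / k) = (r powr (lam-1) * r powr (-lam)) * (\<eta> r / k)" by simp
    ultimately show ?thesis by (simp add: diff_divide_distrib)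
  qed
  ultimately show ?thesis by simp
qed

text \<open>The kernel of \<open>avg\<close> has total mass 1/(k lam) = 1/(a+K), independently of
  r.\<close>

lemma avg_diff_le:
  assumes c: "continuous_on {0..} \<eta>1" "continuous_on {0..} \<eta>2" and "r > 0"
    and le: "\<And>s. 0 < s \<Longrightarrow> s < r \<Longrightarrow> \<bar>\<eta>1 s - \<eta>2 s\<bar> \<le> S"
  shows "\<bar>avg \<eta>1 r - avg \<eta>2 r\<bar> \<le> S / (a+K)"
proof -
  have int: "(\<lambda>s. s powr (lam-1) * \<eta>1 s) integrable_on {0..r}" "(\<lambda>s. s powr (lam-1) * \<eta>2 s) integrable_on {0..r}"
    using c by (auto intro!: integrable_continuous_interval continuous_on_subset[OF avg_integrand_cont])
  have "\<bar>integral {0..r} (\<lambda>s. s powr (lam-1) * (\<eta>1 s - \<eta>2 s))\<bar> \<le> S / lam * r powr lam - S / lam * 0 powr lam"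
  proof (rule integral_abs_le_primitive[where G' = "\<lambda>s. S / lam * (lam * s powr (lam-1))"])
    show "continuous_on {0..} (\<lambda>s. s powr (lam - 1) * (\<eta>1 s - \<eta>2 s))"
      by (intro avg_integrand_cont continuous_intros c)
    show "continuous_on {0..r} (\<lambda>r. S / lam * r powr lam)"
      using lam_gt1 by (auto intro!: continuous_intros continuous_on_powr')
    fix s assume s: "0 < s" "s < r"
    show "((\<lambda>r. S / lam * r powr lam) has_real_derivative S / lam * (lam * s powr (lam-1))) (at s)"
      by (intro DERIV_cmult has_real_derivative_powr s)
    have "s powr (lam-1) * \<bar>\<eta>1 s - \<eta>2 s\<bar> \<le> s powr (lam-1) * S" using le[OF s] by (intro mult_left_mono) auto
    thus "\<bar>s powr (lam-1) * (\<eta>1 s - \<eta>2 s)\<bar> \<le> S / lam * (lam * s powr (lam-1))"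
      using lam_gt1 by (simp add: abs_mult mult_ac)
  qed (use assms in auto)
  hence *: "\<bar>integral {0..r} (\<lambda>s. s powr (lam-1) * (\<eta>1 s - \<eta>2 s))\<bar> \<le> S / lam * r powr lam" by simp
  have "avg \<eta>1 r - avg \<eta>2 r = r powr (-lam) / k * integral {0..r} (\<lambda>s. s powr (lam-1) * (\<eta>1 s - \<eta>2 s))"
    unfolding avg_def right_diff_distrib integral_diff[OF int] by (simp add: algebra_simps)
  hence "\<bar>avg \<eta>1 r - avg \<eta>2 r\<bar> = r powr (-lam) / k * \<bar>integral {0..r} (\<lambda>s. s powr (lam-1) * (\<eta>1 s - \<eta>2 s))\<bar>"
    using k_pos by (simp add: abs_mult)
  also have "\<dots> \<le> r powr (-lam) / k * (S / lam * r powr lam)"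
    using k_pos by (intro mult_left_mono *) simp
  also have "\<dots> = S / (k * lam)" using assms(3) by (simp add: powr_minus field_simps)
  also have "k * lam = a + K" using k_pos by (simp add: lam_def)
  finally show ?thesis .
qed

text \<open>At r = 0 the average is a quotient 0/0; its limit supplies the decay constant of
  \<xi>.\<close>

lemma avg_tendsto:
  assumes c: "continuous_on {0..} \<eta>"
  shows "(avg \<eta> \<longlongrightarrow> \<eta> 0 / (a+K)) (at_right 0)"
proof -
  define I where "I = (\<lambda>r. integral {0..r} (\<lambda>s. s powr (lam-1) * \<eta> s))"
  have cI: "continuous_on {0..} I" unfolding I_def by (intro continuous_on_integral_from_0 avg_integrand_cont c)
  have lim0: "(f \<longlongrightarrow> f 0) (at_right 0)" if "continuous_on {0..} f" for f :: "real \<Rightarrow> real"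
  proof -
    have "(f \<longlongrightarrow> f 0) (at 0 within {0..})" using that by (simp add: continuous_on_def)
    thus ?thesis by (rule tendsto_within_subset) auto
  qed
  have pos: "\<forall>\<^sub>F r in at_right (0::real). r > 0" by (simp add: eventually_at_right_less)
  have "((\<lambda>r. I r / (k * r powr lam)) \<longlongrightarrow> \<eta> 0 / (k * lam)) (at_right 0)"
  proof (rule lhopital_right_0)
    show "(I \<longlongrightarrow> 0) (at_right 0)" using lim0[OF cI] by (simp add: I_def)
    have "continuous_on {0..} (\<lambda>r. k * r powr lam)" using lam_gt1 by (auto intro!: continuous_intros continuous_on_powr')
    from lim0[OF this] show "((\<lambda>r. k * r powr lam) \<longlongrightarrow> 0) (at_right 0)" by simp
    show "\<forall>\<^sub>F r in at_right 0. k * r powr lam \<noteq> 0" "\<forall>\<^sub>F r in at_right 0. k * (lam * r powr (lam-1)) \<noteq> 0"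
      using pos by (eventually_elim, use k_pos lam_gt1 in simp)+
    show "\<forall>\<^sub>F r in at_right 0. (I has_real_derivative r powr (lam-1) * \<eta> r) (at r)"
      using pos by eventually_elim (unfold I_def, intro DERIV_integral_from_0 avg_integrand_cont c)
    show "\<forall>\<^sub>F r in at_right 0. ((\<lambda>r. k * r powr lam) has_real_derivative k * (lam * r powr (lam-1))) (at r)"
      using pos by eventually_elim (intro DERIV_cmult has_real_derivative_powr)
    have "((\<lambda>r. \<eta> r / (k * lam)) \<longlongrightarrow> \<eta> 0 / (k * lam)) (at_right 0)"
      using lim0[OF c] lam_gt1 k_pos by (intro tendsto_intros) auto
    moreover have "\<forall>\<^sub>F r in at_right 0. \<eta> r / (k * lam) = r powr (lam-1) * \<eta> r / (k * (lam * r powr (lam-1)))"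
      using pos by eventually_elim (simp add: field_simps)
    ultimately show "((\<lambda>r. r powr (lam-1) * \<eta> r / (k * (lam * r powr (lam-1)))) \<longlongrightarrow> \<eta> 0 / (k * lam)) (at_right 0)"
      by (rule Lim_transform_eventually)
  qed
  moreover have "\<forall>\<^sub>F r in at_right 0. I r / (k * r powr lam) = avg \<eta> r"
    using pos by eventually_elim (simp add: avg_def I_def powr_minus field_simps)
  ultimately have "(avg \<eta> \<longlongrightarrow> \<eta> 0 / (k * lam)) (at_right 0)" by (rule Lim_transform_eventually)
  thus ?thesis using k_pos by (simp add: lam_def)
qed

text \<open>Minus the derivative of \<eta> with respect to r, with \<xi> eliminated through
  \<open>avg\<close>; the system is thus one integral equation for \<eta>.\<close>

definition rhs :: "real \<Rightarrow> (real \<Rightarrow> real) \<Rightarrow> real \<Rightarrow> real" where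
  "rhs A \<eta> r = (r powr p * clip A (avg \<eta> r) powr p - m * clip A (\<eta> r) powr q) / k"

text \<open>At r = 0 the value of \<open>avg\<close> is 0 by the convention
  \<open>0 powr (-lam) = 0\<close>, in general not its limit. The factor r^p times a clipped, hence
  bounded, quantity is continuous there all the same.\<close>

lemma rhs_cont:
  assumes "A > 0" and c: "continuous_on {0..} \<eta>" shows "continuous_on {0..} (rhs A \<eta>)"
proof -
  define f where "f = (\<lambda>r. r powr p * clip A (avg \<eta> r) powr p)"
  have "continuous_on {0..} f"
    unfolding continuous_on_eq_continuous_within
  proof
    fix r :: real assume "r \<in> {0..}"
    then consider "r = 0" | "r > 0" by fastforce
    thus "continuous (at r within {0..}) f"
    proof cases
      case 1
      have "continuous_on {0..} (\<lambda>r. r powr p * A powr p)" using p1 by (auto intro!: continuous_intros continuous_on_powr')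
      from this[unfolded continuous_on_def, rule_format, of 0]
      have "((\<lambda>r. r powr p * A powr p) \<longlongrightarrow> 0) (at 0 within {0..})" by simp
      hence "(f \<longlongrightarrow> 0) (at 0 within {0..})"
      proof (rule Lim_null_comparison[rotated])
        show "\<forall>\<^sub>F r in at 0 within {0..}. norm (f r) \<le> r powr p * A powr p"
          unfolding f_def using clip_bounds[OF assms(1)] p1
          by (intro always_eventually allI) (auto intro!: mult_left_mono powr_mono2)
      qed
      thus ?thesis using 1 by (simp add: continuous_within f_def)
    next
      case 2
      have "continuous (at r) (avg \<eta>)" using avg_deriv[OF c 2] by (rule DERIV_isCont)
      hence "continuous (at r) (\<lambda>r. clip A (avg \<eta> r))" unfolding clip_def by (intro continuous_intros)
      hence "continuous (at r) (\<lambda>r. clip A (avg \<eta> r) powr p)"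
        unfolding continuous_at using p1 clip_bounds[OF assms(1)] 
        by (intro tendsto_powr' tendsto_const) (auto intro!: always_eventually)
      moreover have "continuous (at r) (\<lambda>r. r powr p)" using has_real_derivative_powr[OF 2] by (rule DERIV_isCont)
      ultimately have "continuous (at r) f" unfolding f_def by (intro continuous_mult)
      thus ?thesis by (rule continuous_at_imp_continuous_within)
    qed
  qed
  moreover have "continuous_on {0..} (\<lambda>r. clip A (\<eta> r) powr q)"
    by (intro continuous_on_powr' continuous_on_clip c continuous_on_const) (use q_bounds clip_bounds[OF assms(1)] in auto)
  ultimately show ?thesis unfolding rhs_def f_def using k_pos
    by (intro continuous_on_divide continuous_on_diff continuous_on_mult_left continuous_on_const) auto
qed

text \<open>A contraction in an exponentially weighted sup norm: \<eta> is written as e^\<Lambda> f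
  with f bounded and continuous. Since \<Lambda>' is twice the Lipschitz bound of
  \<open>rhs\<close>, the contraction factor is 1/2 on the whole half-line, with no continuation in
  steps.\<close>

lemma truncated_fixed_point:
  assumes A: "A > 0"
  shows "\<exists>\<eta>. continuous_on {0..} \<eta> \<and> (\<forall>r\<ge>0. \<eta> r = 1 - integral {0..r} (rhs A \<eta>))"
proof -
  define M where "M = (A powr p + m * A powr q) / k"
  define C1 where "C1 = (p * A powr (p-1) / (a+K) + m * (q * A powr (q-1))) / k"
  have C1: "C1 > 0" using p1 q_bounds a0 K0 m0 k_pos A by (auto simp: C1_def intro!: divide_pos_pos add_pos_pos mult_pos_pos)
  have M: "M \<ge> 0" using m0 k_pos by (simp add: M_def)
  define \<Lambda> where "\<Lambda> = (\<lambda>r. 2 * C1 * (r + r powr (p+1) / (p+1)))"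
  have \<Lambda>0: "\<Lambda> 0 = 0" by (simp add: \<Lambda>_def)
  have cont\<Lambda>: "continuous_on {0..} \<Lambda>" unfolding \<Lambda>_def using p1 by (auto intro!: continuous_intros continuous_on_powr')
  have d\<Lambda>: "(\<Lambda> has_real_derivative 2 * C1 * (1 + r powr p)) (at r)" if "r > 0" for r
  proof -
    have "((\<lambda>r. r powr (p+1) / (p+1)) has_real_derivative r powr p) (at r)"
      using DERIV_cdivide[OF has_real_derivative_powr[OF that, of "p+1"], of "p+1"] p1 by simp
    thus ?thesis unfolding \<Lambda>_def by (intro DERIV_cmult DERIV_add DERIV_ident)
  qed
  have \<Lambda>mono: "\<Lambda> s \<le> \<Lambda> r" if "0 \<le> s" "s \<le> r" for s r
    unfolding \<Lambda>_def using that C1 p1 by (intro mult_left_mono add_mono divide_right_mono powr_mono2) auto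
  define E where "E = (\<lambda>f::real \<Rightarrow>\<^sub>C real. \<lambda>r. exp (\<Lambda> r) * f r)"
  have Ec: "continuous_on {0..} (E f)" for f
    unfolding E_def by (intro continuous_intros cont\<Lambda> continuous_on_apply_bcontfun)
  have rc: "continuous_on {0..} (rhs A (E f))" for f by (rule rhs_cont[OF A Ec])
  \<comment> \<open>The \<open>max 0 r\<close> extends the image constantly to negative r, as
    elements of the function space live on the whole line.\<close>
  define \<Phi> where "\<Phi> = (\<lambda>f r. exp (- \<Lambda> (max 0 r)) * (1 - integral {0..max 0 r} (rhs A (E f))))"
  have rbound: "\<bar>rhs A \<eta> r\<bar> \<le> M * (1 + r powr p)" if "r \<ge> 0" for \<eta> r
  proof -
    define u v where "u = clip A (avg \<eta> r) powr p" and "v = clip A (\<eta> r) powr q"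
    have uv: "0 \<le> u" "u \<le> A powr p" "0 \<le> v" "v \<le> A powr q"
      unfolding u_def v_def using clip_bounds[OF A] p1 q_bounds by (auto intro!: powr_mono2)
    have "\<bar>r powr p * u - m * v\<bar> \<le> r powr p * u + m * v" using uv m0 by (intro abs_leI) (auto simp: add_nonneg_nonneg)
    also have "\<dots> \<le> r powr p * A powr p + m * A powr q" using uv m0 by (intro add_mono mult_left_mono) auto
    also have "\<dots> \<le> (A powr p + m * A powr q) * (1 + r powr p)" using m0 by (simp add: algebra_simps)
    finally have "\<bar>r powr p * u - m * v\<bar> \<le> (A powr p + m * A powr q) * (1 + r powr p)" .
    thus ?thesis unfolding rhs_def u_def[symmetric] v_def[symmetric] M_def using k_pos
      by (simp add: divide_right_mono)
  qed
  have \<Phi>bc: "\<Phi> f \<in> bcontfun" for f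
  proof (rule bcontfun_normI)
    have c: "continuous_on {0..} (\<lambda>r. exp (- \<Lambda> r) * (1 - integral {0..r} (rhs A (E f))))"
      by (intro continuous_intros cont\<Lambda> continuous_on_integral_from_0 rc)
    show "continuous_on UNIV (\<Phi> f)" unfolding \<Phi>_def
      by (rule continuous_on_compose2[OF c, of UNIV "\<lambda>r. max 0 r"]) (auto intro!: continuous_intros)
    fix x :: real
    define r where "r = max 0 x"
    have r: "r \<ge> 0" by (simp add: r_def)
    have "\<bar>integral {0..r} (rhs A (E f))\<bar> \<le> M / (2 * C1) * \<Lambda> r - M / (2 * C1) * \<Lambda> 0"
    proof (rule integral_abs_le_primitive[OF rc r, where G' = "\<lambda>r. M / (2 * C1) * (2 * C1 * (1 + r powr p))"])
      show "continuous_on {0..r} (\<lambda>r. M / (2 * C1) * \<Lambda> r)"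
        by (intro continuous_intros continuous_on_subset[OF cont\<Lambda>]) auto
      show "((\<lambda>r. M / (2 * C1) * \<Lambda> r) has_real_derivative M / (2 * C1) * (2 * C1 * (1 + s powr p))) (at s)" if "0 < s" for s
        by (intro DERIV_cmult d\<Lambda> that)
      show "\<bar>rhs A (E f) s\<bar> \<le> M / (2 * C1) * (2 * C1 * (1 + s powr p))" if "0 < s" for s
        using rbound[of s "E f"] that C1 by simp
    qed
    also have "\<dots> = M / (2 * C1) * \<Lambda> r" by (simp add: \<Lambda>0)
    also have "\<Lambda> r \<le> exp (\<Lambda> r)" using exp_ge_add_one_self[of "\<Lambda> r"] by linarith
    hence "M / (2 * C1) * \<Lambda> r \<le> M / (2 * C1) * exp (\<Lambda> r)"
      using M C1 by (intro mult_left_mono) auto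
    finally have "\<bar>1 - integral {0..r} (rhs A (E f))\<bar> \<le> 1 + M / (2 * C1) * exp (\<Lambda> r)" by linarith
    hence "exp (- \<Lambda> r) * \<bar>1 - integral {0..r} (rhs A (E f))\<bar> \<le> exp (- \<Lambda> r) * (1 + M / (2 * C1) * exp (\<Lambda> r))"
      by (intro mult_left_mono) auto
    also have "\<dots> = exp (- \<Lambda> r) + M / (2 * C1)" by (simp add: algebra_simps exp_minus)
    also have "\<dots> \<le> 1 + M / (2 * C1)" using \<Lambda>mono[of 0 r] r \<Lambda>0 by simp
    finally show "norm (\<Phi> f x) \<le> 1 + M / (2 * C1)" unfolding \<Phi>_def r_def[symmetric] by (simp add: abs_mult)
  qed
  define \<Psi> where "\<Psi> = (\<lambda>f. Bcontfun (\<Phi> f))"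
  have \<Psi>ap: "apply_bcontfun (\<Psi> f) = \<Phi> f" for f unfolding \<Psi>_def by (rule Bcontfun_inverse[OF \<Phi>bc])
  have rdiff: "\<bar>rhs A (E f) r - rhs A (E g) r\<bar> \<le> dist f g / 2 * (exp (\<Lambda> r) * (2 * C1 * (1 + r powr p)))" if r: "r > 0" for f g r
  proof -
    \<comment> \<open>Because \<open>avg\<close> sees all of {0..r}, the difference must be bounded
      on the whole interval; monotonicity of \<Lambda> puts the worst weight at r.\<close>
    define S where "S = exp (\<Lambda> r) * dist f g"
    have S: "\<bar>E f s - E g s\<bar> \<le> S" if "0 \<le> s" "s \<le> r" for s
    proof -
      have "\<bar>E f s - E g s\<bar> = exp (\<Lambda> s) * \<bar>f s - g s\<bar>" by (simp add: E_def right_diff_distrib[symmetric] abs_mult)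
      also have "\<dots> \<le> exp (\<Lambda> r) * dist f g"
        using \<Lambda>mono[OF that] dist_bounded[of f s g] by (intro mult_mono) (auto simp: dist_real_def)
      finally show ?thesis by (simp add: S_def)
    qed
    have S0: "S \<ge> 0" by (simp add: S_def)
    have 1: "\<bar>avg (E f) r - avg (E g) r\<bar> \<le> S / (a+K)" using S r by (intro avg_diff_le Ec) auto
    have "\<bar>clip A (avg (E f) r) powr p - clip A (avg (E g) r) powr p\<bar> \<le> p * A powr (p-1) * (S / (a+K))"
      using 1 p1 by (intro order.trans[OF clip_powr_lipschitz[OF A p1] mult_left_mono]) auto
    hence "r powr p * \<bar>clip A (avg (E f) r) powr p - clip A (avg (E g) r) powr p\<bar> \<le> (1 + r powr p) * (p * A powr (p-1) * (S / (a+K)))"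
      using p1 by (intro mult_mono) auto
    moreover have "\<bar>clip A (E f r) powr q - clip A (E g r) powr q\<bar> \<le> q * A powr (q-1) * S"
      using S[of r] r q_bounds
      by (intro order.trans[OF clip_powr_lipschitz[OF A q_bounds(1)] mult_left_mono]) auto
    hence "m * \<bar>clip A (E f r) powr q - clip A (E g r) powr q\<bar> \<le> m * (q * A powr (q-1) * S)"
      using m0 by (intro mult_left_mono) auto
    moreover have "m * (q * A powr (q-1) * S) * 1 \<le> m * (q * A powr (q-1) * S) * (1 + r powr p)"
      using m0 q_bounds S0 by (intro mult_left_mono) auto
    moreover have "\<bar>rhs A (E f) r - rhs A (E g) r\<bar> * k \<le> 
       r powr p * \<bar>clip A (avg (E f) r) powr p - clip A (avg (E g) r) powr p\<bar> + m * \<bar>clip A (E f r) powr q - clip A (E g r) powr q\<bar>"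
    proof -
      define a1 a2 b1 b2 where "a1 = clip A (avg (E f) r) powr p" and "a2 = clip A (avg (E g) r) powr p"
        and "b1 = clip A (E f r) powr q" and "b2 = clip A (E g r) powr q"
      have "(rhs A (E f) r - rhs A (E g) r) * k = r powr p * (a1 - a2) - m * (b1 - b2)"
        unfolding rhs_def a1_def b1_def a2_def b2_def using k_pos by (simp add: field_simps)
      hence "\<bar>rhs A (E f) r - rhs A (E g) r\<bar> * k = \<bar>r powr p * (a1 - a2) - m * (b1 - b2)\<bar>"
        using k_pos by (metis abs_mult abs_of_pos)
      also have "\<dots> \<le> \<bar>r powr p * (a1 - a2)\<bar> + \<bar>m * (b1 - b2)\<bar>" by (rule abs_triangle_ineq4)
      also have "\<dots> = r powr p * \<bar>a1 - a2\<bar> + m * \<bar>b1 - b2\<bar>" using m0 by (simp add: abs_mult)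
      finally show ?thesis unfolding a1_def b1_def a2_def b2_def .
    qed
    ultimately have "\<bar>rhs A (E f) r - rhs A (E g) r\<bar> * k \<le> (1 + r powr p) * (p * A powr (p-1) * (S / (a+K))) + m * (q * A powr (q-1) * S) * (1 + r powr p)"
      by linarith
    also have "\<dots> = C1 * S * (1 + r powr p) * k" using k_pos by (simp add: C1_def field_simps)
    finally have "\<bar>rhs A (E f) r - rhs A (E g) r\<bar> \<le> C1 * S * (1 + r powr p)" using k_pos by simp
    moreover have "C1 * S * (1 + r powr p) = dist f g / 2 * (exp (\<Lambda> r) * (2 * C1 * (1 + r powr p)))"
      by (simp add: S_def field_simps)
    ultimately show ?thesis by (simp only:)
  qed
  have contr: "dist (\<Psi> f) (\<Psi> g) \<le> 1/2 * dist f g" for f g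
  proof (rule dist_bound)
    fix x :: real
    define r where "r = max 0 x"
    have r: "r \<ge> 0" by (simp add: r_def)
    have int: "rhs A (E h) integrable_on {0..r}" for h
      by (rule integrable_continuous_interval[OF continuous_on_subset[OF rc]]) auto
    have "\<bar>integral {0..r} (\<lambda>s. rhs A (E f) s - rhs A (E g) s)\<bar> \<le> dist f g / 2 * exp (\<Lambda> r) - dist f g / 2 * exp (\<Lambda> 0)"
    proof (rule integral_abs_le_primitive[OF _ r, where G' = "\<lambda>r. dist f g / 2 * (exp (\<Lambda> r) * (2 * C1 * (1 + r powr p)))"])
      show "continuous_on {0..} (\<lambda>s. rhs A (E f) s - rhs A (E g) s)" by (intro continuous_intros rc)
      show "continuous_on {0..r} (\<lambda>a. dist f g / 2 * exp (\<Lambda> a))"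
        by (intro continuous_intros continuous_on_subset[OF cont\<Lambda>]) auto
      show "((\<lambda>a. dist f g / 2 * exp (\<Lambda> a)) has_real_derivative dist f g / 2 * (exp (\<Lambda> s) * (2 * C1 * (1 + s powr p)))) (at s)"
        if "0 < s" for s by (intro DERIV_cmult DERIV_chain2[OF DERIV_exp] d\<Lambda> that)
    qed (use rdiff in auto)
    also have "\<dots> \<le> dist f g / 2 * exp (\<Lambda> r)" by simp
    finally have "\<bar>integral {0..r} (rhs A (E f)) - integral {0..r} (rhs A (E g))\<bar> \<le> dist f g / 2 * exp (\<Lambda> r)"
      by (simp add: integral_diff[OF int int])
    hence "exp (- \<Lambda> r) * \<bar>integral {0..r} (rhs A (E f)) - integral {0..r} (rhs A (E g))\<bar> \<le> exp (- \<Lambda> r) * (dist f g / 2 * exp (\<Lambda> r))"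
      by (intro mult_left_mono) auto
    also have "\<dots> = 1/2 * dist f g" by (simp add: exp_minus)
    finally have *: "exp (- \<Lambda> r) * \<bar>integral {0..r} (rhs A (E f)) - integral {0..r} (rhs A (E g))\<bar> \<le> 1/2 * dist f g" .
    have "\<Phi> f x - \<Phi> g x = exp (- \<Lambda> r) * (integral {0..r} (rhs A (E g)) - integral {0..r} (rhs A (E f)))"
      unfolding \<Phi>_def r_def[symmetric] by (simp add: algebra_simps)
    hence "dist (\<Phi> f x) (\<Phi> g x) = exp (- \<Lambda> r) * \<bar>integral {0..r} (rhs A (E f)) - integral {0..r} (rhs A (E g))\<bar>"
      by (simp add: dist_real_def abs_mult abs_minus_commute)
    thus "dist (apply_bcontfun (\<Psi> f) x) (apply_bcontfun (\<Psi> g) x) \<le> 1/2 * dist f g" using * unfolding \<Psi>ap by simp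
  qed
  obtain f where f: "\<Psi> f = f" using banach_fix_type[of "1/2" \<Psi>] contr by auto
  have "E f r = 1 - integral {0..r} (rhs A (E f))" if "r \<ge> 0" for r
  proof -
    have "f r = \<Phi> f r" using \<Psi>ap[of f] f by metis
    thus ?thesis using that unfolding E_def[of] \<Phi>_def by (simp add: max_def exp_minus E_def)
  qed
  thus ?thesis using Ec by blast
qed


text \<open>The fixed point read back in the variable t. The limits at infinity are the values at r
  = 0: \<eta> starts from 1, and \<open>avg\<close> then gives 1/(a+K) for \<xi>.\<close>

lemma truncated_trajectory:
  assumes A: "A > 0"
  shows "\<exists>\<xi> \<eta>. (\<forall>t. (\<xi> has_real_derivative (a+K) * \<xi> t - \<eta> t) (at t)) \<and>
     (\<forall>t. (\<eta> has_real_derivative exp (- ((p-1) * K) * t) * clip A (\<xi> t) powr p - m * (exp (- k * t) * clip A (\<eta> t) powr q)) (at t)) \<and>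
     (\<xi> \<longlongrightarrow> 1 / (a+K)) at_top \<and> (\<eta> \<longlongrightarrow> 1) at_top"
proof -
  obtain h where hc: "continuous_on {0..} h" and h: "\<And>r. r \<ge> 0 \<Longrightarrow> h r = 1 - integral {0..r} (rhs A h)"
    using truncated_fixed_point[OF A] by blast
  have dh: "(h has_real_derivative - rhs A h r) (at r)" if r: "r > 0" for r
  proof -
    have "((\<lambda>r. 1 - integral {0..r} (rhs A h)) has_real_derivative 0 - rhs A h r) (at r)"
      by (intro DERIV_diff DERIV_const DERIV_integral_from_0 rhs_cont A hc r)
    moreover have ev: "\<forall>\<^sub>F s in nhds r. h s = 1 - integral {0..s} (rhs A h)"
      by (rule eventually_mono[OF eventually_nhds_in_open[of "{0<..}" r]]) (use r h in auto)
    ultimately show ?thesis using DERIV_cong_ev[OF refl ev refl, of "- rhs A h r"] by simp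
  qed
  define E where "E = (\<lambda>t. exp (- k * t))"
  have E0: "E t > 0" for t by (simp add: E_def)
  have dE: "(E has_real_derivative - k * E t) (at t)" for t
    unfolding E_def by (auto intro!: derivative_eq_intros)
  have El: "filterlim E (at_right 0) at_top" unfolding E_def using k_pos by real_asymp
  define \<xi> where "\<xi> = (\<lambda>t. avg h (E t))"
  define \<eta> where "\<eta> = (\<lambda>t. h (E t))"
  have "(\<xi> has_real_derivative (a+K) * \<xi> t - \<eta> t) (at t)" for t
  proof -
    have "(\<xi> has_real_derivative (h (E t) / k - lam * avg h (E t)) / E t * (- k * E t)) (at t)"
      unfolding \<xi>_def by (rule DERIV_chain2[OF avg_deriv[OF hc E0] dE])
    moreover have "(h (E t) / k - lam * avg h (E t)) / E t * (- k * E t) = (k * lam) * avg h (E t) - h (E t)"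
      using E0[of t] k_pos by (simp add: field_simps)
    moreover have "k * lam = a + K" using k_pos by (simp add: lam_def)
    ultimately show ?thesis by (simp add: \<xi>_def \<eta>_def)
  qed
  moreover have "(\<eta> has_real_derivative exp (- ((p-1) * K) * t) * clip A (\<xi> t) powr p - m * (exp (- k * t) * clip A (\<eta> t) powr q)) (at t)" for t
  proof -
    define u v where "u = clip A (\<xi> t) powr p" and "v = clip A (\<eta> t) powr q"
    have "(\<eta> has_real_derivative - rhs A h (E t) * (- k * E t)) (at t)"
      unfolding \<eta>_def by (rule DERIV_chain2[OF dh[OF E0] dE])
    moreover have "- rhs A h (E t) * (- k * E t) = (E t * E t powr p) * u - m * (E t * v)"
      unfolding rhs_def u_def v_def \<xi>_def \<eta>_def using k_pos by (simp add: field_simps)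
    moreover have "E t * E t powr p = exp (- ((p-1) * K) * t)"
    proof -
      have "E t * E t powr p = exp (- (k * (p+1)) * t)" unfolding E_def by (simp add: exp_powr_real exp_add[symmetric] algebra_simps)
      also have "k * (p+1) = (p-1) * K" unfolding k_def using q_p by (metis mult.commute mult.left_commute)
      finally show ?thesis .
    qed
    ultimately show ?thesis unfolding u_def v_def E_def by simp
  qed
  moreover have "(\<xi> \<longlongrightarrow> 1 / (a+K)) at_top"
    using filterlim_compose[OF avg_tendsto[OF hc] El] h[of 0] by (simp add: \<xi>_def)
  moreover have "(\<eta> \<longlongrightarrow> 1) at_top"
  proof -
    have "(h \<longlongrightarrow> h 0) (at 0 within {0..})" using hc by (simp add: continuous_on_def)
    hence "(h \<longlongrightarrow> h 0) (at_right 0)" by (rule tendsto_within_subset) auto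
    from filterlim_compose[OF this El] show ?thesis using h[of 0] by (simp add: \<eta>_def)
  qed
  ultimately show ?thesis by blast
qed

text \<open>As long as the truncation is inactive, \<open>L > 0\<close> bounds the solution independently of the
  truncation level, which therefore is never reached.\<close>

theorem fast_decay_exists:
  "\<exists>x y. traj x y \<and> (\<forall>t. x t > 0 \<and> y t > 0) \<and> ((\<lambda>t. exp (K*t) * x t) \<longlongrightarrow> 1 / (a+K)) at_top \<and> (\<exists>t. L (x t) (y t) > 0)"
proof -
  have aK: "a + K > 0" using a0 K0 by simp
  from L_pos_bounded obtain R where R: "R > 0" "\<And>x y. x > 0 \<Longrightarrow> y > 0 \<Longrightarrow> L x y > 0 \<Longrightarrow> x \<le> R \<and> y \<le> R" by blast
  have "((\<lambda>t. (q-1) * m / k * exp (- k * t)) \<longlongrightarrow> 0) at_top" using k_pos by real_asymp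
  hence "\<forall>\<^sub>F t in at_top. (q-1) * m / k * exp (- k * t) < 1/2" by (rule order_tendstoD) simp
  then obtain T0 where T0: "\<And>t. t \<ge> T0 \<Longrightarrow> (q-1) * m / k * exp (- k * t) < 1/2" unfolding eventually_at_top_linorder by blast
  \<comment> \<open>For t >= T0 the quantity \<eta>^(1-q), with limit 1, is shown to be at least
    1/2; as 1-q < 0 this means \<eta> <= E.\<close>
  define E where "E = (1/2::real) powr (1 / (1-q))"
  have E1: "E \<ge> 1"
  proof -
    have "(1::real) powr (1 / (1-q)) \<le> (1/2) powr (1 / (1-q))" using q_bounds by (intro powr_mono2') auto
    thus ?thesis by (simp add: E_def)
  qed
  \<comment> \<open>E and E/(a+K) bound \<eta> and \<xi> after \<open>T0\<close>, and e^(K T0) R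
    bounds both before it. The 1 is the margin by which the truncation level is missed. None of
    these depends on the truncated solution.\<close>
  define A where "A = E + E / (a+K) + exp (K * T0) * R + 1"
  have A: "A > 0" "A > 1" "A > 1 / (a+K)" "E / (a+K) \<le> A - 1" "E \<le> A - 1" "exp (K * T0) * R \<le> A - 1"
  proof -
    have "E / (a+K) > 0" "1 / (a+K) \<le> E / (a+K)" "exp (K * T0) * R > 0" using E1 aK R by (auto simp: divide_right_mono)
    thus "A > 0" "A > 1" "A > 1 / (a+K)" "E / (a+K) \<le> A - 1" "E \<le> A - 1" "exp (K * T0) * R \<le> A - 1"
      using E1 unfolding A_def by linarith+
  qed
  obtain \<xi> \<eta> where d\<xi>: "\<And>t. (\<xi> has_real_derivative (a+K) * \<xi> t - \<eta> t) (at t)"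
    and d\<eta>: "\<And>t. (\<eta> has_real_derivative exp (- ((p-1) * K) * t) * clip A (\<xi> t) powr p - m * (exp (- k * t) * clip A (\<eta> t) powr q)) (at t)"
    and \<xi>l: "(\<xi> \<longlongrightarrow> 1 / (a+K)) at_top" and \<eta>l: "(\<eta> \<longlongrightarrow> 1) at_top"
    using truncated_trajectory[OF A(1)] by blast
  define x where "x = (\<lambda>t. exp (- K * t) * \<xi> t)"
  define y where "y = (\<lambda>t. exp (- K * t) * \<eta> t)"
  define good where "good = (\<lambda>t. 0 < \<xi> t \<and> \<xi> t < A \<and> 0 < \<eta> t \<and> \<eta> t < A)"
  have dx: "(x has_real_derivative a * x t - y t) (at t)" for t
    unfolding x_def y_def by (rule derivative_eq_intros refl d\<xi>)+ (simp add: algebra_simps)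
  have good_pos: "x t > 0 \<and> y t > 0" if "good t" for t using that by (simp add: good_def x_def y_def)
  have dy: "(y has_real_derivative x t powr p - K * y t - m * \<bar>y t\<bar> powr q) (at t)" if g: "good t" for t
  proof -
    have c: "clip A (\<xi> t) = \<xi> t" "clip A (\<eta> t) = \<eta> t" using g by (auto simp: good_def clip_def)
    have "exp (- K * t) * exp (- ((p-1) * K) * t) = exp (- K * t * p)" "exp (- K * t) * exp (- k * t) = exp (- K * t * q)"
      by (simp_all add: exp_add[symmetric] k_def algebra_simps)
    hence xp: "exp (- K * t) * (exp (- ((p-1) * K) * t) * \<xi> t powr p) = x t powr p"
      and yq: "exp (- K * t) * (exp (- k * t) * \<eta> t powr q) = \<bar>y t\<bar> powr q"
      using g by (simp_all add: x_def y_def good_def powr_mult exp_powr_real abs_mult mult.assoc[symmetric])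
    have "(y has_real_derivative (exp (- K * t) * (- K)) * \<eta> t + 
        (exp (- ((p-1) * K) * t) * \<xi> t powr p - m * (exp (- k * t) * \<eta> t powr q)) * exp (- K * t)) (at t)"
      unfolding y_def by (intro DERIV_mult d\<eta>[of t, unfolded c]) (auto intro!: derivative_eq_intros)
    moreover have "(exp (- K * t) * (- K)) * \<eta> t + 
        (exp (- ((p-1) * K) * t) * \<xi> t powr p - m * (exp (- k * t) * \<eta> t powr q)) * exp (- K * t)
      = exp (- K * t) * (exp (- ((p-1) * K) * t) * \<xi> t powr p) - K * y t - m * (exp (- K * t) * (exp (- k * t) * \<eta> t powr q))"
      unfolding y_def by (simp add: algebra_simps)
    ultimately show ?thesis unfolding xp yq by simp
  qed
  define \<Lambda> where "\<Lambda> = (\<lambda>t. L (x t) (y t))"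
  define \<Lambda>' where "\<Lambda>' = (\<lambda>t. - ((y t - a * x t) * (J (x t) (y t) - J (x t) (a * x t))))"
  have \<Lambda>0: "(\<Lambda> \<longlongrightarrow> 0) at_top"
  proof -
    have "((\<lambda>t. exp (- K * t)) \<longlongrightarrow> 0) at_top" using K0 by real_asymp
    from tendsto_mult[OF this \<xi>l] have "(x \<longlongrightarrow> 0) at_top" by (simp add: x_def)
    moreover have "\<forall>\<^sub>F t in at_top. 0 < x t \<and> 0 < y t \<and> y t \<le> (a+K+1) * x t"
    proof -
      have "((\<lambda>t. \<eta> t - (a+K+1) * \<xi> t) \<longlongrightarrow> 1 - (a+K+1) * (1/(a+K))) at_top" by (intro tendsto_intros \<xi>l \<eta>l)
      moreover have "1 - (a+K+1) * (1/(a+K)) < 0" using aK by (simp add: field_simps)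
      ultimately have "\<forall>\<^sub>F t in at_top. \<eta> t - (a+K+1) * \<xi> t < 0" by (rule order_tendstoD)
      moreover have "\<forall>\<^sub>F t in at_top. \<eta> t > 0" "\<forall>\<^sub>F t in at_top. \<xi> t > 0"
        using \<eta>l \<xi>l aK by (auto intro!: order_tendstoD(1))
      ultimately show ?thesis
      proof eventually_elim
        case (elim t)
        have "exp (- K * t) * \<eta> t \<le> exp (- K * t) * ((a+K+1) * \<xi> t)" using elim by (intro mult_left_mono) auto
        thus ?case using elim by (simp add: x_def y_def mult_ac)
      qed
    qed
    ultimately show ?thesis unfolding \<Lambda>_def by (rule L_tendsto_0)
  qed
  have above: "\<forall>\<^sub>F t in at_top. y t > a * x t"
  proof -
    have "((\<lambda>t. \<eta> t - a * \<xi> t) \<longlongrightarrow> 1 - a * (1/(a+K))) at_top" by (intro tendsto_intros \<xi>l \<eta>l)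
    moreover have "1 - a * (1/(a+K)) > 0" using K0 a0 by (simp add: field_simps)
    ultimately have "\<forall>\<^sub>F t in at_top. \<eta> t - a * \<xi> t > 0" by (rule order_tendstoD)
    thus ?thesis
    proof eventually_elim
      case (elim t)
      hence "exp (- K * t) * (a * \<xi> t) < exp (- K * t) * \<eta> t" by simp
      thus ?case by (simp add: x_def y_def mult_ac)
    qed
  qed
  then obtain T2 where T2: "\<And>t. t \<ge> T2 \<Longrightarrow> y t > a * x t" unfolding eventually_at_top_linorder by blast
  \<comment> \<open>Where the truncation is inactive L decreases to 0 at infinity, so it is
    positive. The uniform \<open>e\<close> near \<open>w\<close> is what keeps the orbit off the
    axes as t decreases to \<open>w\<close>.\<close>
  have key: "\<exists>s>w. \<exists>e>0. \<forall>t>w. \<Lambda> t > 0 \<and> (t \<le> s \<longrightarrow> \<Lambda> t \<ge> e)" if g: "\<And>t. t > w \<Longrightarrow> good t" for w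
  proof -
    have d\<Lambda>: "(\<Lambda> has_real_derivative \<Lambda>' t) (at t)" if "t > w" for t
      unfolding \<Lambda>_def \<Lambda>'_def using L_deriv[OF dx dy[OF g[OF that]] refl] good_pos[OF g[OF that]] by blast
    have "\<Lambda>' t \<le> 0" if "t > w" for t
      using diss_nonneg good_pos[OF g[OF that]] by (simp add: \<Lambda>'_def)
    hence anti: "\<Lambda> t \<le> \<Lambda> s" if "w < s" "s \<le> t" for s t
      using d\<Lambda> that(1) by (intro DERIV_nonpos_imp_nonincreasing[OF that(2)]) (meson less_le_trans)
    have ge0: "\<Lambda> t \<ge> 0" if "t > w" for t
      by (rule tendsto_upperbound[OF \<Lambda>0]) (use anti[OF that] in \<open>auto intro!: eventually_at_top_linorderI[of t]\<close>)
    have strict: "\<Lambda> t > 0" if t: "t > w" "t \<ge> T2" for t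
    proof -
      have "\<Lambda> (t+1) < \<Lambda> t"
      proof (rule DERIV_neg_imp_decreasing[of t "t+1" \<Lambda>])
        fix u assume u: "t \<le> u" "u \<le> t + 1"
        hence uw: "u > w" using t by simp
        have "\<Lambda>' u < 0" using diss_pos[of "x u" "y u"] T2[of u] u t good_pos[OF g[OF uw]] by (simp add: \<Lambda>'_def)
        thus "\<exists>d. (\<Lambda> has_real_derivative d) (at u) \<and> d < 0" using d\<Lambda>[OF uw] by blast
      qed simp
      thus ?thesis using ge0[of "t+1"] t by simp
    qed
    define s where "s = max (w+1) T2"
    have s: "s > w" "\<Lambda> s > 0" using strict[of s] by (auto simp: s_def)
    have "\<Lambda> t > 0" if "t > w" for t
      using strict[of "max t T2"] anti[OF that, of "max t T2"] that by (simp add: less_max_iff_disj)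
    thus ?thesis using s anti by blast
  qed
  have upper: "\<xi> t \<le> A - 1 \<and> \<eta> t \<le> A - 1" if g: "\<And>t. t > w \<Longrightarrow> good t" and t: "t > w" for w t
  proof (cases "t \<ge> T0")
    case False
    have "\<Lambda> t > 0" using key[OF g] t by blast
    hence xyR: "x t \<le> R" "y t \<le> R" using R(2)[of "x t" "y t"] good_pos[OF g[OF t]] by (auto simp: \<Lambda>_def)
    have "exp (K * t) * x t \<le> exp (K * T0) * R" "exp (K * t) * y t \<le> exp (K * T0) * R"
      using xyR False K0 R(1) good_pos[OF g[OF t]] by (intro mult_mono; simp)+
    moreover have "exp (K * t) * x t = \<xi> t" "exp (K * t) * y t = \<eta> t"
      by (simp_all add: x_def y_def exp_minus)
    ultimately show ?thesis using A(6) by simp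
  next
    case True
    have \<eta>E: "\<eta> u \<le> E" if u: "u \<ge> t" for u
    proof -
      \<comment> \<open>Discarding the term in \<xi>^p leaves \<eta>' >= -m e^(-k t) \<eta>^q, a
        separable inequality; f is its integrated form, nondecreasing with limit -1.\<close>
      define f where "f = (\<lambda>t. - (\<eta> t powr (1-q)) - (q-1) * m / k * exp (- k * t))"
      define D where "D = (\<lambda>t. exp (- ((p-1) * K) * t) * clip A (\<xi> t) powr p - m * (exp (- k * t) * clip A (\<eta> t) powr q))"
      have "f u \<le> -1"
      proof (rule deriv_nonneg_le_limit[OF _ _ _ order_refl, where f = f and f' = "\<lambda>t. - ((1-q) * \<eta> t powr (1-q-1) * D t) - (q-1) * m / k * (exp (- k * t) * (- k))"])
        fix s assume s: "u \<le> s"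
        hence gs: "good s" using u t g by simp
        hence \<eta>s: "\<eta> s > 0" by (simp add: good_def)
        have "((\<lambda>t. \<eta> t powr (1-q)) has_real_derivative (1-q) * \<eta> s powr (1-q-1) * D s) (at s)"
          unfolding D_def by (rule DERIV_chain2[OF has_real_derivative_powr[OF \<eta>s] d\<eta>])
        moreover have "((\<lambda>t. exp (- k * t)) has_real_derivative exp (- k * s) * (- k)) (at s)"
          by (auto intro!: derivative_eq_intros)
        ultimately show "(f has_real_derivative - ((1-q) * \<eta> s powr (1-q-1) * D s) - (q-1) * m / k * (exp (- k * s) * (- k))) (at s)"
          unfolding f_def by (intro DERIV_diff DERIV_minus DERIV_cmult)
        have c: "clip A (\<eta> s) = \<eta> s" using gs by (auto simp: good_def clip_def)
        have "\<eta> s powr (1-q-1) * \<eta> s powr q = 1" using \<eta>s by (simp add: powr_add[symmetric])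
        moreover have "D s \<ge> - (m * exp (- k * s)) * \<eta> s powr q" unfolding D_def c by simp
        hence "\<eta> s powr (1-q-1) * D s \<ge> \<eta> s powr (1-q-1) * (- (m * exp (- k * s)) * \<eta> s powr q)"
          by (intro mult_left_mono) auto
        ultimately have "\<eta> s powr (1-q-1) * D s \<ge> - (m * exp (- k * s))"
          by (metis (no_types, lifting) mult.commute mult.left_commute mult_1)
        hence "(q-1) * (\<eta> s powr (1-q-1) * D s) \<ge> (q-1) * (- (m * exp (- k * s)))"
          using q_bounds by (intro mult_left_mono) auto
        moreover have "(q-1) * m / k * (exp (- k * s) * (- k)) = (q-1) * (- (m * exp (- k * s)))" using k_pos by simp
        moreover have "- ((1-q) * \<eta> s powr (1-q-1) * D s) = (q-1) * (\<eta> s powr (1-q-1) * D s)" by (simp add: algebra_simps)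
        ultimately show "0 \<le> - ((1-q) * \<eta> s powr (1-q-1) * D s) - (q-1) * m / k * (exp (- k * s) * (- k))" by linarith
      next
        have "((\<lambda>t. (q-1) * m / k * exp (- k * t)) \<longlongrightarrow> 0) at_top" using k_pos by real_asymp
        hence "(f \<longlongrightarrow> - (1 powr (1-q)) - 0) at_top" unfolding f_def by (intro tendsto_intros \<eta>l) auto
        thus "(f \<longlongrightarrow> -1) at_top" by simp
      qed
      hence "1/2 \<le> \<eta> u powr (1-q)" using T0[of u] u True by (simp add: f_def)
      hence "(\<eta> u powr (1-q)) powr (1/(1-q)) \<le> (1/2) powr (1/(1-q))" using q_bounds by (intro powr_mono2') auto
      moreover have "(\<eta> u powr (1-q)) powr (1/(1-q)) = \<eta> u" using g[of u] u t q_bounds by (simp add: powr_powr good_def)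
      ultimately show ?thesis by (simp add: E_def)
    qed
    \<comment> \<open>With \<eta> <= E the equation for \<xi> is compared from infinity with its
      rest state E/(a+K).\<close>
    define f where "f = (\<lambda>t. exp (- (a+K) * t) * (\<xi> t - E / (a+K)))"
    have "f t \<le> 0"
    proof (rule deriv_nonneg_le_limit[OF _ _ _ order_refl, where f = f and f' = "\<lambda>t. exp (- (a+K) * t) * (E - \<eta> t)"])
      fix s assume s: "t \<le> s"
      show "(f has_real_derivative exp (- (a+K) * s) * (E - \<eta> s)) (at s)"
        unfolding f_def by (rule derivative_eq_intros refl d\<xi>)+ (use aK in \<open>simp add: field_simps\<close>)
      show "0 \<le> exp (- (a+K) * s) * (E - \<eta> s)" using \<eta>E[OF s] by simp
    next
      have "((\<lambda>t. exp (- (a+K) * t)) \<longlongrightarrow> 0) at_top" using aK by real_asymp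
      hence "(f \<longlongrightarrow> 0 * (1/(a+K) - E / (a+K))) at_top" unfolding f_def by (intro tendsto_intros \<xi>l)
      thus "(f \<longlongrightarrow> 0) at_top" by simp
    qed
    hence "\<xi> t \<le> E / (a+K)" by (simp add: f_def mult_le_0_iff)
    thus ?thesis using \<eta>E[of t] A by simp
  qed
  have all_good: "good t" for t
  proof (rule ccontr)
    assume bad: "\<not> good t"
    have "\<forall>\<^sub>F t in at_top. good t" unfolding good_def using A aK
      by (intro eventually_conj order_tendstoD[OF \<xi>l] order_tendstoD[OF \<eta>l]) auto
    then obtain Tg where Tg: "\<And>t. t \<ge> Tg \<Longrightarrow> good t" unfolding eventually_at_top_linorder by blast
    \<comment> \<open>Positive exactly where the truncation is inactive, with time reversed: the
      first zero of \<open>h\<close> is the last time \<open>w\<close> at which a bound is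
      attained.\<close>
    define h where "h = (\<lambda>s. min (min (\<xi> (-s)) (A - \<xi> (-s))) (min (\<eta> (-s)) (A - \<eta> (-s))))"
    have hgood: "h s > 0 \<longleftrightarrow> good (-s)" for s by (auto simp: h_def good_def)
    have "continuous_on UNIV \<xi>" "continuous_on UNIV \<eta>"
      by (rule DERIV_continuous_on[OF has_field_derivative_at_within], rule d\<xi> d\<eta>)+
    moreover have "continuous_on {-Tg..-t} (\<lambda>s. f (-s))" if "continuous_on UNIV f" for f :: "real \<Rightarrow> real"
      using that by (rule continuous_on_compose2) (auto intro!: continuous_intros)
    ultimately have "continuous_on {-Tg..-t} (\<lambda>s. \<xi> (-s))" "continuous_on {-Tg..-t} (\<lambda>s. \<eta> (-s))" by blast+
    hence "continuous_on {-Tg..-t} h" unfolding h_def by (intro continuous_intros)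
    moreover have "h (-Tg) > 0" using hgood[of "-Tg"] Tg by simp
    moreover have "h (-t) \<le> 0" using hgood[of "-t"] bad by simp
    moreover have "-Tg \<le> -t" using Tg[of t] bad by fastforce
    ultimately obtain z where z: "-Tg < z" "z \<le> -t" "h z = 0" "\<And>u. -Tg \<le> u \<Longrightarrow> u < z \<Longrightarrow> h u > 0"
      by (rule first_zero) blast
    define w where "w = - z"
    have gw: "good t" if "t > w" for t
      using z(4)[of "-t"] hgood[of "-t"] Tg[of t] that by (cases "t \<ge> Tg") (auto simp: w_def)
    from key[OF gw] obtain s e where s: "s > w" and e: "e > 0" and le: "\<And>t. w < t \<Longrightarrow> t \<le> s \<Longrightarrow> \<Lambda> t \<ge> e" by blast
    from L_ge_lower[OF e] obtain \<delta> where \<delta>: "\<delta> > 0" "\<And>x y. x > 0 \<Longrightarrow> y > 0 \<Longrightarrow> L x y \<ge> e \<Longrightarrow> \<delta> \<le> x \<and> \<delta> \<le> y" by blast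
    have lim: "(f \<longlongrightarrow> f w) (at_right w)" if "\<And>t. (f has_real_derivative f' t) (at t)" for f f' :: "real \<Rightarrow> real"
      using DERIV_isCont[OF that[of w]] by (simp add: isCont_def filterlim_at_split)
    have lims: "(x \<longlongrightarrow> x w) (at_right w)" "(\<xi> \<longlongrightarrow> \<xi> w) (at_right w)" "(\<eta> \<longlongrightarrow> \<eta> w) (at_right w)"
      by (rule lim, rule dx d\<xi> d\<eta>)+
    hence limy: "(y \<longlongrightarrow> y w) (at_right w)" unfolding y_def by (intro tendsto_intros)
    have ev: "\<forall>\<^sub>F t in at_right w. w < t \<and> t < s" using eventually_at_right_real[OF s] by simp
    \<comment> \<open>The margins \<open>\<delta>\<close> and 1 survive the limit t -> w, so no
      bound can be attained at \<open>w\<close>.\<close>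
    have evb: "\<forall>\<^sub>F t in at_right w. \<delta> \<le> x t \<and> \<delta> \<le> y t \<and> \<xi> t \<le> A - 1 \<and> \<eta> t \<le> A - 1"
      using ev
    proof eventually_elim
      case (elim t)
      thus ?case using upper[of w t, OF gw] \<delta>(2)[of "x t" "y t"] good_pos[OF gw[of t]] le[of t] by (simp add: \<Lambda>_def)
    qed
    have "x w \<ge> \<delta>" by (rule tendsto_lowerbound[OF lims(1)]) (use evb in \<open>auto elim: eventually_mono\<close>)
    moreover have "y w \<ge> \<delta>" by (rule tendsto_lowerbound[OF limy]) (use evb in \<open>auto elim: eventually_mono\<close>)
    ultimately have "x w > 0" "y w > 0" using \<delta>(1) by auto
    hence "\<xi> w > 0" "\<eta> w > 0" unfolding x_def y_def by (auto simp: zero_less_mult_iff)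
    moreover have "\<xi> w \<le> A - 1" by (rule tendsto_upperbound[OF lims(2)]) (use evb in \<open>auto elim: eventually_mono\<close>)
    moreover have "\<eta> w \<le> A - 1" by (rule tendsto_upperbound[OF lims(3)]) (use evb in \<open>auto elim: eventually_mono\<close>)
    ultimately have "h z > 0" by (auto simp: h_def w_def)
    thus False using z(3) by simp
  qed
  have "traj x y" unfolding traj_def using dx dy all_good by blast
  moreover have "((\<lambda>t. exp (K*t) * x t) \<longlongrightarrow> 1 / (a+K)) at_top"
  proof -
    have "(\<lambda>t. exp (K*t) * x t) = \<xi>" by (simp add: fun_eq_iff x_def exp_minus)
    thus ?thesis using \<xi>l by simp
  qed
  moreover have "\<Lambda> 1 > 0" using key[of 0] all_good by auto
  ultimately show ?thesis using good_pos all_good unfolding \<Lambda>_def by blast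
qed

end

section \<open>Radial solutions\<close>

text \<open>The identity N - 2 = a + K translates the decay x ~ c e^(-K t) into u ~ c
  r^(2-N).\<close>

locale emden_radial = emden +
  fixes N :: nat
  assumes a_eq: "a = 2/(p-1)" and N_eq: "real N - 2 = a + K"
begin

text \<open>Here and in \<open>a_q\<close> the common value a + 2 expresses that u^p and |u'|^q
  scale like u'', which is what makes the system autonomous.\<close>

lemma a_p: "a * p = a + 2" using p1 unfolding a_eq by (simp add: field_simps)

lemma a_q: "(a+1) * q = a + 2" using p1 unfolding a_eq q_eq by (simp add: divide_simps)

lemma E_eq_iff:
  "u0 \<ge> 0 \<Longrightarrow> E_eq N p (-m) r u0 u1 u2 \<longleftrightarrow> u2 = - ((a+K+1) / r * u1) - u0 powr p + m * \<bar>u1\<bar> powr q"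
proof -
  assume u0: "u0 \<ge> 0"
  have "\<bar>u0\<bar> powr (p-1) * u0 = u0 powr p" using u0 by (cases "u0 = 0") (simp_all add: powr_diff)
  moreover have "real N - 1 = a + K + 1" using N_eq by simp
  ultimately show ?thesis unfolding E_eq_def q_eq[symmetric] by (simp only:) linarith
qed

definition xof :: "(real \<Rightarrow> real) \<Rightarrow> real \<Rightarrow> real" where "xof u t = exp (a * t) * u (exp t)"
definition yof :: "(real \<Rightarrow> real) \<Rightarrow> real \<Rightarrow> real" where "yof u1 t = - (exp ((a+1) * t) * u1 (exp t))"
definition uof :: "(real \<Rightarrow> real) \<Rightarrow> real \<Rightarrow> real" where "uof x r = r powr (-a) * x (ln r)"

lemma traj_of_solution:
  assumes "\<And>r. r > 0 \<Longrightarrow> (u has_real_derivative u1 r) (at r)"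
    and "\<And>r. r > 0 \<Longrightarrow> (u1 has_real_derivative u2 r) (at r)"
    and "\<And>r. r > 0 \<Longrightarrow> E_eq N p (-m) r (u r) (u1 r) (u2 r)"
    and "\<And>r. r > 0 \<Longrightarrow> u r \<ge> 0"
  shows "traj (xof u) (yof u1)"
  unfolding traj_def
proof (intro allI conjI)
  fix t :: real
  have chain: "((\<lambda>t. f (exp t)) has_real_derivative f' * exp t) (at t)" if "(f has_real_derivative f') (at (exp t))" for f f'
    by (rule DERIV_chain2[OF that DERIV_exp])
  have e: "exp ((a+1)*t) = exp (a*t) * exp t" "exp ((a+2)*t) = exp ((a+1)*t) * exp t"
    by (simp_all add: exp_add[symmetric] algebra_simps)
  have "(xof u has_real_derivative (exp (a*t) * a) * u (exp t) + u1 (exp t) * exp t * exp (a*t)) (at t)"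
    unfolding xof_def by (intro DERIV_mult chain assms) (auto intro!: derivative_eq_intros)
  moreover have "(exp (a*t) * a) * u (exp t) + u1 (exp t) * exp t * exp (a*t) = a * xof u t - yof u1 t"
    unfolding xof_def yof_def e by simp
  ultimately show "(xof u has_real_derivative a * xof u t - yof u1 t) (at t)" by simp
  have "(yof u1 has_real_derivative - ((exp ((a+1)*t) * (a+1)) * u1 (exp t) + u2 (exp t) * exp t * exp ((a+1)*t))) (at t)"
    unfolding yof_def by (intro DERIV_minus DERIV_mult chain assms) (auto intro!: derivative_eq_intros)
  moreover have "- ((exp ((a+1)*t) * (a+1)) * u1 (exp t) + u2 (exp t) * exp t * exp ((a+1)*t))
     = xof u t powr p - K * yof u1 t - m * \<bar>yof u1 t\<bar> powr q"
  proof -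
    define W R P Q where "W = exp ((a+1)*t)" and "R = exp t" and "P = u (exp t) powr p" and "Q = \<bar>u1 (exp t)\<bar> powr q"
    have "xof u t powr p = exp ((a*p) * t) * P"
      unfolding xof_def P_def by (simp add: powr_mult exp_powr_real mult_ac)
    hence xp: "xof u t powr p = W * R * P" unfolding a_p e(2) W_def R_def .
    have "\<bar>yof u1 t\<bar> powr q = exp (((a+1)*q) * t) * Q"
      unfolding yof_def Q_def by (simp add: abs_mult powr_mult exp_powr_real mult_ac)
    hence yq: "\<bar>yof u1 t\<bar> powr q = W * R * Q" unfolding a_q e(2) W_def R_def .
    have "u2 (exp t) = - ((a+K+1) / R * u1 (exp t)) - P + m * Q"
      using assms(3,4)[of "exp t"] E_eq_iff by (simp add: P_def Q_def R_def)
    hence h: "u2 (exp t) * R = - (a+K+1) * u1 (exp t) - (P - m * Q) * R"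
      using exp_gt_zero[of t] unfolding R_def[symmetric] by (simp add: field_simps)
    have "u2 (exp t) * R * W = (- (a+K+1) * u1 (exp t) - (P - m * Q) * R) * W" by (simp only: h)
    thus ?thesis unfolding xp yq unfolding yof_def W_def[symmetric] R_def[symmetric] by (simp add: algebra_simps)
  qed
  ultimately show "(yof u1 has_real_derivative xof u t powr p - K * yof u1 t - m * \<bar>yof u1 t\<bar> powr q) (at t)" by simp
qed

lemma solution_of_traj:
  assumes T: "traj x y" and pos: "\<And>t. x t > 0"
  shows "solves_E N p (-m) (uof x)"
proof -
  define u1 where "u1 = (\<lambda>r. - (r powr (-a-1) * y (ln r)))"
  define u2 where "u2 = (\<lambda>r. - ((-a-1) * r powr (-a-1-1) * y (ln r) + 
     (x (ln r) powr p - K * y (ln r) - m * \<bar>y (ln r)\<bar> powr q) * (1/r) * r powr (-a-1)))"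
  show ?thesis unfolding solves_E_def
  proof (intro exI allI impI conjI)
    fix r :: real assume r: "r > 0"
    have dl: "(ln has_real_derivative 1/r) (at r)" using r by (simp add: DERIV_ln_divide)
    have "(uof x has_real_derivative (-a) * r powr (-a-1) * x (ln r) + (a * x (ln r) - y (ln r)) * (1/r) * r powr (-a)) (at r)"
      unfolding uof_def by (intro DERIV_mult has_real_derivative_powr r DERIV_chain2[OF trajD(1)[OF T] dl])
    moreover have "(-a) * r powr (-a-1) * x (ln r) + (a * x (ln r) - y (ln r)) * (1/r) * r powr (-a) = u1 r"
      using r by (simp add: u1_def powr_diff field_simps)
    ultimately show "(uof x has_real_derivative u1 r) (at r)" by simp
    show "(u1 has_real_derivative u2 r) (at r)"
      unfolding u1_def u2_def by (intro DERIV_minus DERIV_mult has_real_derivative_powr r DERIV_chain2[OF trajD(2)[OF T] dl])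
    have u0: "uof x r > 0" using pos r by (simp add: uof_def)
    have e1: "uof x r powr p = r powr (-a-2) * x (ln r) powr p"
    proof -
      have "- a * p = -a-2" using a_p by simp
      thus ?thesis unfolding uof_def using r by (simp add: powr_mult powr_powr)
    qed
    have e2: "\<bar>u1 r\<bar> powr q = r powr (-a-2) * \<bar>y (ln r)\<bar> powr q"
    proof -
      have "(- a - 1) * q = -a-2" using a_q by (simp add: algebra_simps)
      thus ?thesis unfolding u1_def using r by (simp add: abs_mult powr_mult powr_powr)
    qed
    have e3: "r powr (-a-1-1) = r powr (-a-2)" "r powr (-a-1) = r powr (-a-2) * r"
    proof -
      have "-a-1 = -a-2+1" "-a-1-1 = -a-2" by simp_all
      moreover have "r powr (-a-2+1) = r powr (-a-2) * r" by (subst powr_add) (use r in simp)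
      ultimately show "r powr (-a-1-1) = r powr (-a-2)" "r powr (-a-1) = r powr (-a-2) * r" by (simp_all only:)
    qed
    show "E_eq N p (-m) r (uof x r) (u1 r) (u2 r)"
      unfolding E_eq_iff[OF less_imp_le[OF u0]] e1 e2 u2_def unfolding u1_def e3 using r
      by (simp add: field_simps)
  qed
qed

section \<open>Ground states in the phase plane\<close>

lemma ground_state_pos_at_0:
  assumes d: "\<And>r. r \<ge> 0 \<Longrightarrow> (u has_real_derivative u1 r) (at r within {0..})"
     "\<And>r. r \<ge> 0 \<Longrightarrow> (u1 has_real_derivative u2 r) (at r within {0..})"
    and eq: "\<And>r. r > 0 \<Longrightarrow> E_eq N p (-m) r (u r) (u1 r) (u2 r)"
    and nn: "\<And>r. r \<ge> 0 \<Longrightarrow> u r \<ge> 0" and u10: "u1 0 = 0" and ne: "r0 \<ge> 0" "u r0 \<noteq> 0"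
  shows "u 0 > 0"
proof (rule ccontr)
  assume "\<not> u 0 > 0"
  hence u0: "u 0 = 0" using nn[of 0] by simp
  have cont: "continuous_on {0..} u" "continuous_on {0..} u1"
    by (rule DERIV_continuous_on, rule d, simp)+
  hence cont': "continuous_on {0..r0} u" "continuous_on {0..r0} u1" by (auto intro: continuous_on_subset)
  define G where "G = (\<lambda>r. \<bar>u r\<bar> + \<bar>u1 r\<bar>)"
  have "compact (G ` {0..r0})" unfolding G_def by (intro compact_continuous_image continuous_intros cont' compact_Icc)
  then obtain B where B: "\<And>r. r \<in> {0..r0} \<Longrightarrow> \<bar>G r\<bar> \<le> B"
    using compact_imp_bounded[OF \<open>compact (G ` {0..r0})\<close>] unfolding bounded_iff by fastforce
  define P Q where "P = B powr (p-1)" and "Q = B powr (q-1)"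
  define c where "c = 1 + P + 2 * m * Q"
  \<comment> \<open>If u(0) = 0, all data vanish at 0. The singular term contributes -2 (N-1)/r u'^2
    <= 0 to D', so a Gronwall estimate with interior derivatives starts at r = 0 and gives u =
    0.\<close>
  define D where "D = (\<lambda>r. (u r)^2 + (u1 r)^2)"
  have "D r0 \<le> exp (c * (r0 - 0)) * D 0"
  proof (rule gronwall_le[OF ne(1)])
    show "continuous_on {0..r0} D" unfolding D_def by (intro continuous_intros cont')
    fix r assume r: "0 < r" "r < r0"
    have "at r within {0..} = at r" using r by (intro at_within_interior) auto
    hence dr: "(u has_real_derivative u1 r) (at r)" "(u1 has_real_derivative u2 r) (at r)"
      using d[of r] r by auto
    have "(D has_real_derivative 2 * u r * u1 r + 2 * u1 r * u2 r) (at r)"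
      unfolding D_def by (rule derivative_eq_intros refl dr)+ (simp add: algebra_simps)
    moreover have "2 * u r * u1 r + 2 * u1 r * u2 r \<le> c * D r"
    proof -
      have bd: "\<bar>u r\<bar> \<le> B" "\<bar>u1 r\<bar> \<le> B" using B[of r] r by (auto simp: G_def)
      define d where "d = (a+K+1) / r"
      have d0: "d \<ge> 0" using a0 K0 r by (simp add: d_def)
      have u2: "u2 r = - (d * u1 r) - u r powr p + m * \<bar>u1 r\<bar> powr q"
        using eq[OF r(1)] E_eq_iff nn[of r] r by (simp add: d_def)
      have pw: "z powr s \<le> B powr (s-1) * z" if "0 \<le> z" "z \<le> B" "s > 1" for z s :: real
      proof (cases "z = 0")
        case False
        hence "z powr s = z powr (s-1) * z" using that by (simp add: powr_diff)
        also have "\<dots> \<le> B powr (s-1) * z" using that by (intro mult_right_mono powr_mono2) auto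
        finally show ?thesis .
      qed simp
      have up: "u r powr p \<le> P * \<bar>u r\<bar>" using pw[of "u r" p] nn[of r] r bd p1 by (simp add: P_def)
      have u1p: "\<bar>u1 r\<bar> powr q \<le> Q * \<bar>u1 r\<bar>" using pw[of "\<bar>u1 r\<bar>" q] bd q_bounds by (simp add: Q_def)
      have uv: "2 * (\<bar>u r\<bar> * \<bar>u1 r\<bar>) \<le> D r"
        using sum_squares_bound[of "\<bar>u r\<bar>" "\<bar>u1 r\<bar>"] by (simp add: D_def mult.assoc)
      have "2 * u1 r * u2 r = - (2 * d * (u1 r)^2) - 2 * (u1 r * u r powr p) + 2 * m * (u1 r * \<bar>u1 r\<bar> powr q)"
        unfolding u2 by (simp add: algebra_simps power2_eq_square)
      moreover have "2 * d * (u1 r)^2 \<ge> 0" using d0 by simp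
      moreover have "- (u1 r * u r powr p) \<le> P * (\<bar>u r\<bar> * \<bar>u1 r\<bar>)"
      proof -
        have "- (u1 r * u r powr p) \<le> \<bar>u1 r\<bar> * u r powr p" by (metis abs_ge_minus_self abs_mult abs_of_nonneg powr_ge_zero)
        also have "\<dots> \<le> \<bar>u1 r\<bar> * (P * \<bar>u r\<bar>)" using up by (intro mult_left_mono) auto
        finally show ?thesis by (simp add: mult_ac)
      qed
      moreover have "P * (2 * (\<bar>u r\<bar> * \<bar>u1 r\<bar>)) \<le> P * D r" using uv by (intro mult_left_mono) (auto simp: P_def)
      moreover have "u1 r * \<bar>u1 r\<bar> powr q \<le> Q * (u1 r)^2"
      proof -
        have "u1 r * \<bar>u1 r\<bar> powr q \<le> \<bar>u1 r\<bar> * \<bar>u1 r\<bar> powr q" by (intro mult_right_mono) auto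
        also have "\<dots> \<le> \<bar>u1 r\<bar> * (Q * \<bar>u1 r\<bar>)" using u1p by (intro mult_left_mono) auto
        finally show ?thesis by (simp add: mult_ac power2_eq_square)
      qed
      hence "2 * m * (u1 r * \<bar>u1 r\<bar> powr q) \<le> 2 * m * (Q * (u1 r)^2)" using m0 by (intro mult_left_mono) auto
      moreover have "2 * m * (Q * (u1 r)^2) \<le> 2 * m * (Q * D r)" using m0 by (intro mult_left_mono) (auto simp: D_def Q_def)
      moreover have "2 * u r * u1 r \<le> 2 * (\<bar>u r\<bar> * \<bar>u1 r\<bar>)" by (metis abs_ge_self abs_mult mult.assoc mult_left_mono zero_le_numeral)
      ultimately have "2 * u r * u1 r + 2 * u1 r * u2 r \<le> D r + P * D r + 2 * m * (Q * D r)" using uv by linarith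
      thus ?thesis by (simp add: c_def algebra_simps)
    qed
    ultimately show "\<exists>d. (D has_real_derivative d) (at r) \<and> d \<le> c * D r" by blast
  qed
  also have "D 0 = 0" using u0 u10 by (simp add: D_def)
  finally have "(u r0)^2 \<le> 0" by (smt (verit) D_def mult_zero_right zero_le_power2)
  thus False using ne by simp
qed

text \<open>Since u(0) > 0 and u'(0) = 0, the orbit leaves the origin with y < a x. What remains is
  to show that it stays in the open quadrant, first near r = 0 and then for all times.\<close>

theorem no_ground_state: "\<not> ground_state N p (-m) u"
proof
  assume "ground_state N p (-m) u"
  then obtain u1 u2 r0 where nn: "\<And>r. r \<ge> 0 \<Longrightarrow> u r \<ge> 0" and ne: "r0 \<ge> 0" "u r0 \<noteq> 0"
    and d: "\<And>r. r \<ge> 0 \<Longrightarrow> (u has_real_derivative u1 r) (at r within {0..})"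
           "\<And>r. r \<ge> 0 \<Longrightarrow> (u1 has_real_derivative u2 r) (at r within {0..})"
    and u10: "u1 0 = 0" and eq: "\<And>r. r > 0 \<Longrightarrow> E_eq N p (-m) r (u r) (u1 r) (u2 r)"
    unfolding ground_state_def by blast
  have u0: "u 0 > 0" using ground_state_pos_at_0[OF d eq nn u10 ne] .
  have dpos: "(u has_real_derivative u1 r) (at r)" "(u1 has_real_derivative u2 r) (at r)" if "r > 0" for r
  proof -
    have "at r within {0..} = at r" using that by (intro at_within_interior) auto
    thus "(u has_real_derivative u1 r) (at r)" "(u1 has_real_derivative u2 r) (at r)" using d[of r] that by auto
  qed
  define x where "x = xof u"
  define y where "y = yof u1"
  have T: "traj x y" unfolding x_def y_def by (rule traj_of_solution[OF dpos eq]) (use nn in auto)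
  have xnn: "x t \<ge> 0" for t using nn by (simp add: x_def xof_def)
  have E: "filterlim exp (at_right (0::real)) at_bot" by real_asymp
  have lim0: "((\<lambda>t. f (exp t)) \<longlongrightarrow> f 0) at_bot" if "(f has_real_derivative f') (at 0 within {0..})" for f :: "real \<Rightarrow> real" and f'
  proof -
    have "(f \<longlongrightarrow> f 0) (at 0 within {0..})" using DERIV_continuous[OF that] by (simp add: continuous_within)
    hence "(f \<longlongrightarrow> f 0) (at_right 0)" by (rule tendsto_within_subset) auto
    from filterlim_compose[OF this E] show ?thesis .
  qed
  have ul: "((\<lambda>t. u (exp t)) \<longlongrightarrow> u 0) at_bot" by (rule lim0[OF d(1)]) simp
  have u1l: "((\<lambda>t. u1 (exp t)) \<longlongrightarrow> 0) at_bot" using lim0[OF d(2)] u10 by simp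
  have expl: "((\<lambda>t. exp (c * t)) \<longlongrightarrow> 0) at_bot" if "c > 0" for c :: real using that by real_asymp
  have xl: "(x \<longlongrightarrow> 0) at_bot" using tendsto_mult[OF expl[OF a0] ul] by (simp add: x_def xof_def[abs_def])
  have "((\<lambda>t. exp (1 * t) * u1 (exp t) + a * u (exp t)) \<longlongrightarrow> 0 * 0 + a * u 0) at_bot"
    by (intro tendsto_intros expl ul u1l) simp
  hence "\<forall>\<^sub>F t in at_bot. exp (1 * t) * u1 (exp t) + a * u (exp t) > 0" by (rule order_tendstoD) (use a0 u0 in simp)
  hence low: "\<forall>\<^sub>F t in at_bot. y t < a * x t"
  proof eventually_elim
    case (elim t)
    hence "exp (a*t) * (exp (1 * t) * u1 (exp t) + a * u (exp t)) > 0" by simp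
    moreover have "exp ((a+1)*t) = exp (a*t) * exp t" by (simp add: exp_add[symmetric] algebra_simps)
    ultimately show ?case by (simp add: x_def y_def xof_def yof_def algebra_simps)
  qed
  have "\<forall>\<^sub>F t in at_bot. u (exp t) powr p - m * \<bar>u1 (exp t)\<bar> powr q > 0"
  proof (rule order_tendstoD(1))
    show "((\<lambda>t. u (exp t) powr p - m * \<bar>u1 (exp t)\<bar> powr q) \<longlongrightarrow> u 0 powr p - m * \<bar>0\<bar> powr q) at_bot"
      using u0 q_bounds nn by (intro tendsto_diff tendsto_mult tendsto_const tendsto_powr' tendsto_rabs ul u1l disjI2 conjI)
        (auto intro!: always_eventually)
    show "0 < u 0 powr p - m * \<bar>0\<bar> powr q" using u0 by simp
  qed
  moreover have "\<forall>\<^sub>F t in at_bot. u (exp t) > 0" using ul u0 by (rule order_tendstoD)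
  ultimately have "\<forall>\<^sub>F t in at_bot. u (exp t) powr p - m * \<bar>u1 (exp t)\<bar> powr q > 0 \<and> u (exp t) > 0 \<and> y t < a * x t"
    using low by eventually_elim auto
  then obtain t0 where t0: "\<And>t. t \<le> t0 \<Longrightarrow> u (exp t) powr p - m * \<bar>u1 (exp t)\<bar> powr q > 0 \<and> u (exp t) > 0 \<and> y t < a * x t"
    unfolding eventually_at_bot_linorder by blast
  \<comment> \<open>This is -r^(N-1) u'(r) at r = e^t: it tends to 0 at r = 0 and increases as long
    as u^p outweighs m |u'|^q, which gives y > 0 early on.\<close>
  define \<eta> where "\<eta> = (\<lambda>t. exp (K*t) * y t)"
  have d\<eta>: "(\<eta> has_real_derivative exp (K*t) * (x t powr p - m * \<bar>y t\<bar> powr q)) (at t)" for t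
    unfolding \<eta>_def by (rule derivative_eq_intros refl trajD(2)[OF T])+ (simp add: algebra_simps)
  have \<eta>': "exp (K*t) * (x t powr p - m * \<bar>y t\<bar> powr q) > 0" if "t \<le> t0" for t
  proof -
    have "x t powr p = exp ((a*p) * t) * u (exp t) powr p"
      unfolding x_def xof_def by (simp add: powr_mult exp_powr_real mult_ac)
    moreover have "\<bar>y t\<bar> powr q = exp (((a+1)*q) * t) * \<bar>u1 (exp t)\<bar> powr q"
      unfolding y_def yof_def by (simp add: abs_mult powr_mult exp_powr_real mult_ac)
    ultimately have "x t powr p - m * \<bar>y t\<bar> powr q = exp ((a+2)*t) * (u (exp t) powr p - m * \<bar>u1 (exp t)\<bar> powr q)"
      unfolding a_p a_q by (simp add: algebra_simps)
    thus ?thesis using t0[OF that] by simp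
  qed
  have \<eta>l: "(\<eta> \<longlongrightarrow> 0) at_bot"
  proof -
    have "((\<lambda>t. - (exp ((K+a+1)*t) * u1 (exp t))) \<longlongrightarrow> - (0 * 0)) at_bot" using a0 K0
      by (intro tendsto_intros expl u1l) simp
    moreover have "- (exp ((K+a+1)*t) * u1 (exp t)) = \<eta> t" for t
    proof -
      have "exp ((K+a+1)*t) = exp (K*t) * exp ((a+1)*t)" by (simp add: exp_add[symmetric] algebra_simps)
      thus ?thesis by (simp add: \<eta>_def y_def yof_def)
    qed
    ultimately show ?thesis by simp
  qed
  have early: "x t > 0 \<and> y t > 0" if t: "t \<le> t0" for t
  proof -
    have inc: "\<eta> s < \<eta> v" if "s < v" "v \<le> t0" for s v
      using d\<eta> \<eta>' that by (intro DERIV_pos_imp_increasing[OF that(1)]) (meson order.trans)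
    have "0 \<le> \<eta> (t - 1)"
      by (rule tendsto_upperbound[OF \<eta>l])
         (use inc t in \<open>auto intro!: eventually_at_bot_linorderI[of "t-2"] less_imp_le\<close>)
    hence "\<eta> t > 0" using inc[of "t-1" t] t by simp
    thus ?thesis using t0[OF t] by (auto simp: \<eta>_def x_def xof_def zero_less_mult_iff)
  qed
  have pos: "x t > 0 \<and> y t > 0" for t
  proof (rule ccontr)
    assume bad: "\<not> (x t > 0 \<and> y t > 0)"
    hence tt: "t0 \<le> t" using early[of t] by linarith
    define h where "h = (\<lambda>t. min (x t) (y t))"
    have cont: "continuous_on {t0..t} x" "continuous_on {t0..t} y"
      by (rule DERIV_continuous_on[OF has_field_derivative_at_within], rule trajD[OF T])+
    have "continuous_on {t0..t} h" unfolding h_def by (intro continuous_intros cont)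
    moreover have "h t0 > 0" "h t \<le> 0" using early[of t0] bad by (auto simp: h_def)
    ultimately obtain z where z: "t0 < z" "h z = 0" "\<And>s. t0 \<le> s \<Longrightarrow> s < z \<Longrightarrow> h s > 0"
      using tt by (rule first_zero) blast
    have ynn: "y z \<ge> 0" and xy0: "x z = 0 \<or> y z = 0" using z(2) by (auto simp: h_def min_def split: if_splits)
    \<comment> \<open>The origin is excluded by uniqueness. On x = 0 with y > 0 the solution u would
      turn negative just after, and on y = 0 with x > 0 the derivative y' > 0 would make y negative
      just before.\<close>
    consider "x z = 0" "y z = 0" | "x z = 0" "y z > 0" | "x z > 0" "y z = 0" using xy0 ynn xnn[of z] by fastforce
    thus False
    proof cases
      case 1
      have "traj (\<lambda>t. 0) (\<lambda>t. 0)" by (simp add: traj_def)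
      from traj_unique[OF T this, of z t0] 1 xnn early[of t0] show False by simp
    next
      case 2
      have "a * x z - y z < 0" using 2 by simp
      from DERIV_neg_dec_right[OF trajD(1)[OF T] this] obtain e where "e > 0" "\<And>k. k > 0 \<Longrightarrow> k < e \<Longrightarrow> x (z + k) < x z" by blast
      hence "x (z + e/2) < 0" using 2 by (metis half_gt_zero field_sum_of_halves less_add_same_cancel1)
      thus False using xnn[of "z + e/2"] by simp
    next
      case 3
      have "x z powr p - K * y z - m * \<bar>y z\<bar> powr q > 0" using 3 by simp
      from DERIV_pos_inc_left[OF trajD(2)[OF T] this] obtain e where e: "e > 0" "\<And>k. k > 0 \<Longrightarrow> k < e \<Longrightarrow> y (z - k) < y z" by blast
      define k where "k = min (e/2) ((z - t0)/2)"
      have "y (z - k) < 0" using e z(1) 3 by (metis diff_gt_0_iff_gt half_gt_zero k_def less_imp_le field_sum_of_halves less_add_same_cancel1 min_less_iff_conj min_less_iff_disj)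
      moreover have "h (z - k) > 0" using e z(1) by (intro z(3)) (auto simp: k_def min_def field_simps)
      ultimately show False by (simp add: h_def)
    qed
  qed
  have "\<forall>\<^sub>F t in at_bot. 0 < x t \<and> 0 < y t \<and> y t \<le> a * x t"
    using low by eventually_elim (use pos in auto)
  hence "((\<lambda>t. L (x t) (y t)) \<longlongrightarrow> 0) at_bot" using xl by (intro L_tendsto_0) auto
  thus False using no_regular_trajectory[OF T pos] t0 by blast
qed

end

section \<open>The singular solution\<close>

context emden_radial
begin

lemma N_powr: "r > 0 \<Longrightarrow> r powr (2 - real N) = r powr (-a) * r powr (-K)"
proof -
  have "2 - real N = -a + -K" using N_eq by simp
  thus ?thesis by (simp only: powr_add)
qed

lemma singular_sol_uof:
  assumes T: "traj x y" and pos: "\<And>t. x t > 0" and c: "c > 0"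
    and lim: "((\<lambda>t. exp (K*t) * x t) \<longlongrightarrow> c) at_top" and limX: "(x \<longlongrightarrow> X) at_bot"
    and XM: "X_M N p (-m) = X"
  shows "singular_sol N p (-m) (uof x)"
  unfolding singular_sol_def
proof (intro conjI allI impI)
  show "uof x r > 0" if "r > 0" for r using that pos by (simp add: uof_def)
  show "solves_E N p (-m) (uof x)" by (rule solution_of_traj[OF T pos])
  show "uof x \<sim>[at_right 0] U_M N p (-m)"
  proof (rule asymp_equivI')
    have ea: "- 2 / (p-1) = - a" by (simp add: a_eq)
    have "filterlim ln at_bot (at_right (0::real))" by (rule ln_at_0)
    from filterlim_compose[OF limX this] have "((\<lambda>r. x (ln r) / X) \<longlongrightarrow> X / X) (at_right 0)"
      using X0 by (intro tendsto_intros) auto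
    moreover have "\<forall>\<^sub>F r in at_right 0. x (ln r) / X = uof x r / U_M N p (-m) r"
      using eventually_at_right_less[of "0::real"]
      by eventually_elim (simp only: U_M_def XM ea, simp add: uof_def)
    ultimately have "((\<lambda>r. uof x r / U_M N p (-m) r) \<longlongrightarrow> X / X) (at_right 0)" by (rule Lim_transform_eventually)
    thus "((\<lambda>r. uof x r / U_M N p (-m) r) \<longlongrightarrow> 1) (at_right 0)" using X0 by simp
  qed
  show "\<exists>c>0. uof x \<sim>[at_top] (\<lambda>r. c * r powr (2 - real N))"
  proof (intro exI[of _ c] conjI c asymp_equivI')
    have "filterlim ln at_top (at_top::real filter)" by (rule ln_at_top)
    from filterlim_compose[OF lim this] have "((\<lambda>r. exp (K * ln r) * x (ln r) / c) \<longlongrightarrow> c / c) at_top"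
      using c by (intro tendsto_intros) auto
    moreover have "\<forall>\<^sub>F r in at_top. exp (K * ln r) * x (ln r) / c = uof x r / (c * r powr (2 - real N))"
      using eventually_gt_at_top[of "0::real"]
    proof eventually_elim
      case (elim r)
      have "exp (K * ln r) = r powr K" using elim by (simp add: powr_def)
      thus ?case using elim by (simp add: uof_def N_powr powr_minus field_simps)
    qed
    ultimately have "((\<lambda>r. uof x r / (c * r powr (2 - real N))) \<longlongrightarrow> c / c) at_top" by (rule Lim_transform_eventually)
    thus "((\<lambda>r. uof x r / (c * r powr (2 - real N))) \<longlongrightarrow> 1) at_top" using c by simp
  qed
qed

lemma singular_sol_traj:
  assumes "singular_sol N p (-m) v"
  shows "\<exists>y c. traj (xof v) y \<and> (\<forall>t. xof v t > 0) \<and> c > 0 \<and> ((\<lambda>t. exp (K*t) * xof v t) \<longlongrightarrow> c) at_top"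
proof -
  from assms obtain c where vpos: "\<And>r. r > 0 \<Longrightarrow> v r > 0" and sol: "solves_E N p (-m) v"
    and c: "c > 0" "v \<sim>[at_top] (\<lambda>r. c * r powr (2 - real N))" unfolding singular_sol_def by blast
  from sol obtain u1 u2 where d: "\<And>r. r > 0 \<Longrightarrow> (v has_real_derivative u1 r) (at r)"
     "\<And>r. r > 0 \<Longrightarrow> (u1 has_real_derivative u2 r) (at r)" "\<And>r. r > 0 \<Longrightarrow> E_eq N p (-m) r (v r) (u1 r) (u2 r)"
    unfolding solves_E_def by blast
  have T: "traj (xof v) (yof u1)" by (rule traj_of_solution[OF d]) (use vpos in \<open>auto intro: less_imp_le\<close>)
  have pos: "xof v t > 0" for t using vpos by (simp add: xof_def)
  \<comment> \<open>Asymptotic equivalence counts the quotient 0/0 as 1; positivity of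
    \<open>v\<close> excludes that case below.\<close>
  have "((\<lambda>r. if v r = 0 \<and> c * r powr (2 - real N) = 0 then 1 else v r / (c * r powr (2 - real N))) \<longlongrightarrow> 1) at_top"
    using c(2) by (simp add: asymp_equiv_def)
  from filterlim_compose[OF this exp_at_top]
  have "((\<lambda>t. (if v (exp t) = 0 \<and> c * exp t powr (2 - real N) = 0 then 1 else v (exp t) / (c * exp t powr (2 - real N))) * c) \<longlongrightarrow> 1 * c) at_top"
    by (intro tendsto_mult tendsto_const)
  moreover have "(if v (exp t) = 0 \<and> c * exp t powr (2 - real N) = 0 then 1 else v (exp t) / (c * exp t powr (2 - real N))) * c
     = exp (K*t) * xof v t" for t
  proof -
    have "exp t powr (2 - real N) = exp (- (a*t)) * exp (- (K*t))"
      unfolding N_powr[OF exp_gt_zero] by (simp add: exp_powr_real mult.commute)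
    thus ?thesis using c(1) vpos[of "exp t"] by (simp add: xof_def exp_minus field_simps)
  qed
  ultimately have "((\<lambda>t. exp (K*t) * xof v t) \<longlongrightarrow> c) at_top" by simp
  thus ?thesis using T pos c(1) by blast
qed

text \<open>A similarity transformation is a translation in t = ln r. It multiplies the decay
  constant by a positive factor, which can be chosen to match the two constants before
  \<open>fast_decay_unique\<close> is applied.\<close>

theorem singular_sol_unique_up_to_scaling:
  assumes u: "singular_sol N p (-m) u" and v: "singular_sol N p (-m) v"
  shows "\<exists>\<kappa>>0. \<forall>r>0. v r = \<kappa> powr a * u (\<kappa> * r)"
proof -
  obtain yu cu where U: "traj (xof u) yu" "\<And>t. xof u t > 0" "cu > 0" "((\<lambda>t. exp (K*t) * xof u t) \<longlongrightarrow> cu) at_top"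
    using singular_sol_traj[OF u] by blast
  obtain yv cv where V: "traj (xof v) yv" "\<And>t. xof v t > 0" "cv > 0" "((\<lambda>t. exp (K*t) * xof v t) \<longlongrightarrow> cv) at_top"
    using singular_sol_traj[OF v] by blast
  \<comment> \<open>Shifting by \<open>l\<close> changes the limit of e^(K t) x from
    \<open>cu\<close> to e^(-K l) cu, which is to be \<open>cv\<close>.\<close>
  define l where "l = ln (cu / cv) / K"
  have sh: "((\<lambda>t. f (t + l)) has_real_derivative f') (at t)" if "(f has_real_derivative f') (at (t + l))" for f f' t
    using that by (simp add: DERIV_shift)
  have T: "traj (\<lambda>t. xof u (t + l)) (\<lambda>t. yu (t + l))"
    unfolding traj_def using trajD[OF U(1)] by (blast intro: sh)
  have "((\<lambda>t. exp (K*(t+l)) * xof u (t+l)) \<longlongrightarrow> cu) at_top"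
    using filterlim_compose[OF U(4) filterlim_tendsto_add_at_top[OF tendsto_const[of l] filterlim_ident]] by (simp add: add.commute)
  hence "((\<lambda>t. exp (-(K*l)) * (exp (K*(t+l)) * xof u (t+l))) \<longlongrightarrow> exp (-(K*l)) * cu) at_top"
    by (intro tendsto_intros)
  moreover have "exp (-(K*l)) * (exp (K*(t+l)) * xof u (t+l)) = exp (K*t) * xof u (t+l)" for t
    by (simp add: mult.assoc[symmetric] exp_add[symmetric] ring_distribs)
  moreover have "exp (-(K*l)) * cu = cv"
  proof -
    have "K * l = ln (cu / cv)" using K0 by (simp add: l_def)
    thus ?thesis using U(3) V(3) by (simp add: exp_minus)
  qed
  ultimately have lim: "((\<lambda>t. exp (K*t) * xof u (t+l)) \<longlongrightarrow> cv) at_top" by simp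
  have eq: "xof v t = xof u (t + l)" for t
    by (rule fast_decay_unique[OF V(1) T V(2) U(2) V(4) lim])
  have "v r = exp l powr a * u (exp l * r)" if r: "r > 0" for r
  proof -
    have e: "exp (ln r + l) = exp l * r" using r by (simp add: exp_add)
    have "exp (a * ln r) * v r = exp (a * (ln r + l)) * u (exp l * r)"
      using eq[of "ln r"] r unfolding xof_def e by simp
    also have "exp (a * (ln r + l)) = exp (a * ln r) * exp (a * l)" by (simp add: exp_add[symmetric] ring_distribs)
    finally have "exp (a * ln r) * v r = exp (a * ln r) * (exp (a * l) * u (exp l * r))" by (simp only: mult.assoc)
    thus ?thesis by (simp add: exp_powr_real mult.commute)
  qed
  thus ?thesis by (intro exI[of _ "exp l"]) auto
qed

theorem singular_sol_exists:
  assumes "X_M N p (-m) = X"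
  shows "\<exists>u. singular_sol N p (-m) u"
proof -
  obtain x y t0 where x: "traj x y" "\<And>t. x t > 0 \<and> y t > 0" "((\<lambda>t. exp (K*t) * x t) \<longlongrightarrow> 1/(a+K)) at_top" "L (x t0) (y t0) > 0"
    using fast_decay_exists by blast
  have "1/(a+K) > 0" using a0 K0 by simp
  from singular_sol_uof[OF x(1) _ this x(3) traj_converges_at_bot[OF x(1,2,4)] assms] x(2) show ?thesis by blast
qed

end

section \<open>The critical constant\<close>

text \<open>The bound ln z <= z - 1 at u/w and v/w, with w the weighted mean: the right-hand sides
  average to 0. Equality forces both quotients to be 1.\<close>

lemma weighted_am_gm:
  fixes u v s :: real
  assumes "u > 0" "v > 0" "0 < s" "s < 1"
  shows "u powr s * v powr (1-s) \<le> s * u + (1-s) * v"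
    and "u powr s * v powr (1-s) = s * u + (1-s) * v \<Longrightarrow> u = v"
proof -
  define w where "w = s * u + (1-s) * v"
  have w: "w > 0" unfolding w_def using assms by (intro add_pos_pos mult_pos_pos) auto
  have uw: "ln (u/w) \<le> u/w - 1" "ln (v/w) \<le> v/w - 1" using assms w by (auto intro!: ln_le_minus_one)
  have lnp: "ln (u powr s * v powr (1-s)) = s * ln (u/w) + (1-s) * ln (v/w) + ln w"
    using assms w by (simp add: ln_mult ln_powr ln_div algebra_simps)
  have sum0: "s * (u/w - 1) + (1-s) * (v/w - 1) = 0"
    using w by (simp add: field_simps) (simp add: w_def algebra_simps)
  have le: "s * ln (u/w) \<le> s * (u/w - 1)" "(1-s) * ln (v/w) \<le> (1-s) * (v/w - 1)"
    using uw assms by (auto intro!: mult_left_mono)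
  have "ln (u powr s * v powr (1-s)) \<le> ln w" using lnp sum0 le by linarith
  thus "u powr s * v powr (1-s) \<le> s * u + (1-s) * v" using w assms by (simp add: w_def)
  assume "u powr s * v powr (1-s) = s * u + (1-s) * v"
  hence "ln (u powr s * v powr (1-s)) = ln w" by (simp add: w_def)
  hence "s * ln (u/w) = s * (u/w - 1)" "(1-s) * ln (v/w) = (1-s) * (v/w - 1)" using lnp sum0 le by linarith+
  hence "ln (u/w) = u/w - 1" "ln (v/w) = v/w - 1" using assms by auto
  hence "u/w = 1" "v/w = 1" using assms w ln_eq_minus_one[of "u/w"] ln_eq_minus_one[of "v/w"] by simp_all
  thus "u = v" using w by simp
qed

text \<open>The weights \<open>b\<close> and \<open>\<alpha>\<close> are found by requiring that for \<open>M = Mbar\<close> the divergence of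
  \<open>x\<^sup>-\<^sup>\<alpha> y\<^sup>b F(x, y)\<close> vanishes at the fixed point and that the arithmetic-geometric mean inequality
  is sharp there; \<open>Z0\<close> is the value of \<open>x\<^sup>p / y\<close> at that point.\<close>

lemma emden_young:
  fixes a K p q m b \<alpha> Z0 :: real
  assumes p1: "p > 1" and a0: "a > 0" and K0: "K > 0" and Ka: "K < a" and q: "q = 2*p/(p+1)"
    and Z0: "Z0 = K + (a-K)/q" and b: "b = (a-K)/(K+p*Z0)" and \<alpha>: "\<alpha> = p*b*Z0/a"
    and m0: "m > 0" and m: "m \<le> (a-K)/q * (a powr (-(p/(p+1))) * Z0 powr (-(1/(p+1))))"
  shows "b > 0" "\<alpha> > 0" "\<alpha> < 1" "a*(1-\<alpha>) = K*(b+1)"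
    "\<And>x y. 0 < x \<Longrightarrow> 0 < y \<Longrightarrow> m*(q+b)*y powr (q-1) \<le> \<alpha>*(y/x) + b*(x powr p/y)"
    "\<And>x y. 0 < x \<Longrightarrow> 0 < y \<Longrightarrow> m*(q+b)*y powr (q-1) = \<alpha>*(y/x) + b*(x powr p/y) \<Longrightarrow>
                      \<alpha>*(y/x) = p*b*(x powr p/y)"
proof -
  have q0: "q > 0" using p1 by (simp add: q)
  have Z0p: "Z0 > 0" unfolding Z0 using K0 Ka q0 by (intro add_pos_pos) auto
  have KZ: "K + p*Z0 > 0" using K0 p1 Z0p by (intro add_pos_pos) auto
  show b0: "b > 0" unfolding b using Ka KZ by simp
  show \<alpha>0: "\<alpha> > 0" unfolding \<alpha> using p1 b0 Z0p a0 by simp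
  have bK: "b * (K + p*Z0) = a - K" using KZ by (simp add: b)
  have a\<alpha>: "a * \<alpha> = p*b*Z0" using a0 by (simp add: \<alpha>)
  show rel: "a*(1-\<alpha>) = K*(b+1)" using bK a\<alpha> by (simp add: algebra_simps)
  have "a*(1-\<alpha>) > 0" unfolding rel using K0 b0 by simp
  thus \<alpha>1: "\<alpha> < 1" using a0 by (simp add: zero_less_mult_iff)
  \<comment> \<open>With this weight on y/x the powers of x cancel in (y/x)^s (x^p/y)^(1-s), and
    y^(q-1) is left.\<close>
  define s where "s = p/(p+1)"
  have s: "0 < s" "s < 1" "1 - s = 1/(p+1)" "s * (p+1) = p" "(1-s) * (p+1) = 1" using p1 by (auto simp: s_def field_simps)
  \<comment> \<open>The best constant in c y^(q-1) <= \<alpha> (y/x) + b (x^p/y), attained at y/x =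
    a and x^p/y = Z0. By \<open>bZ\<close> it is q+b times the largest admissible
    \<open>m\<close>.\<close>
  define c where "c = b*Z0*(p+1) * (a powr (-s) * Z0 powr (-(1-s)))"
  have bZ: "(a-K)/q * (q+b) = b*(p+1)*Z0"
  proof -
    have "(K+p*Z0)*(q+b) = (K+p*Z0)*q + (a-K)" using bK by (simp add: algebra_simps)
    also have "a - K = q * Z0 - q * K" using q0 by (simp add: Z0 field_simps)
    also have "(K+p*Z0)*q + (q * Z0 - q * K) = q * (p+1) * Z0" by (simp add: algebra_simps)
    finally have "b * ((K+p*Z0)*(q+b)) = b * (q * (p+1) * Z0)" by simp
    hence "(a-K) * (q+b) = b * (q * (p+1) * Z0)" using bK by (metis mult.assoc)
    thus ?thesis using q0 by (simp add: field_simps)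
  qed
  have "m * (q+b) \<le> (a-K)/q * (a powr (-s) * Z0 powr (-(1-s))) * (q+b)"
    using m q0 b0 unfolding s(3) by (intro mult_right_mono) (auto simp: s_def)
  also have "\<dots> = c" unfolding c_def using bZ by (metis (no_types, lifting) mult.assoc mult.commute)
  finally have mc: "m * (q+b) \<le> c" .
  {
    fix x y :: real assume xy: "0 < x" "0 < y"
    define Y Z where "Y = y/x" and "Z = x powr p/y"
    have YZ: "Y > 0" "Z > 0" using xy by (auto simp: Y_def Z_def)
    have W: "y powr (q-1) = Y powr s * Z powr (1-s)"
    proof -
      have "Y powr s * Z powr (1-s) = (y powr s * x powr (p * (1-s))) / (x powr s * y powr (1-s))"
        using xy by (simp add: Y_def Z_def powr_divide powr_powr)
      also have "p * (1-s) = s" unfolding s(3) by (simp add: s_def)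
      also have "(y powr s * x powr s) / (x powr s * y powr (1-s)) = y powr s / y powr (1-s)" using xy by simp
      also have "\<dots> = y powr (s - (1-s))" by (simp only: powr_diff)
      also have "s - (1-s) = q - 1" unfolding s(3) q using p1 by (simp add: s_def divide_simps)
      finally show ?thesis by simp
    qed
    define u v where "u = Y/a" and "v = Z/Z0"
    have uv: "u > 0" "v > 0" using YZ a0 Z0p by (auto simp: u_def v_def)
    have "\<alpha> * Y + b * Z = b * Z0 * (p * u + v)"
      using a0 Z0p by (simp add: \<alpha> u_def v_def field_simps)
    also have "p * u + v = (p+1) * (s * u + (1-s) * v)"
    proof -
      have "(p+1) * (s * u + (1-s) * v) = (s * (p+1)) * u + ((1-s) * (p+1)) * v" by (simp add: algebra_simps)
      thus ?thesis unfolding s(4,5) by simp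
    qed
    finally have sum: "\<alpha> * Y + b * Z = b * Z0 * (p+1) * (s * u + (1-s) * v)" by simp
    have cW: "c * y powr (q-1) = b * Z0 * (p+1) * (u powr s * v powr (1-s))"
      unfolding W c_def u_def v_def by (simp only: powr_divide powr_minus) (simp add: field_simps)
    have pos: "b * Z0 * (p+1) > 0" using b0 Z0p p1 by simp
    note ag = weighted_am_gm[OF uv s(1,2)]
    have 1: "m*(q+b)*y powr (q-1) \<le> c * y powr (q-1)" using mc by (intro mult_right_mono) auto
    have 2: "c * y powr (q-1) \<le> \<alpha> * Y + b * Z" unfolding cW sum using ag(1) pos by (intro mult_left_mono) auto
    show "m*(q+b)*y powr (q-1) \<le> \<alpha>*(y/x) + b*(x powr p/y)"
      using 1 2 unfolding Y_def Z_def by linarith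
    assume "m*(q+b)*y powr (q-1) = \<alpha>*(y/x) + b*(x powr p/y)"
    hence "c * y powr (q-1) = \<alpha> * Y + b * Z" using 1 2 unfolding Y_def Z_def by linarith
    hence "u powr s * v powr (1-s) = s * u + (1-s) * v" unfolding cW sum using pos by (metis less_irrefl mult_left_cancel)
    hence "u = v" by (rule ag(2))
    hence "Y * Z0 = Z * a" using a0 Z0p by (simp add: u_def v_def field_simps)
    hence "\<alpha> * Y = p * b * Z" using a0 by (simp add: \<alpha> field_simps)
    thus "\<alpha>*(y/x) = p*b*(x powr p/y)" unfolding Y_def Z_def .
  }
qed

text \<open>The right-hand side is the m for which the trace a - K - q m y^(q-1) vanishes at the
  fixed point: there x^p/y = K + m y^(q-1) = Z0 and y^(q-1) = a^s Z0^(1-s). Writing a and Z0 over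
  the common denominator \<open>g\<close> gives the closed form, since the exponents s and 1-s
  recombine to one factor \<open>g\<close>.\<close>

lemma Mbar_eq:
  fixes N :: nat and p :: real
  assumes p1: "p > 1" and N: "N \<ge> 3" and a: "a = 2/(p-1)" and q: "q = 2*p/(p+1)" and K: "K = real N - 2 - a"
    and Z0: "Z0 = K + (a-K)/q"
  shows "- Mbar N p = (a-K)/q * (a powr (-(p/(p+1))) * Z0 powr (-(1/(p+1))))"
proof -
  define n where "n = real N - 2"
  have n: "n \<ge> 1" using N by (simp add: n_def)
  define D where "D = n * (p-1)^2 + 4"
  have D: "D > 0" using n by (simp add: D_def add_nonneg_pos)
  define s where "s = p/(p+1)"
  have s1: "1/(p+1) = 1 - s" using p1 by (simp add: s_def field_simps)
  define g where "g = 2*p*(p-1)"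
  have g: "g > 0" using p1 by (simp add: g_def)
  have Kn: "K = n - a" by (simp add: K n_def)
  have aK: "(a-K)/q = (p+1) * (n + 4 - n*p) / g"
    unfolding q Kn a g_def using p1 by (simp add: divide_simps) (simp add: algebra_simps)
  have Z0D: "Z0 = D / g"
    unfolding Z0 aK unfolding Kn a g_def D_def using p1 by (simp add: divide_simps) (simp add: algebra_simps power2_eq_square)
  have ag: "a = 4 * p / g" unfolding a g_def using p1 by (simp add: field_simps)
  have "a powr s * Z0 powr (1-s) = (4*p) powr s * D powr (1-s) / (g powr s * g powr (1-s))"
    unfolding Z0D unfolding ag using p1 g D by (simp add: powr_divide)
  also have "g powr s * g powr (1-s) = g" using g by (simp add: powr_add[symmetric])
  finally have prod: "a powr s * Z0 powr (1-s) = (4*p) powr s * D powr (1-s) / g" .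
  have "(a-K)/q * (a powr (-s) * Z0 powr (-(1-s))) = (a-K)/q / (a powr s * Z0 powr (1-s))"
    by (simp only: powr_minus) (simp add: field_simps)
  also have "\<dots> = (p+1) * (n + 4 - n*p) / ((4*p) powr s * D powr (1-s))"
    unfolding prod aK using g by simp
  also have "\<dots> = - Mbar N p"
  proof -
    have num: "(real N - 2) * p - real N - 2 = - (n + 4 - n*p)" by (simp add: n_def algebra_simps)
    show ?thesis unfolding Mbar_def num s1 s_def[symmetric] unfolding n_def[symmetric] D_def[symmetric]
      by (simp only: mult_minus_right minus_divide_left[symmetric] minus_minus)
  qed
  finally show ?thesis unfolding s1 s_def[symmetric] by simp
qed

lemma equilibrium_exists:
  fixes a K p q m :: real
  assumes p1: "p > 1" and a0: "a > 0" and K0: "K > 0" and q: "1 < q" "q < p" and m0: "m > 0"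
  obtains X where "X > 0" "X powr (p-1) - m * a powr q * X powr (q-1) - a * K = 0"
    "\<And>x. 0 < x \<Longrightarrow> x < X \<Longrightarrow> x powr (p-1) - m * a powr q * x powr (q-1) - a * K < 0"
    "\<And>x. X < x \<Longrightarrow> x powr (p-1) - m * a powr q * x powr (q-1) - a * K > 0"
proof -
  define f where "f = (\<lambda>x. x powr (p-1) - m * a powr q * x powr (q-1) - a * K)"
  \<comment> \<open>Dividing the equation by x^(q-1) isolates the gradient term as a constant and
    leaves a strictly increasing function, hence exactly one sign change.\<close>
  define \<phi> where "\<phi> = (\<lambda>x. x powr (p-q) - a * K * x powr (-(q-1)))"
  have f\<phi>: "f x = x powr (q-1) * (\<phi> x - m * a powr q)" if "x > 0" for x
  proof -
    have "x powr (q-1) * x powr (p-q) = x powr (p-1)" "x powr (q-1) * x powr (-(q-1)) = 1"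
      using that by (simp_all add: powr_add[symmetric])
    hence "x powr (q-1) * \<phi> x = x powr (p-1) - a * K"
      unfolding \<phi>_def by (metis (no_types, lifting) mult.left_commute mult.right_neutral right_diff_distrib)
    thus ?thesis by (simp add: f_def right_diff_distrib mult_ac)
  qed
  have \<phi>mono: "\<phi> x < \<phi> y" if "0 < x" "x < y" for x y
  proof -
    have "x powr (p-q) < y powr (p-q)" using that q by (intro powr_less_mono2) auto
    moreover have "y powr (-(q-1)) \<le> x powr (-(q-1))" using that q by (intro powr_mono2') auto
    hence "a * K * y powr (-(q-1)) \<le> a * K * x powr (-(q-1))" using a0 K0 by (intro mult_left_mono) auto
    ultimately show ?thesis by (simp add: \<phi>_def)
  qed
  have "filterlim (\<lambda>x. 1 * x powr (p-1) - m * a powr q * x powr (q-1)) at_top at_top"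
    using q by real_asymp
  hence "\<forall>\<^sub>F x in at_top. 1 * x powr (p-1) - m * a powr q * x powr (q-1) \<ge> a * K" unfolding filterlim_at_top by blast
  with eventually_ge_at_top[of "0::real"] have "\<forall>\<^sub>F x in at_top. x \<ge> 0 \<and> f x \<ge> 0"
    by eventually_elim (simp add: f_def)
  then obtain R where R: "R \<ge> 0" "f R \<ge> 0" using eventually_happens[of _ at_top] by fastforce
  have "continuous_on {0..R} f" unfolding f_def using p1 q by (auto intro!: continuous_intros continuous_on_powr')
  moreover have f0: "f 0 < 0" using a0 K0 by (simp add: f_def)
  ultimately obtain X where X: "0 \<le> X" "f X = 0" using IVT'[of f 0 0 R] R by auto
  have X0: "X > 0" using X f0 by (cases "X = 0") auto
  have \<phi>X: "\<phi> X = m * a powr q" using f\<phi>[OF X0] X X0 by simp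
  show thesis
  proof (rule that[OF X0])
    show "X powr (p-1) - m * a powr q * X powr (q-1) - a * K = 0" using X by (simp add: f_def)
    fix x :: real
    show "x powr (p-1) - m * a powr q * x powr (q-1) - a * K < 0" if "0 < x" "x < X"
    proof -
      have "f x < 0" unfolding f\<phi>[OF that(1)] using \<phi>mono[OF that] \<phi>X that by (simp add: mult_less_0_iff)
      thus ?thesis by (simp add: f_def)
    qed
    show "x powr (p-1) - m * a powr q * x powr (q-1) - a * K > 0" if "X < x"
    proof -
      have x: "x > 0" using that X0 by simp
      have "f x > 0" unfolding f\<phi>[OF x] using \<phi>mono[OF X0 that] \<phi>X x by simp
      thus ?thesis by (simp add: f_def)
    qed
  qed
qed

theorem theorem4p12:
  fixes N :: nat and p M :: real
  assumes "N \<ge> 3"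
    and "real N / (real N - 2) < p" and "p < (real N + 2) / (real N - 2)"
    and "Mbar N p \<le> M" and "M < 0"
  shows "(\<nexists>u. ground_state N p M u) \<and>
         (\<exists>u. singular_sol N p M u \<and>
            (\<forall>v. singular_sol N p M v \<longrightarrow>
                 (\<exists>k>0. \<forall>r>0. v r = k powr (2 / (p - 1)) * u (k * r))))"
proof -
  define n where "n = real N - 2"
  have n: "n \<ge> 1" using assms(1) by (simp add: n_def)
  have p: "n + 2 < n * p" "n * p < n + 4"
    using assms(2,3) n by (simp_all add: n_def field_simps)
  hence "n * (p - 1) > 0" by (simp add: algebra_simps)
  hence p1: "p > 1" using n by (simp add: zero_less_mult_iff)
  define a where "a = 2 / (p-1)"
  define K where "K = n - a"
  define q where "q = 2*p/(p+1)"
  define m where "m = - M"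
  define Z0 where "Z0 = K + (a-K)/q"
  define b where "b = (a-K)/(K+p*Z0)"
  define \<alpha> where "\<alpha> = p*b*Z0/a"
  have a0: "a > 0" using p1 by (simp add: a_def)
  \<comment> \<open>The two bounds on p become K > 0 and K < a: the first makes the origin a saddle,
    the second makes \<open>b\<close> positive.\<close>
  have "2 / (p-1) < n" "n < 4 / (p-1)" using p p1 by (simp_all add: divide_less_eq less_divide_eq algebra_simps)
  hence K0: "K > 0" and Ka: "K < a" by (simp_all add: K_def a_def)
  have m0: "m > 0" using assms(5) by (simp add: m_def)
  have q1: "1 < q" "q < p" using p1 unfolding q_def by (auto simp: field_simps)
  have "m \<le> - Mbar N p" using assms(4) by (simp add: m_def)
  also have "\<dots> = (a-K)/q * (a powr (-(p/(p+1))) * Z0 powr (-(1/(p+1))))"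
    by (rule Mbar_eq[OF p1 assms(1) a_def q_def _ Z0_def]) (simp add: K_def n_def)
  finally have m: "m \<le> (a-K)/q * (a powr (-(p/(p+1))) * Z0 powr (-(1/(p+1))))" .
  obtain X where X0: "X > 0" and Xeq: "X powr (p-1) - m * a powr q * X powr (q-1) - a * K = 0"
    and Xb: "\<And>x. 0 < x \<Longrightarrow> x < X \<Longrightarrow> x powr (p-1) - m * a powr q * x powr (q-1) - a * K < 0"
    and Xa: "\<And>x. X < x \<Longrightarrow> x powr (p-1) - m * a powr q * x powr (q-1) - a * K > 0"
    using equilibrium_exists[OF p1 a0 K0 q1 m0] by blast
  have scale: "x powr p - (K * (a*x) + m * (a*x) powr q) = x * (x powr (p-1) - m * a powr q * x powr (q-1) - a * K)" if "x > 0" for x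
    using that a0 by (simp add: powr_mult powr_diff right_diff_distrib)
  note Y = emden_young[OF p1 a0 K0 Ka q_def Z0_def b_def \<alpha>_def m0 m]
  interpret emden_radial a K p q m b \<alpha> X N
  proof
    show "x powr p < K * (a*x) + m * (a*x) powr q" if "0 < x" "x < X" for x
      using scale[OF that(1)] mult_pos_neg[OF that(1) Xb[OF that]] by linarith
    show "K * (a*x) + m * (a*x) powr q < x powr p" if "X < x" for x
    proof -
      have x: "x > 0" using that X0 by simp
      show ?thesis using scale[OF x] mult_pos_pos[OF x Xa[OF that]] by linarith
    qed
    show "real N - 2 = a + K" by (simp add: K_def n_def)
  qed (fact a0 K0 p1 q_def m0 Y X0 a_def)+
  have XM: "X_M N p (-m) = X"
  proof -
    \<comment> \<open>In terms of a, K, q and m the equation defining \<open>X_M\<close> is the rest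
      point equation on y = a x, divided by x.\<close>
    have qe: "(p-1)/(p+1) = q - 1" using p1 by (simp add: q_def field_simps)
    have Ke: "2 * K_const N p / (p-1) = a * K"
      unfolding K_const_def a_def K_def n_def using p1 by (simp add: field_simps)
    show ?thesis unfolding X_M_def q_def[symmetric] a_def[symmetric] qe Ke
    proof (rule the_equality)
      show "0 < X \<and> X powr (p-1) + - m * a powr q * X powr (q-1) - a * K = 0" using X0 Xeq by simp
      show "x = X" if "0 < x \<and> x powr (p-1) + - m * a powr q * x powr (q-1) - a * K = 0" for x
        using that Xb[of x] Xa[of x] by (cases x X rule: linorder_cases) auto
    qed
  qed
  have M: "M = - m" by (simp add: m_def)
  obtain u where u: "singular_sol N p M u" using singular_sol_exists[OF XM] unfolding M by blast
  show ?thesis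
    using no_ground_state u singular_sol_unique_up_to_scaling[OF u[unfolded M]] unfolding M a_def by blast
qed

end
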